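(* Let $X$ be a compact metric space and $G$ a countable infinite discrete amenable group acting continuously on $X$. Suppose $(X,G)$ satisfies the $g$-almost product property (for some mistake-density function $g$). Let $K\subset M(X,G)$ be a nonempty compact connected set and let $\{F_n\}$ be a Følner sequence of $G$. Then \[ h^{UC}_{top}(Y_K,\{F_n\}) = h_{top}(X,\{F_n\}) = h_{top}(X,G). \]
   Context: $M(X)$ denotes the Borel probability measures on $X$ with the weak$^*$ topology, $M(X,G)$ the $G$-invariant ones, $E(X,G)$ the ergodic ones; $h_{top}(X,G)$ is the topological entropy of the action and $h_\mu(X,G)$ the measure-theoretic entropy. $F(G)$ is the set of finite subsets of $G$. A sequence $\{F_n\}\subset F(G)$ is Følner if $|sF_n\triangle F_n|/|F_n|\to 0$ for every $s\in G$. For $K\in F(G)$, $F\in F(G)$, $\partial_K(F)=\{c\in G: Kc\cap F\neq\emptyset,\ Kc\cap (G\setminus F)\neq\emptyset\}$, and $F$ is $(K,\delta)$-invariant if $|\partial_K(F)|/|F|<\delta$. Fix a countable separating family $\{\varphi_i\}$ of continuous functions on $X$ with $0\le\varphi_i\le 1$ and define $D(\mu,\nu)=\sum_i 2^{-i}|\int\varphi_i\,d\mu-\int\varphi_i\,d\nu|$ on $M(X)$; the metric on $X$ is $\rho(x,y)=D(\delta_x,\delta_y)$. For $F\in F(G)$, $\rho_F(x,y)=\max_{s\in F}\rho(sx,sy)$. Empirical measure: $\mathcal{E}_F(x)=\frac{1}{|F|}\sum_{s\in F}\delta_{sx}$. $V(x,\{F_n\})$ is the set of limit points of $\{\mathcal{E}_{F_n}(x)\}$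 in $M(X)$, and $Y_K=\{x\in X: V(x,\{F_n\})=K\}$ (the saturated set of $K$). Upper capacity entropy: for $Z\subset X$, $F\in F(G)$, $\varepsilon>0$, a set $E\subset Z$ is $(F,\varepsilon)$-separated if $\rho_F(x,y)>\varepsilon$ for distinct $x,y\in E$; $s_F(Z,\varepsilon)$ is the largest cardinality of such a set. $h^{UC}_{top}(Z,\{F_n\})=\lim_{\varepsilon\to0}\limsup_{n\to\infty}\frac{1}{|F_n|}\log s_{F_n}(Z,\varepsilon)$, and $h_{top}(X,\{F_n\}):=h^{UC}_{top}(X,\{F_n\})$. $g$-almost product property: a mistake-density function is a nondecreasing $g:(0,1)\to(0,1)$ with $\lim_{r\to0}g(r)=0$. For $F\in F(G)$, $x\in X$, $\varepsilon>0$, set $B(g;F,x,\varepsilon)=\{y\in X: |\{s\in F:\rho(sx,sy)>\varepsilon\}|\le g(\varepsilon)|F|\}$. $(X,G)$ has the $g$-almost product property if there is a map $m:(0,1)\to F(G)\times(0,1)$ such that for every $k\in\mathbb N$, every $\varepsilon_1,\dots,\varepsilon_k\in(0,1)$, every $x_1,\dots,x_k\in X$ and every pairwise disjoint $F_1,\dots,F_k\in F(G)$ with each $F_i$ being $m(\varepsilon_i)$-invariant (i.e. $(K,\delta)$-invariant where $m(\varepsilon_i)=(K,\delta)$), one has $\bigcap_{i=1}^k B(g;F_i,x_i,\varepsilon_i)\neq\emptyset$. *)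

theory Defs
  imports "HOL-Probability.Probability"
begin

text \<open>The group G is a type of class group_add (not necessarily commutative);
  the group product gh is written g + h, the identity is 0.
  An action T of G on X satisfies T 0 = id and T (g + h) = T g o T h.\<close>

definition Kboundary :: "'g::group_add set \<Rightarrow> 'g set \<Rightarrow> 'g set" where
  "Kboundary K F = {c. ((\<lambda>k. k + c) ` K) \<inter> F \<noteq> {} \<and> ((\<lambda>k. k + c) ` K) \<inter> (UNIV - F) \<noteq> {}}"

definition KD_invariant :: "'g::group_add set \<Rightarrow> real \<Rightarrow> 'g set \<Rightarrow> bool" where
  "KD_invariant K \<delta> F \<longleftrightarrow> finite F \<and> F \<noteq> {} \<and> real (card (Kboundary K F)) / real (card F) < \<delta>"

definition Foelner_seq :: "(nat \<Rightarrow> 'g::group_add set) \<Rightarrow> bool" where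
  "Foelner_seq Fn \<longleftrightarrow> (\<forall>n. finite (Fn n) \<and> Fn n \<noteq> {}) \<and>
     (\<forall>s. ((\<lambda>n. real (card ((((+) s) ` Fn n - Fn n) \<union> (Fn n - ((+) s) ` Fn n))) / real (card (Fn n)))
            \<longlonglongrightarrow> 0))"

definition amenable_group :: "'g::{group_add,countable} itself \<Rightarrow> bool" where
  "amenable_group _ \<longleftrightarrow> (\<exists>Fn::nat \<Rightarrow> 'g set. Foelner_seq Fn)"

definition is_action :: "('g::group_add \<Rightarrow> 'a::topological_space \<Rightarrow> 'a) \<Rightarrow> bool" where
  "is_action T \<longleftrightarrow> T 0 = id \<and> (\<forall>g h. T (g + h) = T g \<circ> T h) \<and> (\<forall>g. continuous_on UNIV (T g))"

definition Foelner_filter :: "'g::group_add set filter" where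
  "Foelner_filter = (INF p \<in> {(K, \<delta>). finite K \<and> \<delta> > 0}. principal {F. KD_invariant (fst p) (snd p) F})"

definition Mprob :: "'a::topological_space measure set" where
  "Mprob = {\<mu>. prob_space \<mu> \<and> sets \<mu> = sets borel}"

definition Minv :: "('g \<Rightarrow> 'a::topological_space \<Rightarrow> 'a) \<Rightarrow> 'a measure set" where
  "Minv T = {\<mu> \<in> Mprob. \<forall>g. distr \<mu> borel (T g) = \<mu>}"

definition weak_star :: "'a::topological_space measure topology" where
  "weak_star = topology_generated_by
     {{\<mu> \<in> Mprob. (\<integral>x. f x \<partial>\<mu>) \<in> U} | (f :: 'a \<Rightarrow> real) U. continuous_on UNIV f \<and> open U}"

definition empirical :: "('g \<Rightarrow> 'a::topological_space \<Rightarrow> 'a) \<Rightarrow> 'g set \<Rightarrow> 'a \<Rightarrow> 'a measure" where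
  "empirical T F x = distr (uniform_count_measure F) borel (\<lambda>s. T s x)"

definition Vlimits :: "('g \<Rightarrow> 'a::topological_space \<Rightarrow> 'a) \<Rightarrow> 'a \<Rightarrow> (nat \<Rightarrow> 'g set) \<Rightarrow> 'a measure set" where
  "Vlimits T x Fn = {\<mu> \<in> Mprob. \<exists>r. strict_mono r \<and>
      limitin weak_star (\<lambda>n. empirical T (Fn (r n)) x) \<mu> sequentially}"

definition saturated :: "('g \<Rightarrow> 'a::topological_space \<Rightarrow> 'a) \<Rightarrow> (nat \<Rightarrow> 'g set) \<Rightarrow> 'a measure set \<Rightarrow> 'a set" where
  "saturated T Fn K = {x. Vlimits T x Fn = K}"

definition dist_F :: "('g \<Rightarrow> 'a::metric_space \<Rightarrow> 'a) \<Rightarrow> 'g set \<Rightarrow> 'a \<Rightarrow> 'a \<Rightarrow> real" where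
  "dist_F T F x y = Max ((\<lambda>s. dist (T s x) (T s y)) ` F)"

definition separated :: "('g \<Rightarrow> 'a::metric_space \<Rightarrow> 'a) \<Rightarrow> 'g set \<Rightarrow> real \<Rightarrow> 'a set \<Rightarrow> bool" where
  "separated T F \<epsilon> E \<longleftrightarrow> (\<forall>x\<in>E. \<forall>y\<in>E. x \<noteq> y \<longrightarrow> dist_F T F x y > \<epsilon>)"

definition sep_num :: "('g \<Rightarrow> 'a::metric_space \<Rightarrow> 'a) \<Rightarrow> 'g set \<Rightarrow> 'a set \<Rightarrow> real \<Rightarrow> nat" where
  "sep_num T F Z \<epsilon> = Sup {card E | E. E \<subseteq> Z \<and> finite E \<and> separated T F \<epsilon> E}"

definition hUC :: "('g \<Rightarrow> 'a::metric_space \<Rightarrow> 'a) \<Rightarrow> 'a set \<Rightarrow> (nat \<Rightarrow> 'g set) \<Rightarrow> ereal" where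
  "hUC T Z Fn = Lim (at_right 0)
     (\<lambda>\<epsilon>. limsup (\<lambda>n. ereal (ln (real (sep_num T (Fn n) Z \<epsilon>)) / real (card (Fn n)))))"

definition open_cover :: "'a::topological_space set set \<Rightarrow> bool" where
  "open_cover U \<longleftrightarrow> (\<forall>W\<in>U. open W) \<and> \<Union>U = UNIV"

definition cover_num :: "'a set set \<Rightarrow> nat" where
  "cover_num U = Inf {card V | V. V \<subseteq> U \<and> finite V \<and> \<Union>V = UNIV}"

definition join_cover :: "('g \<Rightarrow> 'a \<Rightarrow> 'a) \<Rightarrow> 'g set \<Rightarrow> 'a set set \<Rightarrow> 'a set set" where
  "join_cover T F U = {(\<Inter>s\<in>F. T s -` W s) | W. \<forall>s\<in>F. W s \<in> U}"

definition htop :: "('g::group_add \<Rightarrow> 'a::topological_space \<Rightarrow> 'a) \<Rightarrow> ereal" where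
  "htop T = (SUP U \<in> {U. open_cover U}.
      ereal (Lim Foelner_filter (\<lambda>F. ln (real (cover_num (join_cover T F U))) / real (card F))))"

definition mistake_density :: "(real \<Rightarrow> real) \<Rightarrow> bool" where
  "mistake_density g \<longleftrightarrow> (\<forall>r\<in>{0<..<1}. g r \<in> {0<..<1}) \<and> mono_on {0<..<1} g \<and>
     (g \<longlongrightarrow> 0) (at_right 0)"

definition Bball :: "('g \<Rightarrow> 'a::metric_space \<Rightarrow> 'a) \<Rightarrow> (real \<Rightarrow> real) \<Rightarrow> 'g set \<Rightarrow> 'a \<Rightarrow> real \<Rightarrow> 'a set" where
  "Bball T g F x \<epsilon> = {y. real (card {s\<in>F. dist (T s x) (T s y) > \<epsilon>}) \<le> g \<epsilon> * real (card F)}"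

definition g_almost_product :: "('g::group_add \<Rightarrow> 'a::metric_space \<Rightarrow> 'a) \<Rightarrow> (real \<Rightarrow> real) \<Rightarrow> bool" where
  "g_almost_product T g \<longleftrightarrow> (\<exists>m :: real \<Rightarrow> 'g set \<times> real.
     (\<forall>\<epsilon>\<in>{0<..<1}. finite (fst (m \<epsilon>)) \<and> snd (m \<epsilon>) \<in> {0<..<1}) \<and>
     (\<forall>(k::nat) (eps :: nat \<Rightarrow> real) (xs :: nat \<Rightarrow> 'a) (Fs :: nat \<Rightarrow> 'g set).
        (\<forall>i<k. eps i \<in> {0<..<1} \<and> finite (Fs i) \<and> KD_invariant (fst (m (eps i))) (snd (m (eps i))) (Fs i)) \<and>
        (\<forall>i<k. \<forall>j<k. i \<noteq> j \<longrightarrow> Fs i \<inter> Fs j = {}) \<longrightarrow>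
        (\<Inter>i<k. Bball T g (Fs i) (xs i) (eps i)) \<noteq> {}))"

end

theory Submission
  imports Defs
begin

text \<open>The two entropies of the whole space agree by comparing separated sets with open covers; the
  limit along the Foelner filter exists by the Ornstein-Weiss lemma, which rests on quasi-tilings of the
  group. For the saturated set, tile the group by a sequence of finer and finer invariant tilings such
  that every set of the Foelner sequence, from some index on, is almost exhausted by tiles of two
  consecutive levels. Points whose averages over the tiles of level j are close to the measure
  \<alpha> j can be glued by the almost product property; since the measures \<alpha> j move
  through K in small steps and accumulate at every point of K, the glued point is saturated for K. The
  gluing may prescribe any orbit segment on one given set of the Foelner sequence up to few mistakes,
  and the number of ways to place the mistakes is subexponential, so the saturated set contains as many
  separated orbits as the whole space.\<close>

subsection \<open>Quasi-tilings and the Ornstein-Weiss lemma\<close>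

text \<open>Upper capacity entropy inspects one index n at a time, and limit points of empirical
  measures ignore any finite part of an orbit. So for each n a separate family of saturated points
  may be counted, free on \<open>Fn n\<close> and constrained only elsewhere; this is why one
  prescribed set suffices for full entropy. Two obstacles shape the construction. The measures in
  \<open>K\<close> need not be ergodic and the Foelner sequence need not be tempered, so no
  pointwise ergodic theorem supplies orbit segments with the right averages; they are glued from
  bounded tiles on which points are chosen so that their errors cancel. Moreover the sets
  \<open>Fn n\<close> need be neither nested nor disjoint, yet a single point must serve all of
  them: one set may contain tiles settled at earlier levels and tiles of later ones. Tiles are
  therefore fixed level by level, each set is judged at the stage of its index, and the tiles
  touching the part settled long before must be negligible in all later sets. That holds because
  this part is finite and \<open>card (Fn n)\<close> tends to infinity in an infinite group.\<close>

abbreviation rtr :: "'g::group_add set \<Rightarrow> 'g \<Rightarrow> 'g set" where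
  "rtr T c \<equiv> (\<lambda>t. t + c) ` T"

lemma card_rtr [simp]: "card (rtr T c) = card T"
  by (simp add: card_image)

lemma Kboundary_iff: "c \<in> Kboundary K F \<longleftrightarrow> (\<exists>k\<in>K. k + c \<in> F) \<and> (\<exists>k\<in>K. k + c \<notin> F)"
  unfolding Kboundary_def by auto

lemma Kboundary_mono: "K \<subseteq> K' \<Longrightarrow> Kboundary K F \<subseteq> Kboundary K' F"
  unfolding Kboundary_def by blast

lemma finite_Kboundary:
  assumes "finite K" "finite F"
  shows "finite (Kboundary K F)"
proof -
  have "Kboundary K F \<subseteq> (\<Union>k\<in>K. (\<lambda>f. - k + f) ` F)"
    by (force simp: Kboundary_iff image_iff add.assoc[symmetric])
  then show ?thesis
    using assms by (auto intro: finite_subset)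
qed

text \<open>Boundaries multiply by \<open>K\<close> from the left while tiles move from the right,
  and the two commute. Hence all right translates of a shape are equally invariant, which is why
  only these serve as tiles.\<close>

lemma Kboundary_rtr: "Kboundary K (rtr F a) = rtr (Kboundary K F) a"
proof -
  have mem: "x \<in> rtr F a \<longleftrightarrow> x - a \<in> F" for x and F :: "'a set"
    by (force simp: image_iff)
  show ?thesis
    by (auto simp: set_eq_iff mem Kboundary_iff add_diff_eq)
qed

lemma KD_invariant_mono:
  assumes "KD_invariant K' \<delta>' F" "K \<subseteq> K'" "\<delta>' \<le> \<delta>" "finite K'"
  shows "KD_invariant K \<delta> F"
proof -
  have "card (Kboundary K F) \<le> card (Kboundary K' F)"
    using assms by (intro card_mono finite_Kboundary Kboundary_mono) (auto simp: KD_invariant_def)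
  then have "real (card (Kboundary K F)) / card F \<le> real (card (Kboundary K' F)) / card F"
    by (simp add: divide_right_mono)
  then show ?thesis
    using assms by (auto simp: KD_invariant_def)
qed

section \<open>The filter of increasingly invariant finite sets\<close>

lemma eventually_Foelner_filter:
  "eventually P Foelner_filter \<longleftrightarrow> (\<exists>K \<delta>. finite K \<and> \<delta> > 0 \<and> (\<forall>F. KD_invariant K \<delta> F \<longrightarrow> P F))"
proof -
  have "eventually P Foelner_filter \<longleftrightarrow>
    (\<exists>p \<in> {(K, \<delta>). finite K \<and> \<delta> > 0}. eventually P (principal {F. KD_invariant (fst p) (snd p) F}))"
    unfolding Foelner_filter_def
  proof (rule eventually_INF_base)
    show "{(K::'a set, \<delta>::real). finite K \<and> \<delta> > 0} \<noteq> {}"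
      by (auto intro!: exI[of _ "{}"] exI[of _ 1])
    fix a b :: "'a set \<times> real"
    assume "a \<in> {(K, \<delta>). finite K \<and> \<delta> > 0}" "b \<in> {(K, \<delta>). finite K \<and> \<delta> > 0}"
    then show "\<exists>x\<in>{(K, \<delta>). finite K \<and> \<delta> > 0}. principal {F. KD_invariant (fst x) (snd x) F}
        \<le> inf (principal {F. KD_invariant (fst a) (snd a) F}) (principal {F. KD_invariant (fst b) (snd b) F})"
      by (intro bexI[of _ "(fst a \<union> fst b, min (snd a) (snd b))"])
         (auto intro: KD_invariant_mono)
  qed
  then show ?thesis
    by (auto simp: eventually_principal)
qed

lemma eventually_KD_invariant:
  "finite K \<Longrightarrow> \<delta> > 0 \<Longrightarrow> eventually (KD_invariant K \<delta>) Foelner_filter"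
  by (auto simp: eventually_Foelner_filter)

lemma eventually_finite_Foelner: "eventually (\<lambda>F. finite F \<and> F \<noteq> {}) Foelner_filter"
  unfolding eventually_Foelner_filter by (rule exI[of _ "{}"], rule exI[of _ 1]) (simp add: KD_invariant_def)

text \<open>With fewer than \<open>n\<close> elements, \<open>F\<close> would have less than one
  boundary point, hence none, so a translate of \<open>K\<close> meeting \<open>F\<close> would lie
  inside it although \<open>K\<close> is larger.\<close>

lemma eventually_card_Foelner:
  assumes "infinite (UNIV :: 'g::group_add set)"
  shows "eventually (\<lambda>F::'g set. n \<le> card F) Foelner_filter"
proof -
  obtain K :: "'g set" where K: "finite K" "card K = Suc n"
    using infinite_arbitrarily_large[OF assms] by blast
  have "n \<le> card F" if F: "KD_invariant K (1 / Suc n) F" for F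
  proof (rule ccontr)
    assume "\<not> n \<le> card F"
    have fF: "finite F" "F \<noteq> {}" and lt: "real (card (Kboundary K F)) / card F < 1 / Suc n"
      using F by (auto simp: KD_invariant_def)
    have "real (card (Kboundary K F)) < real (card F) / Suc n"
      using lt fF by (simp add: field_simps card_gt_0_iff)
    also have "... < 1"
      using \<open>\<not> n \<le> card F\<close> by simp
    finally have e: "Kboundary K F = {}"
      using finite_Kboundary[OF K(1) fF(1)] by simp
    obtain f k where fk: "f \<in> F" "k \<in> K"
      using fF K by fastforce
    have "k + (- k + f) \<in> F"
      using fk by (simp add: add.assoc[symmetric])
    then have "rtr K (- k + f) \<subseteq> F"
      using e fk by (force simp: set_eq_iff Kboundary_iff)
    then have "card (rtr K (- k + f)) \<le> card F"
      using fF by (intro card_mono)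
    then show False
      using K \<open>\<not> n \<le> card F\<close> by simp
  qed
  then show ?thesis
    unfolding eventually_Foelner_filter using K
    by (intro exI[of _ K] exI[of _ "1 / Suc n"]) auto
qed

lemma Foelner_seq_filterlim:
  fixes Fn :: "nat \<Rightarrow> 'g::group_add set"
  assumes "Foelner_seq Fn"
  shows "filterlim Fn Foelner_filter sequentially"
  unfolding filterlim_iff
proof (intro allI impI)
  fix P :: "'g set \<Rightarrow> bool"
  assume "eventually P Foelner_filter"
  then obtain K \<delta> where K: "finite K" "\<delta> > 0" "\<And>F. KD_invariant K \<delta> F \<Longrightarrow> P F"
    by (auto simp: eventually_Foelner_filter)
  define D where "D s n = ((+) s ` Fn n - Fn n) \<union> (Fn n - (+) s ` Fn n)" for s n
  have fF: "finite (Fn n)" "Fn n \<noteq> {}" for n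
    using assms by (auto simp: Foelner_seq_def)
  have fD: "finite (D s n)" for s n
    using fF by (auto simp: D_def)
  have lim: "(\<lambda>n. \<Sum>k\<in>K. \<Sum>k'\<in>K. real (card (D (k - k') n)) / card (Fn n)) \<longlonglongrightarrow> (\<Sum>k\<in>K. \<Sum>k'\<in>K. 0)"
    using assms by (intro tendsto_sum) (auto simp: Foelner_seq_def D_def)
  have bd: "real (card (Kboundary K (Fn n))) / card (Fn n)
      \<le> (\<Sum>k\<in>K. \<Sum>k'\<in>K. real (card (D (k - k') n)) / card (Fn n))" for n
  proof -
    \<comment> \<open>If \<open>k + c\<close> is inside and \<open>k' + c\<close> outside, then
      \<open>k + c\<close> lies in \<open>Fn n\<close> but not in its translate by
      \<open>k - k'\<close>; so finitely many symmetric differences control the whole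
      boundary.\<close>
    have sub: "Kboundary K (Fn n) \<subseteq> (\<Union>k\<in>K. \<Union>k'\<in>K. (\<lambda>f. - k + f) ` D (k - k') n)"
    proof
      fix c assume "c \<in> Kboundary K (Fn n)"
      then obtain k k' where k: "k \<in> K" "k + c \<in> Fn n" "k' \<in> K" "k' + c \<notin> Fn n"
        by (auto simp: Kboundary_iff)
      have "k + c \<notin> (+) (k - k') ` Fn n"
      proof
        assume "k + c \<in> (+) (k - k') ` Fn n"
        then obtain f where "f \<in> Fn n" "k + c = k - k' + f" by auto
        then have "c = - k' + f"
          by (metis add.assoc add_left_cancel diff_conv_add_uminus)
        then have "k' + c = f"
          by (simp add: add.assoc[symmetric])
        then show False using k \<open>f \<in> Fn n\<close> by simp
      qed
      then have "k + c \<in> D (k - k') n"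
        using k by (auto simp: D_def)
      moreover have "c = - k + (k + c)"
        by (simp add: add.assoc[symmetric])
      ultimately show "c \<in> (\<Union>k\<in>K. \<Union>k'\<in>K. (\<lambda>f. - k + f) ` D (k - k') n)"
        using k by blast
    qed
    have "card (Kboundary K (Fn n)) \<le> card (\<Union>k\<in>K. \<Union>k'\<in>K. (\<lambda>f. - k + f) ` D (k - k') n)"
      using fD K by (intro card_mono sub) auto
    also have "... \<le> (\<Sum>k\<in>K. card (\<Union>k'\<in>K. (\<lambda>f. - k + f) ` D (k - k') n))"
      using K by (intro card_UN_le)
    also have "... \<le> (\<Sum>k\<in>K. \<Sum>k'\<in>K. card ((\<lambda>f. - k + f) ` D (k - k') n))"
      using K by (intro sum_mono card_UN_le)
    also have "... \<le> (\<Sum>k\<in>K. \<Sum>k'\<in>K. card (D (k - k') n))"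
      using fD by (intro sum_mono card_image_le)
    finally have "real (card (Kboundary K (Fn n))) \<le> (\<Sum>k\<in>K. \<Sum>k'\<in>K. real (card (D (k - k') n)))"
      by (metis (mono_tags, lifting) of_nat_le_iff of_nat_sum sum.cong)
    then show ?thesis
      by (simp add: sum_divide_distrib[symmetric] divide_right_mono)
  qed
  have "eventually (\<lambda>n. (\<Sum>k\<in>K. \<Sum>k'\<in>K. real (card (D (k - k') n)) / card (Fn n)) < \<delta>) sequentially"
    using lim K(2) by (auto dest!: order_tendstoD)
  then show "eventually (\<lambda>n. P (Fn n)) sequentially"
  proof eventually_elim
    case (elim n)
    then have "KD_invariant K \<delta> (Fn n)"
      using bd[of n] fF by (auto simp: KD_invariant_def intro: le_less_trans)
    then show ?case by (rule K(3))
  qed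
qed

lemma Foelner_filter_neq_bot:
  fixes Fn :: "nat \<Rightarrow> 'g::group_add set"
  assumes "Foelner_seq Fn"
  shows "(Foelner_filter :: 'g set filter) \<noteq> bot"
proof
  assume "Foelner_filter = (bot :: 'g set filter)"
  then have "filtermap Fn sequentially = bot"
    using Foelner_seq_filterlim[OF assms] by (simp add: filterlim_def le_bot)
  then show False
    by (simp add: filtermap_bot_iff)
qed

section \<open>Maximal quasi-tilings and their density\<close>

abbreviation tiled :: "('b \<times> 'c \<times> 'd set) set \<Rightarrow> 'd set" where
  "tiled P \<equiv> (\<Union>p\<in>P. snd (snd p))"

text \<open>A triple (T, c, A) records the part A of the translate T + c which the other tiles leave
  uncovered. The full translates lie in the covered region, so that the boundary of that region is
  controlled by the boundaries of the shapes.\<close>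

definition quasi_tiling :: "real \<Rightarrow> 'g::group_add set set \<Rightarrow> ('g set \<times> 'g \<times> 'g set) set \<Rightarrow> bool" where
  "quasi_tiling eps L P \<longleftrightarrow>
     (\<forall>T c A. (T, c, A) \<in> P \<longrightarrow> T \<in> L \<and> A \<subseteq> rtr T c \<and> (1 - eps) * real (card T) \<le> real (card A) \<and>
        rtr T c \<subseteq> tiled P) \<and>
     disjoint_family_on (\<lambda>p. snd (snd p)) P"

lemma quasi_tilingD:
  assumes "quasi_tiling eps L P" "(T, c, A) \<in> P"
  shows "T \<in> L" "A \<subseteq> rtr T c" "(1 - eps) * real (card T) \<le> real (card A)"
    "rtr T c \<subseteq> tiled P"
proof -
  note * = assms(1)[unfolded quasi_tiling_def, THEN conjunct1, rule_format, OF assms(2)]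
  show "T \<in> L" using * by (elim conjE)
  show "A \<subseteq> rtr T c" using * by (elim conjE)
  show "(1 - eps) * real (card T) \<le> real (card A)" using * by (elim conjE)
  show "rtr T c \<subseteq> tiled P" using * by (elim conjE)
qed

lemma quasi_tiling_mono:
  "quasi_tiling eps L P \<Longrightarrow> L \<subseteq> L' \<Longrightarrow> quasi_tiling eps L' P"
  unfolding quasi_tiling_def by (meson subsetD)

lemma quasi_tiling_disjoint:
  assumes "quasi_tiling eps L P"
  shows "disjoint_family_on (\<lambda>p. snd (snd p)) P"
  using assms unfolding quasi_tiling_def by auto

text \<open>Upper bounds for Zorn's lemma: the covering condition only gets easier in a larger
  family, and disjointness concerns two tiles, which lie in a common member of the chain.\<close>

lemma quasi_tiling_chain_Union:
  assumes "subset.chain {Q. P \<subseteq> Q \<and> quasi_tiling eps L Q} C" "C \<noteq> {}"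
  shows "P \<subseteq> \<Union>C \<and> quasi_tiling eps L (\<Union>C)"
proof
  have C: "P \<subseteq> Q" "quasi_tiling eps L Q" if "Q \<in> C" for Q
    using assms that by (auto simp: subset.chain_def)
  show "P \<subseteq> \<Union>C"
    using C(1) assms(2) by auto
  have "T \<in> L \<and> A \<subseteq> rtr T c \<and> (1 - eps) * real (card T) \<le> real (card A) \<and>
        rtr T c \<subseteq> (\<Union>p\<in>\<Union>C. snd (snd p))" if mem: "(T, c, A) \<in> \<Union>C" for T c A
  proof -
    obtain Q where "Q \<in> C" "(T, c, A) \<in> Q" using mem by auto
    with quasi_tilingD[OF C(2)[OF this(1)] this(2)] show ?thesis
      by (auto 0 3)
  qed
  moreover have "disjoint_family_on (\<lambda>p. snd (snd p)) (\<Union>C)"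
    unfolding disjoint_family_on_def
  proof (intro ballI impI)
    fix p q assume "p \<in> \<Union>C" "q \<in> \<Union>C" "p \<noteq> q"
    then obtain Q1 Q2 where Q: "Q1 \<in> C" "p \<in> Q1" "Q2 \<in> C" "q \<in> Q2" by auto
    then have "Q1 \<subseteq> Q2 \<or> Q2 \<subseteq> Q1"
      using assms(1) unfolding subset_chain_def by blast
    then obtain Q where "Q \<in> C" "p \<in> Q" "q \<in> Q"
      using Q by blast
    with quasi_tiling_disjoint[OF C(2)[OF this(1)]] \<open>p \<noteq> q\<close>
    show "snd (snd p) \<inter> snd (snd q) = {}"
      by (auto simp: disjoint_family_on_def)
  qed
  ultimately show "quasi_tiling eps L (\<Union>C)"
    unfolding quasi_tiling_def by blast
qed

text \<open>Zorn's lemma gives a maximal extension. A translate of \<open>T\<close> meeting its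
  covered region in fewer than \<open>eps * card T\<close> points could be added, with its uncovered
  part as the recorded set, contradicting maximality.\<close>

lemma quasi_tiling_extend:
  assumes qt: "quasi_tiling eps L P" and "eps < 1" and T: "finite T" "T \<noteq> {}"
  obtains P' where "P \<subseteq> P'" "quasi_tiling eps (insert T L) P'"
    "\<And>c. eps * card T \<le> card (rtr T c \<inter> tiled P')"
proof -
  define \<A> where "\<A> = {Q. P \<subseteq> Q \<and> quasi_tiling eps (insert T L) Q}"
  have "P \<in> \<A>"
    using quasi_tiling_mono[OF qt] unfolding \<A>_def by auto
  moreover have "\<Union>C \<in> \<A>" if "C \<noteq> {}" "subset.chain \<A> C" for C
    using quasi_tiling_chain_Union[of P eps "insert T L" C] that unfolding \<A>_def by blast
  ultimately obtain M where M: "M \<in> \<A>" "\<And>X. X \<in> \<A> \<Longrightarrow> M \<subseteq> X \<Longrightarrow> X = M"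
    using subset_Zorn_nonempty[of \<A>] by blast
  define U where "U = tiled M"
  have qtM: "quasi_tiling eps (insert T L) M" and PM: "P \<subseteq> M"
    using M by (auto simp: \<A>_def)
  have "eps * card T \<le> card (rtr T c \<inter> U)" for c
  proof (rule ccontr)
    assume less: "\<not> ?thesis"
    define A where "A = rtr T c - U"
    have "card (rtr T c) = card (rtr T c \<inter> U) + card A"
      unfolding A_def using T by (intro card_Int_Diff) simp
    then have cA: "(1 - eps) * real (card T) \<le> real (card A)"
      using less by (simp add: algebra_simps)
    moreover have "0 < (1 - eps) * real (card T)"
      using T \<open>eps < 1\<close> by (simp add: card_gt_0_iff)
    ultimately have "A \<noteq> {}" by auto
    let ?M = "insert (T, c, A) M"
    have U': "tiled ?M = A \<union> U" by (simp add: U_def)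
    have disj: "disjoint_family_on (\<lambda>p. snd (snd p)) ?M"
      using quasi_tiling_disjoint[OF qtM] by (auto simp: disjoint_family_on_def A_def U_def)
    have "T' \<in> insert T L \<and> A' \<subseteq> rtr T' c' \<and> (1 - eps) * real (card T') \<le> real (card A') \<and>
        rtr T' c' \<subseteq> A \<union> U" if "(T', c', A') \<in> ?M" for T' c' A'
    proof (cases "(T', c', A') \<in> M")
      case True
      from quasi_tilingD[OF qtM True] show ?thesis by (auto simp: U_def)
    next
      case False
      then have "T' = T" "c' = c" "A' = A" using that by auto
      then show ?thesis using cA by (auto simp: A_def)
    qed
    then have "quasi_tiling eps (insert T L) ?M"
      unfolding quasi_tiling_def U' using disj by blast
    then have "?M = M"
      using M(2)[of ?M] PM by (auto simp: \<A>_def)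
    then have "A \<subseteq> U" by (auto simp: U_def)
    then show False using \<open>A \<noteq> {}\<close> by (auto simp: A_def)
  qed
  then show thesis
    using that[OF PM qtM] by (auto simp: U_def)
qed

text \<open>The error region: it contains every translate of a shape that meets \<open>F\<close>
  without lying in \<open>F\<close>.\<close>

definition collar :: "'g::group_add set set \<Rightarrow> 'g set \<Rightarrow> 'g set" where
  "collar L F = (\<Union>T\<in>L. \<Union>c\<in>Kboundary T F. rtr T c)"

lemma finite_collar:
  "finite L \<Longrightarrow> (\<And>T. T \<in> L \<Longrightarrow> finite T) \<Longrightarrow> finite F \<Longrightarrow> finite (collar L F)"
  by (auto simp: collar_def finite_Kboundary)

lemma card_collar:
  assumes "finite L"
  shows "card (collar L F) \<le> (\<Sum>T\<in>L. card T * card (Kboundary T F))"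
proof -
  have "card (collar L F) \<le> (\<Sum>T\<in>L. card (\<Union>c\<in>Kboundary T F. rtr T c))"
    unfolding collar_def by (rule card_UN_le[OF assms])
  also have "... \<le> (\<Sum>T\<in>L. card T * card (Kboundary T F))"
  proof (rule sum_mono)
    fix T
    show "card (\<Union>c\<in>Kboundary T F. rtr T c) \<le> card T * card (Kboundary T F)"
    proof (cases "finite (Kboundary T F)")
      case True
      then have "card (\<Union>c\<in>Kboundary T F. rtr T c) \<le> (\<Sum>c\<in>Kboundary T F. card (rtr T c))"
        by (rule card_UN_le)
      then show ?thesis by (simp add: mult.commute)
    next
      case inf: False
      \<comment> \<open>The right-hand side is 0 here because \<open>card\<close> of an infinite set
        is 0, so the union must be shown to be infinite as well.\<close>
      have "infinite (\<Union>c\<in>Kboundary T F. rtr T c)"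
      proof
        obtain t where t: "t \<in> T" using inf by (fastforce simp: Kboundary_def)
        assume "finite (\<Union>c\<in>Kboundary T F. rtr T c)"
        moreover have "(\<lambda>c. t + c) ` Kboundary T F \<subseteq> (\<Union>c\<in>Kboundary T F. rtr T c)"
          using t by auto
        ultimately have "finite ((\<lambda>c. t + c) ` Kboundary T F)"
          by (rule finite_subset[rotated])
        then show False
          using inf by (auto dest!: finite_imageD simp: inj_on_def)
      qed
      then show ?thesis by simp
    qed
  qed
  finally show ?thesis .
qed

lemma rtr_subset_collar:
  assumes "T \<in> L" "rtr T c \<inter> F \<noteq> {}"
  shows "rtr T c \<subseteq> F \<or> rtr T c \<subseteq> collar L F"
proof (cases "rtr T c \<subseteq> F")
  case False
  then have "c \<in> Kboundary T F"
    using assms by (auto simp: Kboundary_def)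
  then show ?thesis
    using assms by (auto simp: collar_def)
qed auto

text \<open>The recorded parts of these tiles are disjoint subsets of \<open>F\<close> and its
  collar, and each makes up at least half of its shape because \<open>eps \<le> 1/2\<close>; hence
  the factor 2.\<close>

lemma quasi_tiling_meeting:
  assumes qt: "quasi_tiling eps L P" and "eps \<le> 1/2" and L: "finite L" "\<And>T. T \<in> L \<Longrightarrow> finite T \<and> T \<noteq> {}"
    and F: "finite F"
  defines "I \<equiv> {p\<in>P. rtr (fst p) (fst (snd p)) \<inter> F \<noteq> {}}"
  shows "finite I"
    "(\<Sum>p\<in>I. card (fst p)) \<le> 2 * (card F + (\<Sum>T\<in>L. card T * card (Kboundary T F)))"
proof -
  let ?N = "F \<union> collar L F"
  have fN: "finite ?N"
    using L F by (auto intro: finite_collar)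
  have sub: "snd (snd p) \<subseteq> ?N" if "p \<in> I" for p
  proof -
    obtain T c A where p: "p = (T, c, A)" by (cases p)
    have "(T, c, A) \<in> P" "rtr T c \<inter> F \<noteq> {}"
      using that by (auto simp: I_def p)
    with quasi_tilingD[OF qt this(1)] rtr_subset_collar[of T L c F] show ?thesis
      by (auto simp: p)
  qed
  have half: "card (fst p) \<le> 2 * card (snd (snd p))" if "p \<in> P" for p
  proof -
    obtain T c A where p: "p = (T, c, A)" by (cases p)
    have "1/2 * real (card T) \<le> (1 - eps) * real (card T)"
      using \<open>eps \<le> 1/2\<close> by (intro mult_right_mono) auto
    also have "... \<le> card A"
      using quasi_tilingD[OF qt] that p by auto
    finally show ?thesis by (simp add: p)
  qed
  have ne: "snd (snd p) \<noteq> {}" if "p \<in> P" for p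
  proof -
    have "fst p \<in> L" using quasi_tilingD(1)[OF qt, of "fst p" "fst (snd p)" "snd (snd p)"] that by simp
    then have "card (fst p) > 0" using L by (auto simp: card_gt_0_iff)
    then show ?thesis using half[OF that] by auto
  qed
  have dj: "disjoint_family_on (\<lambda>p. snd (snd p)) I"
    using quasi_tiling_disjoint[OF qt] by (auto simp: I_def disjoint_family_on_def)
  have "inj_on (\<lambda>p. snd (snd p)) I"
    using dj ne unfolding inj_on_def disjoint_family_on_def I_def by (metis (mono_tags, lifting) inf.idem mem_Collect_eq)
  moreover have "(\<lambda>p. snd (snd p)) ` I \<subseteq> Pow ?N"
    using sub by auto
  then have "finite ((\<lambda>p. snd (snd p)) ` I)"
    by (rule finite_subset) (use fN in auto)
  ultimately show fI: "finite I"
    by (rule finite_imageD[rotated])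
  have "(\<Sum>p\<in>I. card (fst p)) \<le> (\<Sum>p\<in>I. 2 * card (snd (snd p)))"
    using half by (intro sum_mono) (auto simp: I_def)
  also have "... = 2 * (\<Sum>p\<in>I. card (snd (snd p)))"
    by (simp add: sum_distrib_left)
  also have "(\<Sum>p\<in>I. card (snd (snd p))) = card (\<Union>p\<in>I. snd (snd p))"
    using dj fI finite_subset[OF sub fN]
    by (intro card_UN_disjoint[symmetric]) (simp_all add: disjoint_family_on_def)
  also have "card (\<Union>p\<in>I. snd (snd p)) \<le> card ?N"
    using sub fN by (intro card_mono) auto
  also have "card ?N \<le> card F + (\<Sum>T\<in>L. card T * card (Kboundary T F))"
    using card_Un_le[of F "collar L F"] card_collar[OF L(1), of F] by linarith
  finally show "(\<Sum>p\<in>I. card (fst p)) \<le> 2 * (card F + (\<Sum>T\<in>L. card T * card (Kboundary T F)))"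
    by simp
qed

text \<open>A boundary point of the remainder is a boundary point of \<open>F\<close> or of a full
  translate meeting \<open>F\<close>. The latter are bounded by the invariance of the shapes times
  the total size of those translates.\<close>

lemma Kboundary_Diff_quasi_tiling:
  fixes eps \<eta> :: real
  assumes qt: "quasi_tiling eps L P" and "eps \<le> 1/2" and L: "finite L" "\<And>T. T \<in> L \<Longrightarrow> finite T \<and> T \<noteq> {}"
    and F: "finite F" and T: "finite T" and \<eta>: "0 \<le> \<eta>"
    and inv: "\<And>T'. T' \<in> L \<Longrightarrow> card (Kboundary T T') \<le> \<eta> * card T'"
  shows "card (Kboundary T (F - tiled P)) \<le>
    card (Kboundary T F) + \<eta> * (2 * (card F + (\<Sum>T\<in>L. card T * card (Kboundary T F))))"
proof -
  define I where "I = {p\<in>P. rtr (fst p) (fst (snd p)) \<inter> F \<noteq> {}}"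
  define U where "U = tiled P"
  have inL: "fst p \<in> L" if "p \<in> I" for p
    using quasi_tilingD(1)[OF qt, of "fst p" "fst (snd p)" "snd (snd p)"] that by (simp add: I_def)
  have fI: "finite I"
    using quasi_tiling_meeting(1)[OF qt \<open>eps \<le> 1/2\<close> L F] by (simp add: I_def)
  have "Kboundary T (F - U) \<subseteq> Kboundary T F \<union> (\<Union>p\<in>I. Kboundary T (rtr (fst p) (fst (snd p))))"
  proof
    fix c assume "c \<in> Kboundary T (F - U)"
    then obtain k k' where k: "k \<in> T" "k + c \<in> F" "k + c \<notin> U" "k' \<in> T" "k' + c \<notin> F - U"
      by (auto simp: Kboundary_iff)
    show "c \<in> Kboundary T F \<union> (\<Union>p\<in>I. Kboundary T (rtr (fst p) (fst (snd p))))"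
    proof (cases "k' + c \<in> F")
      case False
      then show ?thesis using k by (auto simp: Kboundary_iff)
    next
      case True
      then obtain p where p: "p \<in> P" "k' + c \<in> snd (snd p)"
        using k by (auto simp: U_def)
      obtain S d A where pe: "p = (S, d, A)" by (cases p)
      \<comment> \<open>\<open>k + c\<close> is uncovered, hence outside the whole translate and not
        just outside \<open>A\<close>. This puts \<open>c\<close> on the boundary of a translated
        shape, whose size is known.\<close>
      have "A \<subseteq> rtr S d" "rtr S d \<subseteq> U"
        using quasi_tilingD[OF qt, of S d A] p pe by (auto simp: U_def)
      then have "p \<in> I" "c \<in> Kboundary T (rtr S d)"
        using p pe True k unfolding I_def Kboundary_iff by auto
      then have "c \<in> Kboundary T (rtr (fst p) (fst (snd p)))" using pe by simp
      then show ?thesis using \<open>p \<in> I\<close> by blast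
    qed
  qed
  then have "card (Kboundary T (F - U)) \<le>
      card (Kboundary T F \<union> (\<Union>p\<in>I. Kboundary T (rtr (fst p) (fst (snd p)))))"
    using fI F T L inL by (intro card_mono) (auto intro!: finite_Kboundary finite_imageI)
  also have "... \<le> card (Kboundary T F) + card (\<Union>p\<in>I. Kboundary T (rtr (fst p) (fst (snd p))))"
    by (rule card_Un_le)
  also have "card (\<Union>p\<in>I. Kboundary T (rtr (fst p) (fst (snd p)))) \<le>
      (\<Sum>p\<in>I. card (Kboundary T (rtr (fst p) (fst (snd p)))))"
    using fI by (rule card_UN_le)
  finally have "real (card (Kboundary T (F - U))) \<le> card (Kboundary T F) + (\<Sum>p\<in>I. real (card (Kboundary T (fst p))))"
    by (simp add: Kboundary_rtr flip: of_nat_sum of_nat_add)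
  also have "(\<Sum>p\<in>I. real (card (Kboundary T (fst p)))) \<le> (\<Sum>p\<in>I. \<eta> * real (card (fst p)))"
    using inv inL by (intro sum_mono) auto
  also have "... = \<eta> * real (\<Sum>p\<in>I. card (fst p))"
    by (simp add: sum_distrib_left)
  also have "... \<le> \<eta> * real (2 * (card F + (\<Sum>T\<in>L. card T * card (Kboundary T F))))"
    using quasi_tiling_meeting(2)[OF qt \<open>eps \<le> 1/2\<close> L F] \<eta>
    by (intro mult_left_mono) (auto simp: I_def simp flip: of_nat_sum of_nat_mult of_nat_add)
  finally show ?thesis
    by (simp add: U_def)
qed

text \<open>Double counting of the pairs of \<open>c\<close> and \<open>t\<close> with
  \<open>rtr T c\<close> inside \<open>H\<close> and \<open>t + c\<close> in \<open>V\<close>: at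
  least \<open>card H - card (Kboundary T H)\<close> values of \<open>c\<close> occur, and each
  point of \<open>H \<inter> V\<close> arises at most once for each \<open>t\<close>.\<close>

lemma card_Int_of_translate_bound:
  fixes eps :: real
  assumes H: "finite H" and T: "finite T" "T \<noteq> {}" and "eps \<ge> 0"
    and V: "\<And>c. eps * card T \<le> card (rtr T c \<inter> V)"
  shows "eps * (real (card H) - real (card (Kboundary T H))) \<le> card (H \<inter> V)"
proof -
  define C where "C = {c. rtr T c \<subseteq> H}"
  obtain t where t: "t \<in> T" using T by auto
  have "C \<subseteq> (\<lambda>h. - t + h) ` H"
  proof
    fix c assume "c \<in> C"
    then have "t + c \<in> H" "c = - t + (t + c)"
      using t by (auto simp: C_def add.assoc[symmetric])
    then show "c \<in> (\<lambda>h. - t + h) ` H" by blast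
  qed
  then have fC: "finite C" using H by (auto intro: finite_subset)
  have "(\<lambda>h. - t + h) ` H \<subseteq> C \<union> Kboundary T H"
    using t by (force simp: C_def Kboundary_iff add.assoc[symmetric])
  then have "card ((\<lambda>h. - t + h) ` H) \<le> card (C \<union> Kboundary T H)"
    using fC finite_Kboundary[OF T(1) H] by (intro card_mono) auto
  also have "... \<le> card C + card (Kboundary T H)"
    by (rule card_Un_le)
  finally have cC: "real (card H) - real (card (Kboundary T H)) \<le> card C"
    by (simp add: card_image)
  have "real (card (rtr T c \<inter> V)) = (\<Sum>t\<in>T. (of_bool (t + c \<in> V) :: real))" for c
  proof -
    have "rtr T c \<inter> V = (\<lambda>t. t + c) ` {t\<in>T. t + c \<in> V}" by auto
    then have "card (rtr T c \<inter> V) = card {t\<in>T. t + c \<in> V}"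
      by (simp add: card_image)
    then show ?thesis
      using T by (simp add: Int_def)
  qed
  note cVc = this
  have "real (card C) * (eps * real (card T)) = (\<Sum>c\<in>C. eps * real (card T))" by simp
  also have "... \<le> (\<Sum>c\<in>C. \<Sum>t\<in>T. (of_bool (t + c \<in> V) :: real))"
    using V by (intro sum_mono) (simp add: cVc)
  also have "... = (\<Sum>t\<in>T. \<Sum>c\<in>C. (of_bool (t + c \<in> V) :: real))"
    by (rule sum.swap)
  also have "... \<le> (\<Sum>t\<in>T. real (card (H \<inter> V)))"
  proof (rule sum_mono)
    fix t assume t: "t \<in> T"
    have "(\<lambda>c. t + c) ` {c\<in>C. t + c \<in> V} \<subseteq> H \<inter> V"
      using t by (auto simp: C_def)
    then have "card ((\<lambda>c. t + c) ` {c\<in>C. t + c \<in> V}) \<le> card (H \<inter> V)"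
      using H by (intro card_mono) auto
    then show "(\<Sum>c\<in>C. (of_bool (t + c \<in> V) :: real)) \<le> real (card (H \<inter> V))"
      using fC by (simp add: card_image Int_def)
  qed
  finally have "(eps * card C) * card T \<le> card (H \<inter> V) * real (card T)"
    by (simp add: mult_ac)
  then have "eps * card C \<le> card (H \<inter> V)"
    using T by (simp add: card_gt_0_iff)
  moreover have "eps * (real (card H) - real (card (Kboundary T H))) \<le> eps * card C"
    using cC \<open>eps \<ge> 0\<close> by (intro mult_left_mono)
  ultimately show ?thesis by linarith
qed

text \<open>The list runs from small to large shapes and the induction tiles with the tail first, so
  that the head fills the gaps left by the larger tiles. Each shape removes a fraction
  \<open>eps\<close> of the remainder, up to a boundary error.\<close>

lemma quasi_tiling_density:
  fixes eps \<eta> :: real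
  assumes eps: "0 < eps" "eps \<le> 1/2" and \<eta>: "0 \<le> \<eta>"
    and "sorted_wrt (\<lambda>T T'. card (Kboundary T T') \<le> \<eta> * card T') Ts"
    and "\<And>T. T \<in> set Ts \<Longrightarrow> finite T \<and> T \<noteq> {}"
  shows "\<exists>P. quasi_tiling eps (set Ts) P \<and>
    (\<forall>F. finite F \<and> (\<forall>T\<in>set Ts. card (Kboundary T F) \<le> \<eta> * card F) \<and>
       (\<Sum>T\<in>set Ts. card T * card (Kboundary T F)) \<le> card F \<longrightarrow>
       card (F - tiled P) \<le> ((1 - eps) ^ length Ts + 5 * \<eta>) * card F)"
  using assms(4,5)
proof (induction Ts)
  case Nil
  have "card F \<le> (1 + 5 * \<eta>) * real (card F)" for F :: "'a set"
    using \<eta> by (simp add: algebra_simps)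
  then show ?case
    by (intro exI[of _ "{}"]) (simp add: quasi_tiling_def disjoint_family_on_def)
next
  case (Cons T Ts)
  obtain P where qt: "quasi_tiling eps (set Ts) P" and
    dens: "\<And>F. finite F \<Longrightarrow> (\<forall>T\<in>set Ts. card (Kboundary T F) \<le> \<eta> * card F) \<Longrightarrow>
       (\<Sum>T\<in>set Ts. card T * card (Kboundary T F)) \<le> card F \<Longrightarrow>
       card (F - tiled P) \<le> ((1 - eps) ^ length Ts + 5 * \<eta>) * card F"
    using Cons by auto
  have T: "finite T" "T \<noteq> {}" using Cons.prems by auto
  obtain P' where P': "P \<subseteq> P'" "quasi_tiling eps (insert T (set Ts)) P'"
    "\<And>c. eps * card T \<le> card (rtr T c \<inter> tiled P')"
    using quasi_tiling_extend[OF qt _ T] eps by auto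
  have "card (F - tiled P') \<le> ((1 - eps) ^ Suc (length Ts) + 5 * \<eta>) * card F"
    if F: "finite F" and inv: "\<forall>T'\<in>set (T # Ts). card (Kboundary T' F) \<le> \<eta> * card F"
      and sm: "(\<Sum>T'\<in>set (T # Ts). card T' * card (Kboundary T' F)) \<le> card F" for F
  proof -
    let ?U = "tiled P" and ?U' = "tiled P'"
    let ?H = "F - ?U"
    have sm': "(\<Sum>T'\<in>set Ts. card T' * card (Kboundary T' F)) \<le> card F"
      using sm by (intro order_trans[OF sum_mono2 sm]) auto
    have h: "card ?H \<le> ((1 - eps) ^ length Ts + 5 * \<eta>) * card F"
      using dens[OF F _ sm'] inv by auto
    have "card (Kboundary T ?H) \<le> card (Kboundary T F) +
        \<eta> * (2 * (card F + (\<Sum>T\<in>set Ts. card T * card (Kboundary T F))))"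
      using Cons.prems F T \<eta> eps by (intro Kboundary_Diff_quasi_tiling[OF qt]) auto
    also have "... \<le> \<eta> * card F + \<eta> * (2 * (card F + card F))"
      using inv sm' \<eta> by (intro add_mono mult_left_mono) (auto simp flip: of_nat_add of_nat_sum of_nat_mult)
    \<comment> \<open>5 = 1 + 2 * (1 + 1): one share from the boundary of \<open>F\<close> itself,
      four from the translates meeting \<open>F\<close>.\<close>
    finally have b: "card (Kboundary T ?H) \<le> 5 * \<eta> * card F" by simp
    have "eps * (real (card ?H) - real (card (Kboundary T ?H))) \<le> card (?H \<inter> ?U')"
      using F T eps P'(3) by (intro card_Int_of_translate_bound) auto
    moreover have "eps * card (Kboundary T ?H) \<le> eps * (5 * \<eta> * card F)"
      using b eps by (intro mult_left_mono) auto
    moreover have "card ?H = card (?H \<inter> ?U') + card (?H - ?U')"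
      using F by (intro card_Int_Diff) auto
    moreover have "F - ?U' = ?H - ?U'"
      using P'(1) by blast
    ultimately have "card (F - ?U') \<le> (1 - eps) * card ?H + eps * (5 * \<eta> * card F)"
      by (simp add: algebra_simps)
    also have "... \<le> (1 - eps) * (((1 - eps) ^ length Ts + 5 * \<eta>) * card F) + eps * (5 * \<eta> * card F)"
      using h eps by (intro add_right_mono mult_left_mono) auto
    \<comment> \<open>The additive error does not accumulate, since \<open>5 * \<eta>\<close> is
      averaged with itself with weights \<open>1 - eps\<close> and \<open>eps\<close>.\<close>
    also have "... = ((1 - eps) ^ Suc (length Ts) + 5 * \<eta>) * card F"
      by (simp add: algebra_simps)
    finally show ?thesis .
  qed
  then show ?case
    using P'(2) by (intro exI[of _ P']) simp
qed

section \<open>From quasi-tilings to tilings by invariant tiles\<close>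

lemma eventually_card_Kboundary_le:
  fixes \<eta> :: real
  assumes "finite T" "0 < \<eta>"
  shows "eventually (\<lambda>F. card (Kboundary T F) \<le> \<eta> * card F) Foelner_filter"
  using eventually_KD_invariant[OF assms]
proof eventually_elim
  case (elim F)
  then have "card F > 0" "real (card (Kboundary T F)) / card F < \<eta>"
    by (auto simp: KD_invariant_def card_gt_0_iff)
  then show ?case by (simp add: field_simps)
qed

text \<open>A later shape can be taken invariant under all earlier ones because that is an eventual
  property. \<open>P\<close> holds only frequently since the Ornstein-Weiss argument uses shapes on
  which a quotient is close to its lower limit.\<close>

lemma invariant_chain:
  fixes P :: "'g::group_add set \<Rightarrow> bool" and \<eta> :: real
  assumes P: "frequently P Foelner_filter" and "0 < \<eta>"
  shows "\<exists>Ts. length Ts = k \<and> sorted_wrt (\<lambda>T T'. card (Kboundary T T') \<le> \<eta> * card T') Ts \<and>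
    (\<forall>T\<in>set Ts. P T \<and> finite T \<and> T \<noteq> {})"
proof (induction k)
  case (Suc k)
  then obtain Ts where Ts: "length Ts = k" "sorted_wrt (\<lambda>T T'. card (Kboundary T T') \<le> \<eta> * card T') Ts"
    "\<forall>T\<in>set Ts. P T \<and> finite T \<and> T \<noteq> {}" by auto
  have "eventually (\<lambda>F. \<forall>T\<in>set Ts. card (Kboundary T F) \<le> \<eta> * card F) Foelner_filter"
    using Ts \<open>0 < \<eta>\<close> by (intro eventually_ball_finite) (auto intro: eventually_card_Kboundary_le)
  with eventually_finite_Foelner
  have "eventually (\<lambda>F. (finite F \<and> F \<noteq> {}) \<and> (\<forall>T\<in>set Ts. card (Kboundary T F) \<le> \<eta> * card F)) Foelner_filter"
    by (rule eventually_conj)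
  from frequently_ex[OF frequently_eventually_frequently[OF P this]]
  obtain F where "P F" "finite F" "F \<noteq> {}" "\<forall>T\<in>set Ts. card (Kboundary T F) \<le> \<eta> * card F"
    by auto
  with Ts show ?case
    by (intro exI[of _ "Ts @ [F]"]) (auto simp: sorted_wrt_append)
qed auto

definition covers :: "'g set set \<Rightarrow> real \<Rightarrow> 'g set \<Rightarrow> bool" where
  "covers \<T> eps F \<longleftrightarrow> real (card (F - \<Union>{A\<in>\<T>. A \<subseteq> F})) \<le> eps * real (card F)"

text \<open>One family of tiles on the whole group serves every sufficiently invariant
  \<open>F\<close> at once. This uniformity is what lets all sets of a Foelner sequence be treated
  by the same tiles.\<close>

lemma Foelner_quasi_tiling:
  fixes eps :: real and P :: "'g::group_add set \<Rightarrow> bool"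
  assumes eps: "0 < eps" and P: "frequently P Foelner_filter"
  obtains L \<T> where "finite L" "\<And>T. T \<in> L \<Longrightarrow> P T \<and> finite T \<and> T \<noteq> {}" "disjoint \<T>"
    "\<And>A. A \<in> \<T> \<Longrightarrow> \<exists>T\<in>L. \<exists>c. A \<subseteq> rtr T c \<and> (1 - eps) * card T \<le> card A"
    "eventually (covers \<T> eps) Foelner_filter"
proof -
  define e where "e = min eps (1/2)"
  \<comment> \<open>Chosen so that \<open>5 * \<eta>\<close> from the density bound and
    \<open>\<eta>\<close> from the collar add up to \<open>eps / 2\<close>; the other half is left
    for \<open>(1 - e) ^ k\<close>.\<close>
  define \<eta> where "\<eta> = eps / 12"
  have e: "0 < e" "e \<le> 1/2" "e \<le> eps" and \<eta>: "0 < \<eta>" using eps by (auto simp: e_def \<eta>_def)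
  obtain k where k: "(1 - e) ^ k < eps / 2"
    using real_arch_pow_inv[of "eps / 2" "1 - e"] eps e by auto
  obtain Ts where Ts: "length Ts = k" "sorted_wrt (\<lambda>T T'. card (Kboundary T T') \<le> \<eta> * card T') Ts"
    "\<And>T. T\<in>set Ts \<Longrightarrow> P T \<and> finite T \<and> T \<noteq> {}"
    using invariant_chain[OF P \<eta>, of k] by auto
  obtain Q where qt: "quasi_tiling e (set Ts) Q" and
    dens: "\<And>F. finite F \<Longrightarrow> (\<forall>T\<in>set Ts. card (Kboundary T F) \<le> \<eta> * card F) \<Longrightarrow>
       (\<Sum>T\<in>set Ts. card T * card (Kboundary T F)) \<le> card F \<Longrightarrow>
       card (F - tiled Q) \<le> ((1 - e) ^ k + 5 * \<eta>) * card F"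
    using quasi_tiling_density[OF e(1,2) _ Ts(2)] \<eta> Ts by auto
  define \<T> where "\<T> = (\<lambda>p. snd (snd p)) ` Q"
  define M where "M = (\<Sum>T\<in>set Ts. card T)"
  \<comment> \<open>Small enough to bound the collar sum both by \<open>\<eta> * card F\<close>, for
    the loss at the boundary, and by \<open>card F\<close>, as the density bound requires.\<close>
  define \<eta>' where "\<eta>' = min \<eta> 1 / (M + 1)"
  have \<eta>': "0 < \<eta>'" using \<eta> by (simp add: \<eta>'_def)
  have "min \<eta> 1 / (M + 1) \<le> min \<eta> 1 / 1" using \<eta> by (intro divide_left_mono) auto
  then have "\<eta>' \<le> min \<eta> 1" by (simp add: \<eta>'_def)
  then have \<eta>'_le: "\<eta>' \<le> \<eta>" by simp
  have "M * \<eta>' = min \<eta> 1 * (M / (M + 1))" by (simp add: \<eta>'_def)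
  also have "... \<le> min \<eta> 1 * 1" using \<eta> by (intro mult_left_mono) auto
  finally have "M * \<eta>' \<le> min \<eta> 1" by simp
  then have M\<eta>: "M * \<eta>' \<le> \<eta>" "M * \<eta>' \<le> 1" by auto
  have "eventually (\<lambda>F. \<forall>T\<in>set Ts. card (Kboundary T F) \<le> \<eta>' * card F) Foelner_filter"
    using Ts \<eta>' by (intro eventually_ball_finite) (auto intro: eventually_card_Kboundary_le)
  then have "eventually (covers \<T> eps) Foelner_filter"
    using eventually_finite_Foelner
  proof eventually_elim
    case (elim F)
    have F: "finite F" using elim by simp
    have "real (\<Sum>T\<in>set Ts. card T * card (Kboundary T F)) \<le> (\<Sum>T\<in>set Ts. card T * (\<eta>' * card F))"
      using elim by (auto intro!: sum_mono mult_left_mono)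
    also have "... = M * \<eta>' * card F"
      by (simp add: M_def sum_distrib_left mult_ac)
    finally have s: "real (\<Sum>T\<in>set Ts. card T * card (Kboundary T F)) \<le> M * \<eta>' * card F" .
    have s1: "real (\<Sum>T\<in>set Ts. card T * card (Kboundary T F)) \<le> \<eta> * card F"
      using M\<eta> by (intro order_trans[OF s] mult_right_mono) auto
    have "M * \<eta>' * card F \<le> 1 * real (card F)"
      using M\<eta>(2) by (intro mult_right_mono) simp_all
    then have "real (\<Sum>T\<in>set Ts. card T * card (Kboundary T F)) \<le> card F"
      using s by simp
    then have s2: "(\<Sum>T\<in>set Ts. card T * card (Kboundary T F)) \<le> card F" by linarith
    have b: "\<forall>T\<in>set Ts. card (Kboundary T F) \<le> \<eta> * card F"
    proof
      fix T assume "T \<in> set Ts"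
      then have "card (Kboundary T F) \<le> \<eta>' * card F" using elim by auto
      also have "... \<le> \<eta> * card F" using \<eta>'_le by (intro mult_right_mono) auto
      finally show "card (Kboundary T F) \<le> \<eta> * card F" .
    qed
    have "F - \<Union>{A\<in>\<T>. A \<subseteq> F} \<subseteq> (F - tiled Q) \<union> collar (set Ts) F"
    proof
      fix x assume x: "x \<in> F - \<Union>{A\<in>\<T>. A \<subseteq> F}"
      show "x \<in> (F - tiled Q) \<union> collar (set Ts) F"
      proof (cases "x \<in> tiled Q")
        case True
        then obtain T c A where q: "(T, c, A) \<in> Q" "x \<in> A" by auto
        note D = quasi_tilingD[OF qt q(1)]
        have "\<not> A \<subseteq> F" using x q by (force simp: \<T>_def)
        then have "\<not> rtr T c \<subseteq> F" using D by auto
        moreover have "rtr T c \<inter> F \<noteq> {}" using D q x by auto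
        ultimately have "rtr T c \<subseteq> collar (set Ts) F"
          using rtr_subset_collar[OF D(1)] by blast
        then show ?thesis using q(2) D(2) by blast
      qed (use x in auto)
    qed
    then have "card (F - \<Union>{A\<in>\<T>. A \<subseteq> F}) \<le> card ((F - tiled Q) \<union> collar (set Ts) F)"
      using F Ts by (intro card_mono) (auto intro!: finite_collar)
    also have "... \<le> card (F - tiled Q) + card (collar (set Ts) F)"
      by (rule card_Un_le)
    also have "... \<le> card (F - tiled Q) + (\<Sum>T\<in>set Ts. card T * card (Kboundary T F))"
      using card_collar[of "set Ts" F] by simp
    finally have "real (card (F - \<Union>{A\<in>\<T>. A \<subseteq> F})) \<le> card (F - tiled Q) + \<eta> * card F"
      using s1 by linarith
    also have "... \<le> ((1 - e) ^ k + 5 * \<eta>) * card F + \<eta> * card F"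
      using dens[OF F b s2] by simp
    also have "... = ((1 - e) ^ k + eps / 2) * card F"
      by (simp add: \<eta>_def algebra_simps)
    also have "... \<le> eps * card F"
      using k by (intro mult_right_mono) auto
    finally show ?case by (simp add: covers_def)
  qed
  moreover have "\<exists>T\<in>set Ts. \<exists>c. A \<subseteq> rtr T c \<and> (1 - eps) * card T \<le> card A" if A: "A \<in> \<T>" for A
  proof -
    obtain T c where q: "(T, c, A) \<in> Q" using A by (auto simp: \<T>_def)
    note D = quasi_tilingD[OF qt q]
    have "(1 - eps) * card T \<le> (1 - e) * card T"
      using e by (intro mult_right_mono) auto
    with D show ?thesis by force
  qed
  moreover have "disjoint \<T>"
    unfolding \<T>_def using quasi_tiling_disjoint[OF qt] by (rule disjoint_family_on_disjoint_image)
  ultimately show thesis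
    using that[of "set Ts" \<T>] Ts by blast
qed

text \<open>Deleting \<open>eps * card T\<close> points creates at most
  \<open>card K * eps * card T\<close> new boundary points. With \<open>\<delta> / 4\<close> for the
  shape and \<open>\<delta> / 8\<close> for the deletion, passing to \<open>A\<close> by
  \<open>card T \<le> 2 * card A\<close> still gives at most three quarters of
  \<open>\<delta>\<close>.\<close>

lemma KD_invariant_large_subset:
  fixes eps \<delta> :: real
  assumes T: "KD_invariant K (\<delta> / 4) T" and A: "A \<subseteq> rtr T c" "(1 - eps) * card T \<le> card A"
    and eps: "eps \<le> 1/2" "8 * (card K + 1) * eps \<le> \<delta>" and K: "finite K"
  shows "KD_invariant K \<delta> A"
proof -
  have fT: "finite T" "card T > 0"
    using T by (auto simp: KD_invariant_def card_gt_0_iff)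
  have bT: "real (card (Kboundary K T)) < \<delta> / 4 * card T"
    using T fT by (simp add: KD_invariant_def pos_divide_less_eq)
  have "0 \<le> \<delta> / 4 * card T"
    using bT by linarith
  then have \<delta>: "0 \<le> \<delta>" using fT(2) by (simp add: zero_le_mult_iff)
  have fA: "finite A" using A fT by (auto intro: finite_subset)
  have "1/2 * real (card T) \<le> (1 - eps) * card T"
    using eps by (intro mult_right_mono) auto
  then have half: "real (card T) \<le> 2 * card A" using A by linarith
  then have cA: "card A > 0" using fT by linarith
  have dif: "real (card (rtr T c - A)) \<le> eps * card T"
    using card_Diff_subset[OF fA A(1)] card_mono[OF _ A(1)] A(2) fT
    by (simp add: algebra_simps of_nat_diff)
  have "Kboundary K A \<subseteq> Kboundary K (rtr T c) \<union> (\<Union>k\<in>K. (\<lambda>x. - k + x) ` (rtr T c - A))"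
  proof
    fix x assume "x \<in> Kboundary K A"
    then obtain k k' where k: "k \<in> K" "k + x \<in> A" "k' \<in> K" "k' + x \<notin> A"
      by (auto simp: Kboundary_iff)
    show "x \<in> Kboundary K (rtr T c) \<union> (\<Union>k\<in>K. (\<lambda>x. - k + x) ` (rtr T c - A))"
    proof (cases "k' + x \<in> rtr T c")
      case True
      moreover have "x = - k' + (k' + x)" by (simp add: add.assoc[symmetric])
      ultimately show ?thesis using k by blast
    next
      case False
      then have "x \<in> Kboundary K (rtr T c)" using k A by (auto simp only: Kboundary_iff)
      then show ?thesis by simp
    qed
  qed
  then have "card (Kboundary K A) \<le> card (Kboundary K (rtr T c) \<union> (\<Union>k\<in>K. (\<lambda>x. - k + x) ` (rtr T c - A)))"
    using K fT by (intro card_mono) (auto intro!: finite_Kboundary)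
  also have "... \<le> card (Kboundary K (rtr T c)) + card (\<Union>k\<in>K. (\<lambda>x. - k + x) ` (rtr T c - A))"
    by (rule card_Un_le)
  also have "card (\<Union>k\<in>K. (\<lambda>x. - k + x) ` (rtr T c - A)) \<le> (\<Sum>k\<in>K. card ((\<lambda>x. - k + x) ` (rtr T c - A)))"
    using K by (rule card_UN_le)
  also have "... = card K * card (rtr T c - A)"
    by (simp add: card_image)
  finally have "real (card (Kboundary K A)) \<le> card (Kboundary K T) + card K * real (card (rtr T c - A))"
    by (simp add: Kboundary_rtr flip: of_nat_mult of_nat_add)
  also have "... \<le> card (Kboundary K T) + card K * (eps * card T)"
    using dif by (intro add_left_mono mult_left_mono) auto
  also have "... < \<delta> / 4 * card T + (card K * eps) * card T"
    using bT by simp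
  also have "(card K * eps) * card T \<le> (\<delta> / 8) * card T"
  proof -
    have "card K * eps \<le> \<delta> / 8"
    proof (cases "eps \<ge> 0")
      case True
      then show ?thesis using eps by (simp add: algebra_simps)
    next
      case False
      then have "card K * eps \<le> 0" by (simp add: mult_le_0_iff)
      then show ?thesis using \<delta> by simp
    qed
    then show ?thesis by (intro mult_right_mono) auto
  qed
  also have "\<delta> / 4 * card T + (\<delta> / 8) * card T = (3 * \<delta> / 8) * card T"
    by (simp add: algebra_simps)
  also have "... \<le> (3 * \<delta> / 8) * (2 * card A)"
    using half \<delta> by (intro mult_left_mono) auto
  also have "... \<le> \<delta> * card A"
    using \<delta> by (simp add: algebra_simps)
  finally show ?thesis
    using fA cA by (auto simp: KD_invariant_def divide_less_eq)
qed

text \<open>\<open>P\<close> may fail to be translation invariant, and a tile is only part of a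
  translate. Both difficulties vanish by passing through (\<open>K\<close>,
  \<open>\<delta>\<close>)-invariance, which translates keep and large subsets nearly keep. The
  bound \<open>N\<close> exists because there are finitely many shapes.\<close>

lemma Foelner_tiling:
  fixes eps :: real and P :: "'g::group_add set \<Rightarrow> bool"
  assumes eps: "0 < eps" and nb: "(Foelner_filter :: 'g set filter) \<noteq> bot"
    and P: "eventually P Foelner_filter"
  shows "\<exists>\<T> N. disjoint \<T> \<and> (\<forall>A\<in>\<T>. P A \<and> finite A \<and> A \<noteq> {} \<and> card A \<le> N) \<and>
    eventually (covers \<T> eps) Foelner_filter"
proof -
  obtain K \<delta> where K: "finite K" "\<delta> > 0" "\<And>F. KD_invariant K \<delta> F \<Longrightarrow> P F"
    using P by (auto simp: eventually_Foelner_filter)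
  define e where "e = min eps (min (1/2) (\<delta> / (8 * (card K + 1))))"
  have e: "0 < e" "e \<le> eps" "e \<le> 1/2" "e \<le> \<delta> / (8 * (card K + 1))"
    using eps K unfolding e_def by (simp, linarith+)
  have e8: "8 * (card K + 1) * e \<le> \<delta>"
    using e(4) by (simp add: field_simps)
  have "frequently (KD_invariant K (\<delta> / 4)) Foelner_filter"
    using K by (intro eventually_frequently nb eventually_KD_invariant) auto
  from Foelner_quasi_tiling[OF e(1) this]
  obtain L \<T> where L: "finite L" "\<And>T. T \<in> L \<Longrightarrow> KD_invariant K (\<delta> / 4) T \<and> finite T \<and> T \<noteq> {}" "disjoint \<T>"
    "\<And>A. A \<in> \<T> \<Longrightarrow> \<exists>T\<in>L. \<exists>c. A \<subseteq> rtr T c \<and> (1 - e) * card T \<le> card A"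
    "eventually (covers \<T> e) Foelner_filter"
    by blast
  have "P A \<and> finite A \<and> A \<noteq> {} \<and> card A \<le> (\<Sum>T\<in>L. card T)" if mem: "A \<in> \<T>" for A
  proof -
    obtain T c where T: "T \<in> L" "A \<subseteq> rtr T c" "(1 - e) * card T \<le> card A"
      using L(4)[OF mem] by auto
    have "KD_invariant K \<delta> A"
      using KD_invariant_large_subset[OF _ T(2,3) e(3) e8 K(1)] L(2)[OF T(1)] by auto
    moreover have "card A \<le> card (rtr T c)"
      using T L(2)[OF T(1)] by (intro card_mono) auto
    then have "card A \<le> (\<Sum>T\<in>L. card T)"
      using member_le_sum[of T L card] T L(1) by simp
    ultimately show ?thesis
      using K(3) by (auto simp: KD_invariant_def)
  qed
  moreover have "eventually (covers \<T> eps) Foelner_filter"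
    using L(5)
  proof eventually_elim
    case (elim F)
    moreover have "e * card F \<le> eps * card F"
      using e by (intro mult_right_mono) auto
    ultimately show ?case by (simp add: covers_def)
  qed
  ultimately show ?thesis
    using L(3) by blast
qed

lemma sum_card_le:
  assumes F: "finite F" and S: "S \<subseteq> Pow F" "disjoint S"
  shows "finite S" "real (\<Sum>A\<in>S. card A) \<le> card F"
proof -
  show "finite S" using F S(1) by (auto intro: finite_subset[of _ "Pow F"])
  have "finite A" if "A \<in> S" for A using S(1) F that by (auto intro: finite_subset)
  then have "(\<Sum>A\<in>S. card A) = card (\<Union>S)"
    using S(2) by (intro card_Union_disjoint[symmetric]) (auto simp: disjoint_def pairwise_def disjnt_def)
  also have "... \<le> card F" using S(1) F by (intro card_mono) auto
  finally show "real (\<Sum>A\<in>S. card A) \<le> card F" by (simp only: of_nat_le_iff)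
qed

text \<open>The lower limit is approached up to \<open>\<kappa>\<close> on frequently many sets.
  Quasi-tiling a very invariant set by such shapes carries the bound over to it; monotonicity pays
  for incomplete tiles and linear growth for the uncovered rest.\<close>

theorem Ornstein_Weiss:
  fixes f :: "'g::group_add set \<Rightarrow> real"
  assumes nb: "(Foelner_filter :: 'g set filter) \<noteq> bot"
    and f0: "f {} = 0" and mono: "\<And>F F'. finite F' \<Longrightarrow> F \<subseteq> F' \<Longrightarrow> f F \<le> f F'"
    and sub: "\<And>F F'. finite F \<Longrightarrow> finite F' \<Longrightarrow> f (F \<union> F') \<le> f F + f F'"
    and inv: "\<And>F c. finite F \<Longrightarrow> f (rtr F c) = f F"
  shows "\<exists>l. ((\<lambda>F. f F / card F) \<longlongrightarrow> l) Foelner_filter"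
proof -
  define h where "h F = f F / card F" for F
  define c0 where "c0 = f {0}"
  have nonneg: "0 \<le> f F" if "finite F" for F
    using mono[OF that, of "{}"] f0 by simp
  have "c0 \<ge> 0" by (simp add: c0_def nonneg)
  have UN: "f (\<Union>A\<in>S. A) \<le> (\<Sum>A\<in>S. f A)" if "finite S" "\<And>A. A \<in> S \<Longrightarrow> finite A" for S
    using that
  proof (induction S)
    case (insert A S)
    have "f (A \<union> (\<Union>A\<in>S. A)) \<le> f A + f (\<Union>A\<in>S. A)"
      using insert by (intro sub) auto
    with insert show ?case by simp
  qed (simp add: f0)
  have lin: "f F \<le> c0 * card F" if "finite F" for F
  proof -
    have "f F = f (\<Union>A\<in>(\<lambda>x. {x}) ` F. A)" by simp
    also have "... \<le> (\<Sum>A\<in>(\<lambda>x. {x}) ` F. f A)"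
      using that by (intro UN) auto
    also have "... = (\<Sum>x\<in>F. f {x})"
      by (simp add: sum.reindex)
    also have "... = (\<Sum>x\<in>F. c0)"
    proof (rule sum.cong)
      show "f {x} = c0" for x
        using inv[of "{0}" x] by (simp add: c0_def)
    qed simp
    finally show ?thesis by (simp add: mult.commute)
  qed
  \<comment> \<open>Eventual lower bounds; their supremum is the lower limit of
    \<open>h\<close>.\<close>
  define S where "S = {a. eventually (\<lambda>F. a \<le> h F) Foelner_filter}"
  have "0 \<in> S"
    unfolding S_def using eventually_finite_Foelner
    by (auto elim!: eventually_mono simp: h_def nonneg)
  have bd: "a \<le> c0" if "a \<in> S" for a
  proof -
    have "eventually (\<lambda>F. a \<le> h F) Foelner_filter" using that by (simp add: S_def)
    then have "eventually (\<lambda>F::'g set. a \<le> c0) Foelner_filter"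
      using eventually_finite_Foelner
    proof eventually_elim
      case (elim F)
      then have "h F \<le> c0" using lin[of F] by (simp add: h_def divide_le_eq card_gt_0_iff)
      then show ?case using elim by simp
    qed
    then show ?thesis using nb by (simp add: eventually_const_iff)
  qed
  then have bdd: "bdd_above S" by (auto simp: bdd_above_def)
  define l where "l = Sup S"
  have "l \<ge> 0" unfolding l_def using \<open>0 \<in> S\<close> bdd by (rule cSup_upper)
  have "(h \<longlongrightarrow> l) Foelner_filter"
  proof (rule order_tendstoI)
    fix a assume "a < l"
    then obtain b where "b \<in> S" "a < b"
      unfolding l_def using less_cSupE \<open>0 \<in> S\<close> by (metis empty_iff)
    then show "eventually (\<lambda>F. a < h F) Foelner_filter"
      by (auto simp: S_def elim!: eventually_mono)
  next
    fix a assume "l < a"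
    define \<kappa> where "\<kappa> = (a - l) / 3"
    have \<kappa>: "\<kappa> > 0" "l + 2 * \<kappa> < a" using \<open>l < a\<close> by (auto simp: \<kappa>_def field_simps)
    \<comment> \<open>Read off from the final estimate: the losses add up to
      \<open>eps * (2 * (l + \<kappa>) + c0)\<close>, which must not exceed \<open>\<kappa>\<close>.
      The bound 1/2 gives \<open>1 \<le> (1 + 2 * eps) * (1 - eps)\<close>.\<close>
    define eps where "eps = min (1/2) (\<kappa> / (2 * (l + \<kappa>) + c0 + 1))"
    have den: "2 * (l + \<kappa>) + c0 + 1 > 0" using \<open>l \<ge> 0\<close> \<open>c0 \<ge> 0\<close> \<kappa> by simp
    then have eps: "0 < eps" "eps \<le> 1/2" "eps \<le> \<kappa> / (2 * (l + \<kappa>) + c0 + 1)" using \<kappa> unfolding eps_def by (simp, linarith+)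
    have "eps * (2 * (l + \<kappa>) + c0 + 1) \<le> \<kappa>"
      using eps(3) den by (simp add: pos_le_divide_eq)
    then have eps\<kappa>: "eps * (2 * (l + \<kappa>) + c0) \<le> \<kappa>"
      using eps(1) by (simp add: algebra_simps)
    have "frequently (\<lambda>F. h F < l + \<kappa>) Foelner_filter"
    proof (rule ccontr)
      assume "\<not> ?thesis"
      then have "l + \<kappa> \<in> S" by (simp add: S_def not_frequently not_less)
      then have "l + \<kappa> \<le> l" unfolding l_def using bdd by (rule cSup_upper)
      then show False using \<kappa> by simp
    qed
    from Foelner_quasi_tiling[OF eps(1) this]
    obtain L \<T> where L: "finite L" "\<And>T. T \<in> L \<Longrightarrow> h T < l + \<kappa> \<and> finite T \<and> T \<noteq> {}" "disjoint \<T>"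
      "\<And>A. A \<in> \<T> \<Longrightarrow> \<exists>T\<in>L. \<exists>c. A \<subseteq> rtr T c \<and> (1 - eps) * card T \<le> card A"
      "eventually (covers \<T> eps) Foelner_filter"
      by blast
    have tile: "f A \<le> (l + \<kappa>) * (1 + 2 * eps) * card A" if mem: "A \<in> \<T>" for A
    proof -
      obtain T c where T: "T \<in> L" "A \<subseteq> rtr T c" "(1 - eps) * card T \<le> card A"
        using L(4)[OF mem] by auto
      have fT: "finite T" "card T > 0" "h T < l + \<kappa>" using L(2)[OF T(1)] by (auto simp: card_gt_0_iff)
      have "1 \<le> (1 + 2 * eps) * (1 - eps)"
        using eps by (simp add: algebra_simps mult_left_le)
      then have "1 * real (card T) \<le> (1 + 2 * eps) * (1 - eps) * card T"
        by (intro mult_right_mono) auto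
      also have "... \<le> (1 + 2 * eps) * card A"
        using T(3) eps(1) by (simp add: mult.assoc mult_left_mono)
      finally have cT: "card T \<le> (1 + 2 * eps) * card A" by simp
      have "f A \<le> f (rtr T c)" using T fT by (intro mono) auto
      also have "... = f T" using fT by (intro inv)
      also have "... \<le> (l + \<kappa>) * card T"
        using fT by (simp add: h_def divide_less_eq)
      also have "... \<le> (l + \<kappa>) * ((1 + 2 * eps) * card A)"
        using cT \<open>l \<ge> 0\<close> \<kappa> by (intro mult_left_mono) auto
      finally show ?thesis by (simp add: mult.assoc)
    qed
    show "eventually (\<lambda>F. h F < a) Foelner_filter"
      using L(5) eventually_finite_Foelner
    proof eventually_elim
      case (elim F)
      define S where "S = {A\<in>\<T>. A \<subseteq> F}"
      have fS: "finite S" "\<And>A. A \<in> S \<Longrightarrow> finite A"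
        using elim by (auto simp: S_def intro: finite_subset[of _ "Pow F"] finite_subset[of _ F])
      have "F = (\<Union>A\<in>S. A) \<union> (F - \<Union>S)" by (auto simp: S_def)
      then have "f F \<le> f (\<Union>A\<in>S. A) + f (F - \<Union>S)"
        using sub[of "\<Union>A\<in>S. A" "F - \<Union>S"] fS elim by auto
      also have "... \<le> (\<Sum>A\<in>S. f A) + c0 * card (F - \<Union>S)"
        using UN[OF fS] lin[of "F - \<Union>S"] elim by auto
      also have "(\<Sum>A\<in>S. f A) \<le> (\<Sum>A\<in>S. (l + \<kappa>) * (1 + 2 * eps) * card A)"
        by (intro sum_mono tile) (auto simp: S_def)
      also have "... = (l + \<kappa>) * (1 + 2 * eps) * real (\<Sum>A\<in>S. card A)"
        by (simp add: sum_distrib_left)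
      also have "(l + \<kappa>) * (1 + 2 * eps) * real (\<Sum>A\<in>S. card A) \<le> (l + \<kappa>) * (1 + 2 * eps) * real (card F)"
      proof (rule mult_left_mono[OF sum_card_le(2)])
        show "disjoint S" using L(3) by (auto simp: S_def disjoint_def)
      qed (use elim eps \<kappa> \<open>l \<ge> 0\<close> in \<open>auto simp: S_def\<close>)
      also have "c0 * card (F - \<Union>S) \<le> c0 * (eps * card F)"
        using elim \<open>c0 \<ge> 0\<close> by (intro mult_left_mono) (auto simp: covers_def S_def)
      also have "(l + \<kappa>) * (1 + 2 * eps) * card F + c0 * (eps * card F) =
          (l + \<kappa> + eps * (2 * (l + \<kappa>) + c0)) * card F"
        by (simp add: algebra_simps)
      also have "... \<le> (l + \<kappa> + \<kappa>) * card F"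
        using eps\<kappa> by (intro mult_right_mono) auto
      finally have "h F \<le> l + 2 * \<kappa>"
        using elim by (simp add: h_def divide_le_eq card_gt_0_iff algebra_simps)
      then show ?case using \<kappa> by simp
    qed
  qed
  then show ?thesis unfolding h_def by blast
qed

subsection \<open>Entropy by covers and by separated sets\<close>

lemma cover_num_le:
  assumes "finite I" "\<And>i. i \<in> I \<Longrightarrow> \<exists>W\<in>U. B i \<subseteq> W" "(\<Union>i\<in>I. B i) = UNIV"
  shows "cover_num U \<le> card I"
proof -
  obtain w where w: "\<And>i. i \<in> I \<Longrightarrow> w i \<in> U \<and> B i \<subseteq> w i"
    using assms(2) by metis
  have "cover_num U \<le> card (w ` I)"
    unfolding cover_num_def
  proof (rule cInf_lower)
    have "x \<in> \<Union>(w ` I)" for x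
    proof -
      obtain i where "i \<in> I" "x \<in> B i" using assms(3) by blast
      then show ?thesis using w[of i] by blast
    qed
    then have "\<Union>(w ` I) = UNIV" by blast
    moreover have "w ` I \<subseteq> U" "finite (w ` I)" using w assms(1) by auto
    ultimately show "card (w ` I) \<in> {card V |V. V \<subseteq> U \<and> finite V \<and> \<Union>V = UNIV}"
      by blast
  qed auto
  also have "... \<le> card I"
    using assms(1) by (rule card_image_le)
  finally show ?thesis .
qed

lemma cover_num_witness:
  assumes "compact (UNIV :: 'a::topological_space set)" "open_cover (U :: 'a set set)"
  obtains V where "V \<subseteq> U" "finite V" "\<Union>V = UNIV" "card V = cover_num U"
proof -
  obtain V where "V \<subseteq> U" "finite V" "UNIV \<subseteq> \<Union>V"
    using compactE[OF assms(1), of U] assms(2) unfolding open_cover_def by (metis top_greatest)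
  then have "card V \<in> {card V | V. V \<subseteq> U \<and> finite V \<and> \<Union>V = UNIV}" by auto
  then have "{card V | V. V \<subseteq> U \<and> finite V \<and> \<Union>V = UNIV} \<noteq> {}" by blast
  from Inf_nat_def1[OF this] show thesis
    using that unfolding cover_num_def by auto
qed

lemma cover_num_pos:
  assumes "compact (UNIV :: 'a::topological_space set)" "open_cover (U :: 'a set set)"
  shows "cover_num U > 0"
proof -
  obtain V where V: "V \<subseteq> U" "finite V" "\<Union>V = UNIV" "card V = cover_num U"
    by (rule cover_num_witness[OF assms])
  then have "V \<noteq> {}" by auto
  with V show ?thesis by (metis card_gt_0_iff)
qed

lemma action_comp: "is_action T \<Longrightarrow> T (g + h) x = T g (T h x)"
  by (simp add: is_action_def)

lemma action_continuous: "is_action T \<Longrightarrow> continuous_on A (T g)"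
  unfolding is_action_def by (meson continuous_on_subset subset_UNIV)

lemma join_cover_empty: "open_cover U \<Longrightarrow> join_cover T {} U = {UNIV}"
  by (auto simp: join_cover_def)

lemma open_cover_join:
  assumes "is_action T" "open_cover U" "finite F"
  shows "open_cover (join_cover T F U)"
  unfolding open_cover_def
proof
  show "\<forall>W\<in>join_cover T F U. open W"
    using assms unfolding join_cover_def open_cover_def
    by (auto intro!: open_INT open_vimage action_continuous)
  have "x \<in> \<Union>(join_cover T F U)" for x
  proof -
    have "\<forall>y. \<exists>W\<in>U. y \<in> W" using assms(2) unfolding open_cover_def by blast
    then obtain w where "\<And>y. w y \<in> U \<and> y \<in> w y" by metis
    then show ?thesis
      unfolding join_cover_def by (intro UnionI[of "\<Inter>s\<in>F. T s -` w (T s x)"]) auto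
  qed
  then show "\<Union>(join_cover T F U) = UNIV" by auto
qed

lemma cover_num_join_mono:
  assumes "compact (UNIV :: 'a::topological_space set)" "is_action T" "open_cover (U :: 'a set set)"
    and "finite F'" "F \<subseteq> F'"
  shows "cover_num (join_cover T F U) \<le> cover_num (join_cover T F' U)"
proof -
  obtain V where V: "V \<subseteq> join_cover T F' U" "finite V" "\<Union>V = UNIV" "card V = cover_num (join_cover T F' U)"
    using cover_num_witness[OF assms(1) open_cover_join[OF assms(2-4)]] by blast
  have "\<exists>W\<in>join_cover T F U. B \<subseteq> W" if B: "B \<in> V" for B
  proof -
    obtain w where w: "B = (\<Inter>s\<in>F'. T s -` w s)" "\<forall>s\<in>F'. w s \<in> U"
      using B V(1) by (auto simp: join_cover_def)
    have "(\<Inter>s\<in>F. T s -` w s) \<in> join_cover T F U"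
      using w assms(5) unfolding join_cover_def by blast
    moreover have "B \<subseteq> (\<Inter>s\<in>F. T s -` w s)" using w assms(5) by auto
    ultimately show ?thesis by blast
  qed
  with cover_num_le[of V "join_cover T F U" "\<lambda>B. B"] V show ?thesis by auto
qed

lemma cover_num_join_Un:
  assumes "compact (UNIV :: 'a::topological_space set)" "is_action T" "open_cover (U :: 'a set set)"
    and "finite F" "finite F'"
  shows "cover_num (join_cover T (F \<union> F') U) \<le> cover_num (join_cover T F U) * cover_num (join_cover T F' U)"
proof -
  obtain V where V: "V \<subseteq> join_cover T F U" "finite V" "\<Union>V = UNIV" "card V = cover_num (join_cover T F U)"
    using cover_num_witness[OF assms(1) open_cover_join[OF assms(2-4)]] by blast
  obtain V' where V': "V' \<subseteq> join_cover T F' U" "finite V'" "\<Union>V' = UNIV" "card V' = cover_num (join_cover T F' U)"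
    using cover_num_witness[OF assms(1) open_cover_join[OF assms(2,3,5)]] by blast
  have "\<exists>W\<in>join_cover T (F \<union> F') U. fst p \<inter> snd p \<subseteq> W" if p: "p \<in> V \<times> V'" for p
  proof -
    obtain w where w: "fst p = (\<Inter>s\<in>F. T s -` w s)" "\<forall>s\<in>F. w s \<in> U"
      using p V(1) by (auto simp: join_cover_def)
    obtain w' where w': "snd p = (\<Inter>s\<in>F'. T s -` w' s)" "\<forall>s\<in>F'. w' s \<in> U"
      using p V'(1) by (auto simp: join_cover_def)
    define v where "v s = (if s \<in> F then w s else w' s)" for s
    have "\<forall>s\<in>F \<union> F'. v s \<in> U" using w(2) w'(2) by (auto simp: v_def)
    then have "(\<Inter>s\<in>F \<union> F'. T s -` v s) \<in> join_cover T (F \<union> F') U"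
      unfolding join_cover_def by blast
    moreover have "fst p \<inter> snd p \<subseteq> (\<Inter>s\<in>F \<union> F'. T s -` v s)"
      unfolding w(1) w'(1) by (auto simp: v_def)
    ultimately show ?thesis by blast
  qed
  moreover have "(\<Union>p\<in>V \<times> V'. fst p \<inter> snd p) = UNIV"
  proof -
    have "\<exists>p\<in>V \<times> V'. x \<in> fst p \<inter> snd p" for x
    proof -
      obtain A B where "A \<in> V" "x \<in> A" "B \<in> V'" "x \<in> B" using V(3) V'(3) by blast
      then show ?thesis by (intro bexI[of _ "(A, B)"]) auto
    qed
    then show ?thesis by blast
  qed
  ultimately have "cover_num (join_cover T (F \<union> F') U) \<le> card (V \<times> V')"
    using V(2) V'(2) by (intro cover_num_le[where B = "\<lambda>p. fst p \<inter> snd p"]) auto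
  then show ?thesis
    by (simp add: card_cartesian_product V(4) V'(4))
qed

lemma cover_num_join_rtr:
  assumes "compact (UNIV :: 'a::topological_space set)" "is_action T" "open_cover (U :: 'a set set)"
    and "finite F"
  shows "cover_num (join_cover T (rtr F c) U) \<le> cover_num (join_cover T F U)"
proof -
  obtain V where V: "V \<subseteq> join_cover T F U" "finite V" "\<Union>V = UNIV" "card V = cover_num (join_cover T F U)"
    using cover_num_witness[OF assms(1) open_cover_join[OF assms(2-4)]] by blast
  have "\<exists>W\<in>join_cover T (rtr F c) U. T c -` B \<subseteq> W" if B: "B \<in> V" for B
  proof -
    obtain w where w: "B = (\<Inter>s\<in>F. T s -` w s)" "\<forall>s\<in>F. w s \<in> U"
      using B V(1) by (auto simp: join_cover_def)
    have "(\<Inter>s\<in>rtr F c. T s -` w (s - c)) \<in> join_cover T (rtr F c) U"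
      unfolding join_cover_def using w(2) by (auto intro!: exI[of _ "\<lambda>s. w (s - c)"])
    moreover have "T c -` B \<subseteq> (\<Inter>s\<in>rtr F c. T s -` w (s - c))"
      unfolding w(1) by (auto simp: action_comp[OF assms(2)])
    ultimately show ?thesis by blast
  qed
  moreover have "(\<Union>B\<in>V. T c -` B) = UNIV"
    using V(3) by (metis vimage_UNIV vimage_Union)
  ultimately show ?thesis
    using cover_num_le[of V "join_cover T (rtr F c) U" "\<lambda>B. T c -` B"] V by auto
qed

text \<open>\<open>htop\<close> is defined through \<open>Lim\<close>, which is meaningful only
  where the limit exists. The logarithms of the cover numbers are monotone, subadditive and
  translation invariant, so the Ornstein-Weiss lemma provides it.\<close>

lemma cover_entropy_tendsto:
  fixes T :: "'g::group_add \<Rightarrow> 'a::topological_space \<Rightarrow> 'a"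
  assumes "compact (UNIV :: 'a set)" "is_action T" "open_cover U"
    and nb: "(Foelner_filter :: 'g set filter) \<noteq> bot"
  shows "((\<lambda>F. ln (real (cover_num (join_cover T F U))) / real (card F)) \<longlongrightarrow>
    Lim Foelner_filter (\<lambda>F. ln (real (cover_num (join_cover T F U))) / real (card F))) Foelner_filter"
proof -
  define f where "f F = (if finite F then ln (real (cover_num (join_cover T F U))) else 0)" for F
  have pos: "cover_num (join_cover T F U) > 0" if "finite F" for F
    using assms that by (intro cover_num_pos open_cover_join)
  have inv_le: "f (rtr F c) \<le> f F" if "finite F" for F c
    using cover_num_join_rtr[OF assms(1-3) that, of c] pos[of F] pos[of "rtr F c"] that
    by (simp add: f_def)
  have "\<exists>l. ((\<lambda>F. f F / card F) \<longlongrightarrow> l) Foelner_filter"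
  proof (rule Ornstein_Weiss[OF nb])
    have "cover_num {UNIV :: 'a set} \<le> 1"
      using cover_num_le[of "{UNIV :: 'a set}" "{UNIV}" "\<lambda>B. B"] by simp
    moreover have "cover_num {UNIV :: 'a set} > 0"
      using pos[of "{}"] join_cover_empty[OF assms(3), of T] by simp
    ultimately show "f {} = 0"
      by (simp add: f_def join_cover_empty[OF assms(3)] le_Suc_eq)
    show "f F \<le> f F'" if "finite F'" "F \<subseteq> F'" for F F'
      using cover_num_join_mono[OF assms(1-3) that] that finite_subset[OF that(2,1)] pos
      by (simp add: f_def)
    show "f (F \<union> F') \<le> f F + f F'" if "finite F" "finite F'" for F F'
    proof -
      have "real (cover_num (join_cover T (F \<union> F') U)) \<le>
          real (cover_num (join_cover T F U)) * real (cover_num (join_cover T F' U))"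
        using cover_num_join_Un[OF assms(1-3) that] by (simp flip: of_nat_mult)
      then have "ln (real (cover_num (join_cover T (F \<union> F') U))) \<le>
          ln (real (cover_num (join_cover T F U)) * real (cover_num (join_cover T F' U)))"
        using that pos[of "F \<union> F'"] by (intro ln_mono) auto
      also have "... = ln (real (cover_num (join_cover T F U))) + ln (real (cover_num (join_cover T F' U)))"
        using that pos by (intro ln_mult_pos) auto
      finally show ?thesis using that by (simp add: f_def)
    qed
    show "f (rtr F c) = f F" if "finite F" for F c
    proof (rule antisym)
      show "f (rtr F c) \<le> f F" by (rule inv_le[OF that])
      have "rtr (rtr F c) (- c) = F" by (simp add: image_image add.assoc)
      then show "f F \<le> f (rtr F c)" using inv_le[of "rtr F c" "- c"] that by simp
    qed
  qed
  then obtain l where l: "((\<lambda>F. f F / card F) \<longlongrightarrow> l) Foelner_filter" by blast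
  have *: "((\<lambda>F. ln (real (cover_num (join_cover T F U))) / real (card F)) \<longlongrightarrow> l) Foelner_filter"
    using l by (rule Lim_transform_eventually)
      (use eventually_finite_Foelner in \<open>auto elim!: eventually_mono simp: f_def\<close>)
  show ?thesis
    unfolding tendsto_Lim[OF nb *] by (rule *)
qed

section \<open>Separated sets against cover numbers\<close>

lemma dist_F_le_iff:
  "finite F \<Longrightarrow> F \<noteq> {} \<Longrightarrow> dist_F T F x y \<le> e \<longleftrightarrow> (\<forall>s\<in>F. dist (T s x) (T s y) \<le> e)"
  by (simp add: dist_F_def)

lemma dist_F_commute: "dist_F T F x y = dist_F T F y x"
  by (simp add: dist_F_def dist_commute)

lemma card_separated_le_cover_num:
  fixes T :: "'g::group_add \<Rightarrow> 'a::metric_space \<Rightarrow> 'a"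
  assumes "compact (UNIV :: 'a set)" "is_action T" "open_cover U" "finite F" "F \<noteq> {}"
    and diam: "\<And>W x y. W \<in> U \<Longrightarrow> x \<in> W \<Longrightarrow> y \<in> W \<Longrightarrow> dist x y \<le> eps"
    and E: "finite E" "separated T F eps E"
  shows "card E \<le> cover_num (join_cover T F U)"
proof -
  obtain V where V: "V \<subseteq> join_cover T F U" "finite V" "\<Union>V = UNIV" "card V = cover_num (join_cover T F U)"
    using cover_num_witness[OF assms(1) open_cover_join[OF assms(2-4)]] by blast
  have "\<forall>x. \<exists>B\<in>V. x \<in> B" using V(3) by blast
  then obtain B where B: "\<And>x. B x \<in> V \<and> x \<in> B x" by metis
  have "inj_on B E"
  proof (rule inj_onI, rule ccontr)
    fix x y assume xy: "x \<in> E" "y \<in> E" "B x = B y" "x \<noteq> y"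
    obtain w where w: "B x = (\<Inter>s\<in>F. T s -` w s)" "\<forall>s\<in>F. w s \<in> U"
      using B[of x] V(1) by (auto simp: join_cover_def)
    have "x \<in> B x" "y \<in> B x" using B[of x] B[of y] xy by auto
    then have "\<forall>s\<in>F. dist (T s x) (T s y) \<le> eps"
      unfolding w(1) using w(2) by (auto intro: diam)
    then have "dist_F T F x y \<le> eps" by (simp add: dist_F_le_iff assms(4,5))
    then show False using E(2) xy unfolding separated_def by force
  qed
  then have "card E \<le> card V"
    using B V(2) by (intro card_inj_on_le[of B]) auto
  then show ?thesis using V(4) by simp
qed

lemma open_cover_balls:
  assumes "0 < eps"
  shows "open_cover (range (\<lambda>x::'a::metric_space. ball x (eps / 2)))"
    "W \<in> range (\<lambda>x::'a. ball x (eps / 2)) \<Longrightarrow> x \<in> W \<Longrightarrow> y \<in> W \<Longrightarrow> dist x y \<le> eps"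
proof -
  have "x \<in> ball x (eps / 2)" for x :: 'a using assms by simp
  then show "open_cover (range (\<lambda>x::'a. ball x (eps / 2)))"
    unfolding open_cover_def by blast
  assume "W \<in> range (\<lambda>x::'a. ball x (eps / 2))" "x \<in> W" "y \<in> W"
  then obtain z where "dist z x < eps / 2" "dist z y < eps / 2" by auto
  then show "dist x y \<le> eps" using dist_triangle_half_r[of z x eps y] by simp
qed

context
  fixes T :: "'g::group_add \<Rightarrow> 'a::metric_space \<Rightarrow> 'a" and F :: "'g set"
  assumes cpt: "compact (UNIV :: 'a set)" and act: "is_action T" and F: "finite F" "F \<noteq> {}"
begin

text \<open>\<open>sep_num\<close> is a \<open>Sup\<close> of naturals, which is a true maximum only
  for a bounded set; a finite subcover by small balls gives the bound.\<close>

lemma finite_separated_cards: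
  assumes "0 < eps"
  shows "finite {card E | E. E \<subseteq> Z \<and> finite E \<and> separated T F eps E}"
proof -
  let ?N = "cover_num (join_cover T F (range (\<lambda>x::'a. ball x (eps / 2))))"
  have "{card E | E. E \<subseteq> Z \<and> finite E \<and> separated T F eps E} \<subseteq> {..?N}"
    using card_separated_le_cover_num[OF cpt act open_cover_balls(1)[OF assms] F]
      open_cover_balls(2)[OF assms] by blast
  then show ?thesis by (rule finite_subset) auto
qed

lemma card_le_sep_num:
  assumes "0 < eps" "E \<subseteq> Z" "finite E" "separated T F eps E"
  shows "card E \<le> sep_num T F Z eps"
  unfolding sep_num_def
proof (rule cSup_upper)
  show "bdd_above {card E | E. E \<subseteq> Z \<and> finite E \<and> separated T F eps E}"
    by (rule bdd_above_finite[OF finite_separated_cards[OF assms(1)]])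
  show "card E \<in> {card E | E. E \<subseteq> Z \<and> finite E \<and> separated T F eps E}"
    using assms by (intro CollectI exI[of _ E]) simp
qed

lemma sep_num_witness:
  assumes "0 < eps"
  obtains E where "E \<subseteq> Z" "finite E" "separated T F eps E" "card E = sep_num T F Z eps"
proof -
  let ?S = "{card E | E. E \<subseteq> Z \<and> finite E \<and> separated T F eps E}"
  have "card {} \<in> ?S" unfolding mem_Collect_eq by (intro exI[of _ "{}"]) (simp add: separated_def)
  then have ne: "?S \<noteq> {}" by blast
  have "sep_num T F Z eps = Max ?S"
    unfolding sep_num_def by (rule cSup_eq_Max[OF finite_separated_cards[OF assms] ne])
  also have "Max ?S \<in> ?S"
    by (rule Max_in[OF finite_separated_cards[OF assms] ne])
  finally have "sep_num T F Z eps \<in> ?S" .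
  then obtain E where "sep_num T F Z eps = card E" "E \<subseteq> Z" "finite E" "separated T F eps E"
    by blast
  then show thesis using that[of E] by simp
qed

text \<open>A separated set of maximal size is spanning: a point far from all of it could be
  adjoined.\<close>

lemma sep_num_spanning:
  assumes "0 < eps" and E: "E \<subseteq> Z" "finite E" "separated T F eps E" "card E = sep_num T F Z eps"
    and "y \<in> Z"
  shows "\<exists>x\<in>E. dist_F T F x y \<le> eps"
proof (rule ccontr)
  assume no: "\<not> ?thesis"
  have "y \<notin> E"
  proof
    assume "y \<in> E"
    then have "eps < dist_F T F y y" using no by force
    moreover have "dist_F T F y y \<le> eps" using assms(1) F by (simp add: dist_F_le_iff)
    ultimately show False by simp
  qed
  have "eps < dist_F T F x y" "eps < dist_F T F y x" if "x \<in> E" for x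
    using no that dist_F_commute[of T F x y] by force+
  then have "separated T F eps (insert y E)"
    using E(3) unfolding separated_def by blast
  then have "card (insert y E) \<le> sep_num T F Z eps"
    using assms by (intro card_le_sep_num) auto
  then show False using E \<open>y \<notin> E\<close> by simp
qed

lemma sep_num_mono:
  assumes "0 < eps" "Z \<subseteq> Z'"
  shows "sep_num T F Z eps \<le> sep_num T F Z' eps"
proof -
  obtain E where E: "E \<subseteq> Z" "finite E" "separated T F eps E" "card E = sep_num T F Z eps"
    by (rule sep_num_witness[OF assms(1), of Z])
  with card_le_sep_num[OF assms(1) _ E(2,3), of Z'] assms(2) show ?thesis by simp
qed

lemma sep_num_antimono:
  assumes "0 < eps" "eps \<le> eps'"
  shows "sep_num T F Z eps' \<le> sep_num T F Z eps"
proof -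
  obtain E where E: "E \<subseteq> Z" "finite E" "separated T F eps' E" "card E = sep_num T F Z eps'"
    using sep_num_witness[of eps' Z] assms by auto
  have "separated T F eps E" using E(3) assms(2) unfolding separated_def by force
  then show ?thesis using card_le_sep_num[OF assms(1) E(1,2)] E(4) by simp
qed

lemma sep_num_le_cover_num:
  assumes "0 < eps"
  shows "sep_num T F Z eps \<le> cover_num (join_cover T F (range (\<lambda>x::'a. ball x (eps / 2))))"
proof -
  obtain E where E: "E \<subseteq> Z" "finite E" "separated T F eps E" "card E = sep_num T F Z eps"
    using sep_num_witness[OF assms] by auto
  show ?thesis
    using card_separated_le_cover_num[OF cpt act open_cover_balls(1)[OF assms] F open_cover_balls(2)[OF assms] E(2,3)]
    unfolding E(4) by simp
qed

lemma cover_num_le_sep_num: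
  assumes "0 < eps" "\<And>x. \<exists>W\<in>U. cball x eps \<subseteq> W"
  shows "cover_num (join_cover T F U) \<le> sep_num T F UNIV eps"
proof -
  obtain E where E: "E \<subseteq> UNIV" "finite E" "separated T F eps E" "card E = sep_num T F UNIV eps"
    by (rule sep_num_witness[OF assms(1), of UNIV])
  obtain w where w: "\<And>x. w x \<in> U \<and> cball x eps \<subseteq> w x" using assms(2) by metis
  have "\<exists>W\<in>join_cover T F U. {y. dist_F T F x y \<le> eps} \<subseteq> W" for x
  proof
    show "(\<Inter>s\<in>F. T s -` w (T s x)) \<in> join_cover T F U"
      unfolding join_cover_def by (intro CollectI exI[of _ "\<lambda>s. w (T s x)"]) (use w in auto)
    show "{y. dist_F T F x y \<le> eps} \<subseteq> (\<Inter>s\<in>F. T s -` w (T s x))"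
      using w F by (auto simp: dist_F_le_iff subset_iff)
  qed
  moreover have "(\<Union>x\<in>E. {y. dist_F T F x y \<le> eps}) = UNIV"
    using sep_num_spanning[OF assms(1) E] by blast
  ultimately show ?thesis
    using cover_num_le[OF E(2), of "join_cover T F U" "\<lambda>x. {y. dist_F T F x y \<le> eps}"] E(4) by simp
qed

end

text \<open>Zero is included through the default \<open>ln 0 = 0\<close>; it occurs because
  \<open>sep_num\<close> vanishes for empty \<open>Z\<close>.\<close>

lemma ln_of_nat_mono: "a \<le> b \<Longrightarrow> ln (real a) \<le> ln (real b)"
  by (cases "a = 0"; cases "b = 0") auto

text \<open>Smaller scales separate more points, so the \<open>Lim\<close> in \<open>hUC\<close> is
  a genuine limit and equals a supremum, which absorbs any constant factor in the scale.\<close>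

lemma Lim_at_right_antimono:
  fixes f :: "real \<Rightarrow> ereal"
  assumes "\<And>x y. 0 < x \<Longrightarrow> x \<le> y \<Longrightarrow> f y \<le> f x"
  shows "Lim (at_right 0) f = (SUP x\<in>{0<..}. f x)"
proof (rule tendsto_Lim)
  show "(f \<longlongrightarrow> (SUP x\<in>{0<..}. f x)) (at_right 0)"
  proof (rule order_tendstoI)
    fix a assume "a < (SUP x\<in>{0<..}. f x)"
    then obtain e where e: "e > 0" "a < f e" by (auto simp: less_SUP_iff)
    have "eventually (\<lambda>x. x < e) (at_right 0)"
      by (rule eventually_at_rightI[OF _ e(1)]) auto
    then show "eventually (\<lambda>x. a < f x) (at_right 0)"
      using eventually_at_right_less[of "0::real"]
      by eventually_elim (use e assms in \<open>fastforce intro: less_le_trans\<close>)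
  next
    fix a assume a: "(SUP x\<in>{0<..}. f x) < a"
    show "eventually (\<lambda>x. f x < a) (at_right 0)"
      using eventually_at_right_less[of "0::real"]
      by eventually_elim (use a in \<open>auto intro: le_less_trans[OF SUP_upper]\<close>)
  qed
qed simp

definition sep_rate :: "('g \<Rightarrow> 'a::metric_space \<Rightarrow> 'a) \<Rightarrow> 'a set \<Rightarrow> (nat \<Rightarrow> 'g set) \<Rightarrow> real \<Rightarrow> ereal" where
  "sep_rate T Z Fn eps = limsup (\<lambda>n. ereal (ln (real (sep_num T (Fn n) Z eps)) / real (card (Fn n))))"

context
  fixes T :: "'g::group_add \<Rightarrow> 'a::metric_space \<Rightarrow> 'a" and Fn :: "nat \<Rightarrow> 'g set"
  assumes cpt: "compact (UNIV :: 'a set)" and act: "is_action T" and Fn: "Foelner_seq Fn"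
begin

lemma Foelner_seq_finite: "finite (Fn n)" "Fn n \<noteq> {}"
  using Fn by (auto simp: Foelner_seq_def)

lemma hUC_eq_SUP: "hUC T Z Fn = (SUP eps\<in>{0<..}. sep_rate T Z Fn eps)"
  unfolding hUC_def sep_rate_def
proof (rule Lim_at_right_antimono, rule Limsup_mono, rule always_eventually, rule allI)
  fix x y :: real and n assume "0 < x" "x \<le> y"
  from sep_num_antimono[OF cpt act Foelner_seq_finite this]
  show "ereal (ln (real (sep_num T (Fn n) Z y)) / real (card (Fn n)))
      \<le> ereal (ln (real (sep_num T (Fn n) Z x)) / real (card (Fn n)))"
    by (simp add: divide_right_mono ln_of_nat_mono)
qed

lemma sep_rate_mono:
  assumes "0 < eps" "Z \<subseteq> Z'"
  shows "sep_rate T Z Fn eps \<le> sep_rate T Z' Fn eps"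
  unfolding sep_rate_def
proof (rule Limsup_mono, rule always_eventually, rule allI)
  fix n
  from sep_num_mono[OF cpt act Foelner_seq_finite assms]
  show "ereal (ln (real (sep_num T (Fn n) Z eps)) / real (card (Fn n)))
      \<le> ereal (ln (real (sep_num T (Fn n) Z' eps)) / real (card (Fn n)))"
    by (simp add: divide_right_mono ln_of_nat_mono)
qed

text \<open>For covers the limit exists along every Foelner sequence, so \<open>limsup\<close> there
  is a limit independent of the sequence. Covers by balls bound separated sets from above; a
  Lebesgue number bounds cover numbers by separated sets.\<close>

theorem hUC_UNIV_eq_htop: "hUC T UNIV Fn = htop T"
proof -
  define a where "a U = Lim Foelner_filter (\<lambda>F. ln (real (cover_num (join_cover T F U))) / real (card F))"
    for U :: "'a set set"
  have lim: "limsup (\<lambda>n. ereal (ln (real (cover_num (join_cover T (Fn n) U))) / real (card (Fn n)))) = ereal (a U)"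
    if "open_cover U" for U
  proof -
    have nb: "(Foelner_filter :: 'g set filter) \<noteq> bot"
      by (rule Foelner_filter_neq_bot[OF Fn])
    have 1: "((\<lambda>F. ln (real (cover_num (join_cover T F U))) / real (card F)) \<longlongrightarrow> a U) Foelner_filter"
      unfolding a_def by (rule cover_entropy_tendsto[OF cpt act that nb])
    have "(\<lambda>n. ln (real (cover_num (join_cover T (Fn n) U))) / real (card (Fn n))) \<longlonglongrightarrow> a U"
      by (rule filterlim_compose[OF 1 Foelner_seq_filterlim[OF Fn]])
    then have "(\<lambda>n. ereal (ln (real (cover_num (join_cover T (Fn n) U))) / real (card (Fn n)))) \<longlonglongrightarrow> ereal (a U)"
      by (rule tendsto_ereal)
    then show ?thesis
      by (rule lim_imp_Limsup[OF sequentially_bot])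
  qed
  have upper: "sep_rate T UNIV Fn eps \<le> ereal (a (range (\<lambda>x::'a. ball x (eps / 2))))" if "0 < eps" for eps
    unfolding sep_rate_def lim[OF open_cover_balls(1)[OF that], symmetric]
  proof (rule Limsup_mono, rule always_eventually, rule allI)
    fix n
    show "ereal (ln (real (sep_num T (Fn n) UNIV eps)) / real (card (Fn n)))
      \<le> ereal (ln (real (cover_num (join_cover T (Fn n) (range (\<lambda>x. ball x (eps / 2)))))) / real (card (Fn n)))"
      using sep_num_le_cover_num[OF cpt act Foelner_seq_finite that]
      by (simp add: divide_right_mono ln_of_nat_mono)
  qed
  have lower: "\<exists>eps>0. ereal (a U) \<le> sep_rate T UNIV Fn eps" if U: "open_cover U" for U
  proof -
    \<comment> \<open>\<open>e\<close> is a Lebesgue number of the cover; half of it is used because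
      spanning sets come with closed balls.\<close>
    obtain e where e: "e > 0" "\<And>x. \<exists>W\<in>U. ball x e \<subseteq> W"
      using Heine_Borel_lemma[OF cpt, of U] U unfolding open_cover_def by auto
    have cb: "\<exists>W\<in>U. cball x (e / 2) \<subseteq> W" for x
    proof -
      have "cball x (e / 2) \<subseteq> ball x e" using e(1) by auto
      then show ?thesis using e(2)[of x] by blast
    qed
    have "ereal (a U) \<le> sep_rate T UNIV Fn (e / 2)"
      unfolding sep_rate_def lim[OF U, symmetric]
    proof (rule Limsup_mono, rule always_eventually, rule allI)
      fix n
      show "ereal (ln (real (cover_num (join_cover T (Fn n) U))) / real (card (Fn n)))
        \<le> ereal (ln (real (sep_num T (Fn n) UNIV (e / 2))) / real (card (Fn n)))"
        using cover_num_le_sep_num[OF cpt act Foelner_seq_finite _ cb] e(1)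
        by (simp add: divide_right_mono ln_of_nat_mono)
    qed
    then show ?thesis using e(1) by (intro exI[of _ "e / 2"]) simp
  qed
  show ?thesis
    unfolding hUC_eq_SUP htop_def a_def[symmetric]
  proof (rule SUP_eq)
    fix eps :: real assume "eps \<in> {0<..}"
    then show "\<exists>U\<in>{U. open_cover U}. sep_rate T UNIV Fn eps \<le> ereal (a U)"
      using upper[of eps] open_cover_balls(1)[of eps] by auto
  next
    fix U :: "'a set set" assume "U \<in> {U. open_cover U}"
    then show "\<exists>eps\<in>{0<..}. ereal (a U) \<le> sep_rate T UNIV Fn eps"
      using lower[of U] by auto
  qed
qed

end

subsection \<open>The weak-star topology\<close>

abbreviation mean :: "'a measure \<Rightarrow> ('a \<Rightarrow> real) \<Rightarrow> real" where
  "mean \<equiv> lebesgue_integral"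

lemma Mprob_prob_space: "\<mu> \<in> Mprob \<Longrightarrow> prob_space \<mu>"
  and Mprob_sets: "\<mu> \<in> Mprob \<Longrightarrow> sets \<mu> = sets borel"
  by (simp_all add: Mprob_def)

lemma integrable_Mprob:
  fixes f :: "'a::metric_space \<Rightarrow> real"
  assumes cpt: "compact (UNIV :: 'a set)" and f: "continuous_on UNIV f" and \<mu>: "\<mu> \<in> Mprob"
  shows "integrable \<mu> f"
proof -
  interpret prob_space \<mu> using \<mu> by (rule Mprob_prob_space)
  have "bounded (range f)"
    using compact_continuous_image[OF f cpt] by (rule compact_imp_bounded)
  then obtain B where "\<And>x. norm (f x) \<le> B" by (auto simp: bounded_iff)
  moreover have "f \<in> borel_measurable \<mu>"
    using borel_measurable_continuous_onI[OF f] Mprob_sets[OF \<mu>] by (simp cong: measurable_cong_sets)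
  ultimately show ?thesis
    by (intro integrable_const_bound[of f B]) auto
qed

lemma integral_diff_le_Mprob:
  fixes f h :: "'a::metric_space \<Rightarrow> real"
  assumes cpt: "compact (UNIV :: 'a set)" and f: "continuous_on UNIV f" and h: "continuous_on UNIV h"
    and \<mu>: "\<mu> \<in> Mprob" and le: "\<And>x. \<bar>f x - h x\<bar> \<le> e"
  shows "\<bar>(\<integral>x. f x \<partial>\<mu>) - (\<integral>x. h x \<partial>\<mu>)\<bar> \<le> e"
proof -
  interpret prob_space \<mu> using \<mu> by (rule Mprob_prob_space)
  note int = integrable_Mprob[OF cpt f \<mu>] integrable_Mprob[OF cpt h \<mu>]
  have "(\<integral>x. f x \<partial>\<mu>) - (\<integral>x. h x \<partial>\<mu>) = (\<integral>x. f x - h x \<partial>\<mu>)"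
    using int by simp
  also have "\<bar>...\<bar> \<le> (\<integral>x. \<bar>f x - h x\<bar> \<partial>\<mu>)"
    by (rule integral_abs_bound)
  also have "... \<le> (\<integral>x. e \<partial>\<mu>)"
    using int by (intro integral_mono) (auto intro: le)
  finally show ?thesis by (simp add: prob_space)
qed

lemma empirical_Mprob:
  fixes T :: "'g \<Rightarrow> 'a::metric_space \<Rightarrow> 'a"
  assumes "finite F" "F \<noteq> {}"
  shows "empirical T F x \<in> Mprob"
proof -
  have "prob_space (uniform_count_measure F)"
    using assms by (rule prob_space_uniform_count_measure)
  then show ?thesis
    unfolding empirical_def Mprob_def
    by (auto intro!: prob_space.prob_space_distr simp: measurable_def space_uniform_count_measure sets_uniform_count_measure)
qed

lemma integral_empirical:
  fixes f :: "'a::metric_space \<Rightarrow> real"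
  assumes "finite F" "F \<noteq> {}" "continuous_on UNIV f"
  shows "(\<integral>y. f y \<partial>(empirical T F x)) = (\<Sum>s\<in>F. f (T s x)) / card F"
proof -
  have "(\<integral>y. f y \<partial>(empirical T F x)) = (\<integral>s. f (T s x) \<partial>(uniform_count_measure F))"
    unfolding empirical_def using assms
    by (intro integral_distr borel_measurable_continuous_onI)
       (auto simp: measurable_def space_uniform_count_measure sets_uniform_count_measure)
  then show ?thesis
    using assms by (simp add: integral_uniform_count_measure)
qed

lemma openin_weak_star_integral:
  "continuous_on UNIV (f :: 'a::topological_space \<Rightarrow> real) \<Longrightarrow> open U \<Longrightarrow>
    openin weak_star {\<mu> \<in> Mprob. (\<integral>x. f x \<partial>\<mu>) \<in> U}"
  unfolding weak_star_def by (rule topology_generated_by_Basis) blast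

lemma topspace_weak_star: "topspace (weak_star :: 'a::topological_space measure topology) = Mprob"
proof -
  have "Mprob = {\<mu> \<in> Mprob. (\<integral>x. 0 \<partial>\<mu>) \<in> (UNIV :: real set)}" by auto
  then have "(Mprob :: 'a measure set) \<in> {{\<mu> \<in> Mprob. (\<integral>x. f x \<partial>\<mu>) \<in> U} | (f :: 'a \<Rightarrow> real) U. continuous_on UNIV f \<and> open U}"
    by (intro CollectI exI[of _ "\<lambda>_. 0"] exI[of _ UNIV]) auto
  then show ?thesis
    unfolding weak_star_def topology_generated_by_topspace by blast
qed

text \<open>The topology is given by generators only, so convergence of integrals speaks about a
  subbasis; induction over the generation of an open set extends it to all open sets.\<close>

lemma limitin_weak_star_iff:
  fixes X :: "nat \<Rightarrow> 'a::topological_space measure"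
  assumes X: "\<And>n. X n \<in> Mprob" and \<mu>: "\<mu> \<in> Mprob"
  shows "limitin weak_star X \<mu> sequentially \<longleftrightarrow>
    (\<forall>f :: 'a \<Rightarrow> real. continuous_on UNIV f \<longrightarrow> (\<lambda>n. \<integral>x. f x \<partial>(X n)) \<longlonglongrightarrow> (\<integral>x. f x \<partial>\<mu>))"
proof
  assume lim: "limitin weak_star X \<mu> sequentially"
  show "\<forall>f :: 'a \<Rightarrow> real. continuous_on UNIV f \<longrightarrow> (\<lambda>n. \<integral>x. f x \<partial>(X n)) \<longlonglongrightarrow> (\<integral>x. f x \<partial>\<mu>)"
  proof (intro allI impI topological_tendstoI)
    fix f :: "'a \<Rightarrow> real" and U assume "continuous_on UNIV f" "open U" "(\<integral>x. f x \<partial>\<mu>) \<in> U"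
    with lim openin_weak_star_integral[of f U] \<mu>
    have "eventually (\<lambda>n. X n \<in> {\<mu> \<in> Mprob. (\<integral>x. f x \<partial>\<mu>) \<in> U}) sequentially"
      unfolding limitin_def by blast
    then show "eventually (\<lambda>n. (\<integral>x. f x \<partial>(X n)) \<in> U) sequentially"
      by (rule eventually_mono) auto
  qed
next
  assume conv: "\<forall>f :: 'a \<Rightarrow> real. continuous_on UNIV f \<longrightarrow> (\<lambda>n. \<integral>x. f x \<partial>(X n)) \<longlonglongrightarrow> (\<integral>x. f x \<partial>\<mu>)"
  have ev: "\<mu> \<in> W \<longrightarrow> eventually (\<lambda>n. X n \<in> W) sequentially" if "openin weak_star W" for W
    using openin_topology_generated_by[OF that[unfolded weak_star_def]]
  proof induction
    case (Int a b)
    then show ?case by (auto intro: eventually_conj)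
  next
    case (UN S)
    show ?case
    proof
      assume "\<mu> \<in> \<Union>S"
      then obtain k where "k \<in> S" "\<mu> \<in> k" by blast
      then have "eventually (\<lambda>n. X n \<in> k) sequentially" using UN.IH by blast
      then show "eventually (\<lambda>n. X n \<in> \<Union>S) sequentially"
        by (rule eventually_mono) (use \<open>k \<in> S\<close> in blast)
    qed
  next
    case (Basis s)
    then obtain f :: "'a \<Rightarrow> real" and U where s: "s = {\<mu> \<in> Mprob. (\<integral>x. f x \<partial>\<mu>) \<in> U}" "continuous_on UNIV f" "open U"
      by blast
    then show ?case
      using topological_tendstoD[OF conv[rule_format, OF s(2)] s(3)] X by auto
  qed auto
  show "limitin weak_star X \<mu> sequentially"
    unfolding limitin_def using ev \<mu> by (auto simp: topspace_weak_star)
qed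

text \<open>The functions \<open>max 0 (1 - n * infdist x C)\<close> decrease to the indicator of a
  closed set \<open>C\<close>. So integrals determine a measure on closed sets, an
  intersection-stable generator of the Borel sets.\<close>

lemma Mprob_eqI:
  fixes \<mu> \<nu> :: "'a::metric_space measure"
  assumes cpt: "compact (UNIV :: 'a set)" and \<mu>: "\<mu> \<in> Mprob" and \<nu>: "\<nu> \<in> Mprob"
    and eq: "\<And>f :: 'a \<Rightarrow> real. continuous_on UNIV f \<Longrightarrow> (\<integral>x. f x \<partial>\<mu>) = (\<integral>x. f x \<partial>\<nu>)"
  shows "\<mu> = \<nu>"
proof -
  interpret M: prob_space \<mu> using \<mu> by (rule Mprob_prob_space)
  interpret N: prob_space \<nu> using \<nu> by (rule Mprob_prob_space)
  define f where "f C n x = max 0 (1 - real n * infdist x C)" for C :: "'a set" and n and x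
  have cf: "continuous_on UNIV (f C n)" for C n
    unfolding f_def by (intro continuous_intros continuous_on_infdist)
  have bd: "norm (f C n x) \<le> 1" for C n x
    using infdist_nonneg[of x C] by (simp add: f_def)
  have lim: "(\<lambda>n. \<integral>x. f C n x \<partial>\<kappa>) \<longlonglongrightarrow> measure \<kappa> C"
    if C: "closed C" "C \<noteq> {}" and \<kappa>: "\<kappa> \<in> Mprob" for C and \<kappa> :: "'a measure"
  proof -
    interpret K: prob_space \<kappa> using \<kappa> by (rule Mprob_prob_space)
    have Cs: "C \<in> sets \<kappa>" using C Mprob_sets[OF \<kappa>] by simp
    have "(\<lambda>n. \<integral>x. f C n x \<partial>\<kappa>) \<longlonglongrightarrow> (\<integral>x. indicat_real C x \<partial>\<kappa>)"
    proof (rule integral_dominated_convergence[where w = "\<lambda>_. 1"])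
      show "AE x in \<kappa>. (\<lambda>n. f C n x) \<longlonglongrightarrow> indicat_real C x"
      proof (rule AE_I2)
        fix x
        show "(\<lambda>n. f C n x) \<longlonglongrightarrow> indicat_real C x"
        proof (cases "x \<in> C")
          case True
          then show ?thesis by (simp add: f_def)
        next
          case False
          then have d: "infdist x C > 0"
            using C in_closed_iff_infdist_zero[of C x] infdist_nonneg[of x C] by force
          obtain N where N: "1 / infdist x C < real N" using reals_Archimedean2 by blast
          have "f C n x = 0" if "n \<ge> N" for n
          proof -
            have "1 / infdist x C < real n" using N that by linarith
            then have "1 < real n * infdist x C" using d by (simp add: field_simps)
            then show ?thesis by (simp add: f_def)
          qed
          then have "eventually (\<lambda>n. f C n x = 0) sequentially"
            by (auto simp: eventually_sequentially)
          then show ?thesis using False by (simp add: tendsto_eventually)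
        qed
      qed
      show "f C n \<in> borel_measurable \<kappa>" for n
        using integrable_Mprob[OF cpt cf \<kappa>] by auto
    qed (use Cs bd in auto)
    then show ?thesis using Cs by simp
  qed
  show ?thesis
  proof (rule measure_eqI_generator_eq[where E = "Collect closed" and A = "\<lambda>_. UNIV" and \<Omega> = UNIV])
    show "Int_stable (Collect closed :: 'a set set)" by (auto simp: Int_stable_def)
    have "sets (borel :: 'a measure) = sigma_sets UNIV (Collect closed)"
      unfolding borel_eq_closed by (rule sets_measure_of) auto
    then show "sets \<mu> = sigma_sets UNIV (Collect closed)" "sets \<nu> = sigma_sets UNIV (Collect closed)"
      using Mprob_sets[OF \<mu>] Mprob_sets[OF \<nu>] by auto
    fix C :: "'a set" assume "C \<in> Collect closed"
    then have C: "closed C" by simp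
    show "emeasure \<mu> C = emeasure \<nu> C"
    proof (cases "C = {}")
      case False
      have "measure \<mu> C = measure \<nu> C"
        using lim[OF C False \<mu>] lim[OF C False \<nu>] eq[OF cf] by (auto intro: LIMSEQ_unique)
      then show ?thesis by (simp add: M.emeasure_eq_measure N.emeasure_eq_measure)
    qed simp
  qed auto
qed

section \<open>Countably many test functions\<close>

inductive_set lspan :: "(nat \<Rightarrow> 'a \<Rightarrow> real) \<Rightarrow> ('a \<Rightarrow> real) set" for \<psi> where
  zero: "(\<lambda>_. 0) \<in> lspan \<psi>"
| add: "f \<in> lspan \<psi> \<Longrightarrow> (\<lambda>x. c * \<psi> i x + f x) \<in> lspan \<psi>"

text \<open>Uniform density is asked of the linear span, not of the sequence itself. The
  normalisation to values in [0, 1] makes one group element contribute at most 1 to any error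
  sum.\<close>

definition dense_seq :: "(nat \<Rightarrow> 'a::metric_space \<Rightarrow> real) \<Rightarrow> bool" where
  "dense_seq \<psi> \<longleftrightarrow> (\<forall>i. continuous_on UNIV (\<psi> i) \<and> (\<forall>x. 0 \<le> \<psi> i x \<and> \<psi> i x \<le> 1)) \<and>
    (\<forall>f. continuous_on UNIV f \<longrightarrow> (\<forall>e>0. \<exists>h\<in>lspan \<psi>. \<forall>x. \<bar>f x - h x\<bar> < e))"

lemma dense_seqD:
  fixes f :: "'a::metric_space \<Rightarrow> real"
  assumes "dense_seq \<psi>"
  shows "continuous_on UNIV (\<psi> i)" "0 \<le> \<psi> i x" "\<psi> i x \<le> 1"
    "continuous_on UNIV f \<Longrightarrow> 0 < e \<Longrightarrow> \<exists>h\<in>lspan \<psi>. \<forall>x. \<bar>f x - h x\<bar> < e"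
  using assms unfolding dense_seq_def by blast+

lemma lspan_add: "f \<in> lspan \<psi> \<Longrightarrow> g \<in> lspan \<psi> \<Longrightarrow> (\<lambda>x. f x + g x) \<in> lspan \<psi>"
proof (induction rule: lspan.induct)
  case (add f c i)
  then have "(\<lambda>x. c * \<psi> i x + (f x + g x)) \<in> lspan \<psi>" by (intro lspan.add) auto
  then show ?case by (simp add: add.assoc)
qed simp

lemma lspan_base: "(\<lambda>x. c * \<psi> i x) \<in> lspan \<psi>"
  using lspan.add[OF lspan.zero, of c \<psi> i] by simp

lemma lspan_continuous:
  fixes \<psi> :: "nat \<Rightarrow> 'a::topological_space \<Rightarrow> real"
  assumes "\<And>i. continuous_on UNIV (\<psi> i)" "f \<in> lspan \<psi>"
  shows "continuous_on UNIV f"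
  using assms(2) by induction (auto intro!: continuous_intros assms(1))

text \<open>The monomials in a separating family of functions span a subalgebra, so Stone-Weierstrass applies.\<close>

lemma dense_seq_exists:
  fixes \<phi> :: "nat \<Rightarrow> 'a::metric_space \<Rightarrow> real"
  assumes cpt: "compact (UNIV :: 'a set)"
    and cont: "\<And>i. continuous_on UNIV (\<phi> i)" and bd: "\<And>i x. 0 \<le> \<phi> i x \<and> \<phi> i x \<le> 1"
    and sep: "\<And>x y. x \<noteq> y \<Longrightarrow> \<exists>i. \<phi> i x \<noteq> \<phi> i y"
  shows "\<exists>\<psi> :: nat \<Rightarrow> 'a \<Rightarrow> real. dense_seq \<psi>"
proof -
  define mon where "mon p x = (\<Prod>i\<leftarrow>p. \<phi> i x)" for p x
  \<comment> \<open>Monomials are indexed by lists of naturals, of which there are countably many;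
    the empty list gives the constant 1.\<close>
  define \<psi> where "\<psi> n = mon (from_nat n)" for n
  have mon: "continuous_on UNIV (mon p) \<and> (\<forall>x. 0 \<le> mon p x \<and> mon p x \<le> 1)" for p
  proof (induction p)
    case (Cons i p)
    have "mon (i # p) = (\<lambda>x. \<phi> i x * mon p x)" by (simp add: mon_def fun_eq_iff)
    with Cons show ?case
      using bd cont by (auto intro!: continuous_intros mult_le_one)
  qed (auto simp: mon_def)
  have c\<psi>: "continuous_on UNIV (\<psi> i)" for i using mon by (simp add: \<psi>_def)
  have mon_in: "(\<lambda>x. c * mon p x) \<in> lspan \<psi>" for c p
    using lspan_base[of c \<psi> "to_nat p"] by (simp add: \<psi>_def)
  have term_mult: "(\<lambda>x. c * \<psi> i x * f x) \<in> lspan \<psi>" if "f \<in> lspan \<psi>" for c i f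
    using that
  proof induction
    case (add f d j)
    have "(\<lambda>x. (c * d) * mon (from_nat i @ from_nat j) x) \<in> lspan \<psi>" by (rule mon_in)
    from lspan_add[OF this add.IH] show ?case
      by (simp add: \<psi>_def mon_def algebra_simps)
  qed (simp add: lspan.zero)
  have mult: "(\<lambda>x. f x * g x) \<in> lspan \<psi>" if "f \<in> lspan \<psi>" "g \<in> lspan \<psi>" for f g
    using that(1)
  proof induction
    case (add f c i)
    from lspan_add[OF term_mult[OF that(2)] add.IH] show ?case
      by (simp add: algebra_simps)
  qed (simp add: lspan.zero)
  have "\<exists>h\<in>lspan \<psi>. \<forall>x. \<bar>f x - h x\<bar> < e" if f: "continuous_on UNIV f" "0 < e" for f e
  proof -
    have "\<exists>h. h \<in> lspan \<psi> \<and> (\<forall>x\<in>UNIV. \<bar>f x - h x\<bar> < e)"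
    proof (rule Stone_Weierstrass_HOL[OF cpt])
      show "(\<lambda>x. c) \<in> lspan \<psi>" for c :: real
        using mon_in[of c "[]"] by (simp add: mon_def)
      show "continuous_on UNIV f" if "f \<in> lspan \<psi>" for f
        using lspan_continuous[OF c\<psi> that] .
      show "\<exists>f. f \<in> lspan \<psi> \<and> f x \<noteq> f y" if xy: "x \<in> UNIV \<and> y \<in> UNIV \<and> x \<noteq> y" for x y
      proof -
        obtain i where "\<phi> i x \<noteq> \<phi> i y" using sep xy by blast
        then show ?thesis using mon_in[of 1 "[i]"] by (intro exI[of _ "\<lambda>x. 1 * mon [i] x"]) (simp add: mon_def)
      qed
    qed (use lspan_add mult f in auto)
    then show ?thesis by auto
  qed
  then have "dense_seq \<psi>"
    unfolding dense_seq_def using c\<psi> mon by (auto simp: \<psi>_def)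
  then show ?thesis by blast
qed

text \<open>Linearity extends the convergence to the span, and uniform approximation to all
  continuous functions. Two sequences are allowed so that constant ones give uniqueness of measures
  and one constant sequence gives weak-star convergence.\<close>

lemma integral_diff_tendsto:
  fixes X Y :: "nat \<Rightarrow> 'a::metric_space measure" and f :: "'a \<Rightarrow> real"
  assumes cpt: "compact (UNIV :: 'a set)" and \<psi>: "dense_seq \<psi>"
    and X: "\<And>n. X n \<in> Mprob" and Y: "\<And>n. Y n \<in> Mprob"
    and conv: "\<And>i. (\<lambda>n. mean (X n) (\<psi> i) - mean (Y n) (\<psi> i)) \<longlonglongrightarrow> 0"
    and f: "continuous_on UNIV f"
  shows "(\<lambda>n. (\<integral>x. f x \<partial>(X n)) - (\<integral>x. f x \<partial>(Y n))) \<longlonglongrightarrow> 0"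
proof -
  note c\<psi> = dense_seqD(1)[OF \<psi>]
  have span: "(\<lambda>n. (\<integral>x. h x \<partial>(X n)) - (\<integral>x. h x \<partial>(Y n))) \<longlonglongrightarrow> 0" if "h \<in> lspan \<psi>" for h
    using that
  proof induction
    case (add h c i)
    have ch: "continuous_on UNIV h" using lspan_continuous[OF c\<psi> add.hyps] .
    have int: "(\<integral>x. c * \<psi> i x + h x \<partial>\<kappa>) = c * mean \<kappa> (\<psi> i) + (\<integral>x. h x \<partial>\<kappa>)" if "\<kappa> \<in> Mprob" for \<kappa>
      using integrable_Mprob[OF cpt c\<psi> that, of i] integrable_Mprob[OF cpt ch that] by simp
    have "(\<lambda>n. c * (mean (X n) (\<psi> i) - mean (Y n) (\<psi> i)) + ((\<integral>x. h x \<partial>(X n)) - (\<integral>x. h x \<partial>(Y n)))) \<longlonglongrightarrow> c * 0 + 0"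
      by (intro tendsto_intros conv add.IH)
    then show ?case unfolding int[OF X] int[OF Y] by (simp add: algebra_simps)
  qed simp
  show ?thesis
  proof (rule LIMSEQ_I)
    fix r :: real assume "0 < r"
    obtain h where h: "h \<in> lspan \<psi>" "\<And>x. \<bar>f x - h x\<bar> < r / 3"
      using dense_seqD(4)[OF \<psi> f, of "r / 3"] \<open>0 < r\<close> by auto
    have ch: "continuous_on UNIV h" using lspan_continuous[OF c\<psi> h(1)] .
    obtain N where N: "\<And>n. n \<ge> N \<Longrightarrow> norm ((\<integral>x. h x \<partial>(X n)) - (\<integral>x. h x \<partial>(Y n)) - 0) < r / 3"
      using LIMSEQ_D[OF span[OF h(1)], of "r / 3"] \<open>0 < r\<close> by auto
    have "norm ((\<integral>x. f x \<partial>(X n)) - (\<integral>x. f x \<partial>(Y n)) - 0) < r" if "n \<ge> N" for n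
      using integral_diff_le_Mprob[OF cpt f ch X, of "r / 3" n] integral_diff_le_Mprob[OF cpt f ch Y, of "r / 3" n]
        h(2)[THEN less_imp_le] N[OF that] by (simp add: abs_if split: if_splits)
    then show "\<exists>N. \<forall>n\<ge>N. norm ((\<integral>x. f x \<partial>(X n)) - (\<integral>x. f x \<partial>(Y n)) - 0) < r" by blast
  qed
qed

lemma Mprob_eqI_dense_seq:
  fixes \<mu> \<nu> :: "'a::metric_space measure"
  assumes cpt: "compact (UNIV :: 'a set)" and \<psi>: "dense_seq \<psi>" and \<mu>: "\<mu> \<in> Mprob" and \<nu>: "\<nu> \<in> Mprob"
    and eq: "\<And>i. mean \<mu> (\<psi> i) = mean \<nu> (\<psi> i)"
  shows "\<mu> = \<nu>"
proof (rule Mprob_eqI[OF cpt \<mu> \<nu>])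
  fix f :: "'a \<Rightarrow> real" assume f: "continuous_on UNIV f"
  have "(\<lambda>n::nat. (\<integral>x. f x \<partial>\<mu>) - (\<integral>x. f x \<partial>\<nu>)) \<longlonglongrightarrow> 0"
    by (rule integral_diff_tendsto[OF cpt \<psi> \<mu> \<nu> _ f]) (simp add: eq)
  then show "(\<integral>x. f x \<partial>\<mu>) = (\<integral>x. f x \<partial>\<nu>)"
    by (simp add: LIMSEQ_const_iff)
qed

lemma limitin_weak_star_dense_seq:
  fixes X :: "nat \<Rightarrow> 'a::metric_space measure"
  assumes cpt: "compact (UNIV :: 'a set)" and \<psi>: "dense_seq \<psi>"
    and X: "\<And>n. X n \<in> Mprob" and \<mu>: "\<mu> \<in> Mprob"
  shows "limitin weak_star X \<mu> sequentially \<longleftrightarrow> (\<forall>i. (\<lambda>n. mean (X n) (\<psi> i)) \<longlonglongrightarrow> mean \<mu> (\<psi> i))"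
  unfolding limitin_weak_star_iff[OF X \<mu>]
proof (intro iffI allI impI)
  fix f :: "'a \<Rightarrow> real" assume *: "\<forall>i. (\<lambda>n. mean (X n) (\<psi> i)) \<longlonglongrightarrow> mean \<mu> (\<psi> i)" and f: "continuous_on UNIV f"
  have "(\<lambda>n. (\<integral>x. f x \<partial>(X n)) - (\<integral>x. f x \<partial>\<mu>)) \<longlonglongrightarrow> 0"
    by (rule integral_diff_tendsto[OF cpt \<psi> X \<mu> _ f]) (use * in \<open>simp add: LIM_zero_iff\<close>)
  then show "(\<lambda>n. \<integral>x. f x \<partial>(X n)) \<longlonglongrightarrow> (\<integral>x. f x \<partial>\<mu>)"
    by (rule LIM_zero_cancel)
qed (use dense_seqD(1)[OF \<psi>] in blast)

section \<open>Walks through a compact connected set\<close>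

lemma successively_append_last:
  assumes "successively P (xs @ [a])" "successively P (a # ys)"
  shows "successively P (xs @ a # ys)"
  using assms by (cases ys) (simp_all add: successively_append_iff)

text \<open>The starting point is kept off the list, so that appending two lists concatenates the
  chains without repeating the point where they meet.\<close>

definition chain_path :: "'a::metric_space set \<Rightarrow> real \<Rightarrow> 'a \<Rightarrow> 'a list \<Rightarrow> 'a \<Rightarrow> bool" where
  "chain_path S e x xs y \<longleftrightarrow> set xs \<subseteq> S \<and> successively (\<lambda>a b. dist a b < e) (x # xs) \<and> last (x # xs) = y"

lemma chain_path_append:
  assumes "chain_path S e x xs y" "chain_path S e y ys z"
  shows "chain_path S e x (xs @ ys) z"
proof (cases "xs = []")
  case True
  then show ?thesis using assms by (simp add: chain_path_def)
next
  case False
  define zs where "zs = butlast xs"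
  have "last xs = y" using assms(1) False by (simp add: chain_path_def)
  then have xs: "xs = zs @ [y]"
    using append_butlast_last_id[OF False] by (simp add: zs_def)
  have "successively (\<lambda>a b. dist a b < e) ((x # zs) @ y # ys)"
    by (rule successively_append_last) (use assms in \<open>simp_all add: chain_path_def xs\<close>)
  moreover have "last (y # ys) = z" using assms(2) by (simp add: chain_path_def)
  ultimately show ?thesis
    using assms by (auto simp: chain_path_def xs)
qed

text \<open>Points reachable from each other by \<open>e\<close>-steps form relatively open classes,
  and a connected set has only one.\<close>

lemma connected_chain_path:
  assumes "connected S" "0 < e" "x \<in> S" "y \<in> S"
  shows "\<exists>xs. chain_path S e x xs y"
proof -
  define R where "R a b \<longleftrightarrow> a \<in> S \<and> b \<in> S \<and> dist a b < e" for a b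
  have "R\<^sup>*\<^sup>* x y"
  proof (rule connected_equivalence_relation[OF assms(1,3,4)])
    have "symp R" by (auto simp: symp_def R_def dist_commute)
    then show "R\<^sup>*\<^sup>* b a" if "R\<^sup>*\<^sup>* a b" for a b
      using that by (meson symp_rtranclp sympD)
    show "R\<^sup>*\<^sup>* a c" if "R\<^sup>*\<^sup>* a b" "R\<^sup>*\<^sup>* b c" for a b c
      using that by (rule rtranclp_trans)
    fix a assume a: "a \<in> S"
    show "\<exists>T. openin (top_of_set S) T \<and> a \<in> T \<and> (\<forall>x\<in>T. R\<^sup>*\<^sup>* a x)"
    proof (intro exI conjI)
      show "openin (top_of_set S) (S \<inter> ball a e)" by (intro openin_open_Int) simp
      show "a \<in> S \<inter> ball a e" using a assms(2) by simp
      show "\<forall>x\<in>S \<inter> ball a e. R\<^sup>*\<^sup>* a x" using a by (auto simp: R_def)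
    qed
  qed
  then show ?thesis
  proof induction
    case base
    show ?case by (intro exI[of _ "[]"]) (simp add: chain_path_def)
  next
    case (step y z)
    then obtain xs where "chain_path S e x xs y" by blast
    moreover have "chain_path S e y [z] z" using step.hyps by (simp add: chain_path_def R_def)
    ultimately show ?case by (blast intro: chain_path_append)
  qed
qed

lemma connected_chain_loop:
  assumes "connected S" "0 < e" "x \<in> S" "finite N" "N \<subseteq> S"
  shows "\<exists>xs. chain_path S e x xs x \<and> N \<subseteq> set xs"
  using assms(4,5)
proof (induction N)
  case empty
  then show ?case by (intro exI[of _ "[]"]) (simp add: chain_path_def)
next
  case (insert y N)
  then obtain xs where xs: "chain_path S e x xs x" "N \<subseteq> set xs" by auto
  have y: "y \<in> S" using insert by simp
  obtain ys where ys: "chain_path S e x ys y" using connected_chain_path[OF assms(1-3) y] by blast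
  obtain zs where zs: "chain_path S e y zs x" using connected_chain_path[OF assms(1,2) y assms(3)] by blast
  \<comment> \<open>This stationary step puts \<open>y\<close> on the list even if the chain leading
    to it is empty.\<close>
  have yy: "chain_path S e y [y] y" using y assms(2) by (simp add: chain_path_def)
  have "chain_path S e x (ys @ [y] @ zs @ xs) x"
    by (rule chain_path_append[OF ys chain_path_append[OF yy chain_path_append[OF zs xs(1)]]])
  with xs(2) show ?case by (intro exI[of _ "ys @ [y] @ zs @ xs"]) auto
qed

primrec loops :: "(nat \<Rightarrow> 'a list) \<Rightarrow> 'a \<Rightarrow> nat \<Rightarrow> 'a list" where
  "loops l p 0 = [p]"
| "loops l p (Suc n) = loops l p n @ l n"

lemma loops_prefix:
  assumes "n \<le> m" "j < length (loops l p n)"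
  shows "loops l p m ! j = loops l p n ! j \<and> j < length (loops l p m)"
  using assms(1)
proof (induction m rule: dec_induct)
  case base
  show ?case using assms(2) by simp
next
  case (step m)
  then show ?case by (simp add: nth_append)
qed

text \<open>A sequence that walks, in stage n, along a loop of step size at most 1/(n+1) through
  a 1/(n+1)-net.\<close>

lemma compact_connected_sequence:
  fixes S :: "'a::metric_space set"
  assumes "compact S" "connected S" "S \<noteq> {}"
  obtains q where "\<And>n. q n \<in> S" "(\<lambda>n. dist (q n) (q (Suc n))) \<longlonglongrightarrow> 0"
    "\<And>y. y \<in> S \<Longrightarrow> \<exists>s. strict_mono s \<and> (q \<circ> s) \<longlonglongrightarrow> y"
proof -
  obtain p where p: "p \<in> S" using assms(3) by blast
  define e where "e n = 1 / (real n + 1)" for n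
  have e: "e n > 0" for n by (simp add: e_def)
  \<comment> \<open>Nonempty loops make the concatenated lists grow at every stage, so that entry
    \<open>j\<close> exists by stage \<open>j\<close>.\<close>
  have "\<exists>xs. chain_path S (e n) p xs p \<and> xs \<noteq> [] \<and> (\<forall>y\<in>S. \<exists>x\<in>set xs. dist x y < e n)" for n
  proof -
    obtain N where N: "N \<subseteq> S" "finite N" "S \<subseteq> (\<Union>x\<in>N. ball x (e n))"
      by (rule compactE_image[OF assms(1), of S "\<lambda>x. ball x (e n)"]) (use e in auto)
    obtain xs where xs: "chain_path S (e n) p xs p" "N \<subseteq> set xs"
      using connected_chain_loop[OF assms(2) e p N(2,1)] by blast
    have "N \<noteq> {}" using N(3) p by auto
    then show ?thesis using xs N(3) by (intro exI[of _ xs]) fastforce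
  qed
  then have "\<exists>l. \<forall>n. chain_path S (e n) p (l n) p \<and> l n \<noteq> [] \<and> (\<forall>y\<in>S. \<exists>x\<in>set (l n). dist x y < e n)"
    by (intro choice allI)
  then obtain l where l: "\<And>n. chain_path S (e n) p (l n) p" "\<And>n. l n \<noteq> []"
    "\<And>n y. y \<in> S \<Longrightarrow> \<exists>x\<in>set (l n). dist x y < e n"
    by blast
  define C where "C = loops l p"
  have lenC: "Suc n \<le> length (C n)" for n
  proof (induction n)
    case (Suc n)
    have "length (l n) > 0" using l(2) by simp
    with Suc show ?case unfolding C_def by (simp only: loops.simps length_append)
  qed (simp add: C_def)
  have lastC: "last (C n) = p" "C n \<noteq> []" for n
  proof -
    have "last (C n) = p \<and> C n \<noteq> []"
    proof (induction n)
      case (Suc n)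
      have "last (l n) = p" using l(1)[of n] l(2)[of n] by (simp add: chain_path_def)
      then show ?case using l(2)[of n] by (simp add: C_def)
    qed (simp add: C_def)
    then show "last (C n) = p" "C n \<noteq> []" by auto
  qed
  have setC: "set (C n) \<subseteq> S" for n
  proof (induction n)
    case (Suc n)
    then show ?case using l(1)[of n] by (simp add: C_def chain_path_def)
  qed (simp add: C_def p)
  \<comment> \<open>Diagonal reading: \<open>C j\<close> has more than \<open>j\<close> entries and
    later stages only append, so every stage that is long enough shows the same entry.\<close>
  define q where "q j = C j ! j" for j
  have qC: "q j = C m ! j" if "j < length (C m)" for j m
  proof (cases "j \<le> m")
    case True
    then show ?thesis using loops_prefix[of j m j l p] lenC[of j] by (simp add: q_def C_def)
  next
    case False
    then show ?thesis using loops_prefix[of m j j l p] that by (simp add: q_def C_def)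
  qed
  \<comment> \<open>All loops are based at \<open>p\<close>, so a step across the seam of two loops
    is the first step of the later one. The bound on \<open>Suc j\<close> places the target of the
    step in loop \<open>n\<close> or later.\<close>
  have step: "dist (C m ! j) (C m ! Suc j) < e n"
    if "n \<le> m" "length (C n) \<le> Suc j" "Suc j < length (C m)" for n m j
    using that
  proof (induction m rule: dec_induct)
    case (step m)
    show ?case
    proof (cases "Suc j < length (C m)")
      case True
      then show ?thesis using step by (simp add: C_def nth_append)
    next
      case False
      define i where "i = Suc j - length (C m)"
      have ij: "Suc j = length (C m) + i" "i < length (l m)"
        using False step.prems by (auto simp: i_def C_def)
      have "C (Suc m) ! Suc j = l m ! i"
        unfolding C_def loops.simps using ij(1) by (simp add: nth_append C_def)
      moreover have "C (Suc m) ! j = (p # l m) ! i"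
      proof (cases i)
        case 0
        then have "j = length (C m) - 1" using ij by simp
        then have "C (Suc m) ! j = last (C m)"
          using lastC(2)[of m] unfolding C_def loops.simps by (simp add: nth_append last_conv_nth)
        then show ?thesis using 0 lastC by simp
      next
        case (Suc i')
        then have "j = length (C m) + i'" using ij by simp
        then show ?thesis using Suc unfolding C_def loops.simps by (simp add: nth_append)
      qed
      moreover have "dist ((p # l m) ! i) ((p # l m) ! Suc i) < e m"
        using l(1)[of m] ij(2) unfolding chain_path_def by (intro successively_nth[of "\<lambda>a b. dist a b < e m"]) auto
      moreover have "e m \<le> e n" using step.hyps by (simp add: e_def field_simps)
      ultimately show ?thesis by simp
    qed
  qed simp
  have lim: "(\<lambda>n. dist (q n) (q (Suc n))) \<longlonglongrightarrow> 0"
  proof (rule LIMSEQ_I)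
    fix r :: real assume "0 < r"
    then obtain n where n: "e n < r"
      using reals_Archimedean[of r] by (auto simp: e_def inverse_eq_divide add.commute)
    have "norm (dist (q j) (q (Suc j)) - 0) < r" if "j \<ge> length (C n)" for j
    proof -
      have "n \<le> Suc j" using that lenC[of n] by simp
      moreover have "Suc j < length (C (Suc j))" using lenC[of "Suc j"] by simp
      ultimately have "dist (q j) (q (Suc j)) < e n"
        using step[of n "Suc j" j] that qC[of j "Suc j"] qC[of "Suc j" "Suc j"] by simp
      then show ?thesis using n by simp
    qed
    then show "\<exists>no. \<forall>n\<ge>no. norm (dist (q n) (q (Suc n)) - 0) < r" by blast
  qed
  have qS: "q n \<in> S" for n
    using setC[of n] lenC[of n] nth_mem[of n "C n"] by (auto simp: q_def)
  have "\<exists>s. strict_mono s \<and> (q \<circ> s) \<longlonglongrightarrow> y" if y: "y \<in> S" for y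
  proof -
    have near: "\<exists>j>M. dist (q j) y < e n" for M n
    proof -
      define k where "k = max M n"
      obtain x where x: "x \<in> set (l k)" "dist x y < e k" using l(3)[OF y] by blast
      then obtain i where i: "i < length (l k)" "l k ! i = x" by (auto simp: in_set_conv_nth)
      let ?j = "length (C k) + i"
      have "C (Suc k) ! ?j = x" "?j < length (C (Suc k))"
        unfolding C_def loops.simps using i by (simp_all add: nth_append)
      then have "q ?j = x" using qC by metis
      moreover have "e k \<le> e n" by (simp add: e_def k_def field_simps)
      moreover have "?j > M" using lenC[of k] by (simp add: k_def)
      ultimately show ?thesis using x(2) by (intro exI[of _ ?j]) auto
    qed
    have "\<exists>s. \<forall>n. dist (q (s n)) y < e n \<and> s n < s (Suc n)"
    proof (rule dependent_nat_choice)
      show "\<exists>x. dist (q x) y < e 0" using near by blast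
      show "\<exists>y'. dist (q y') y < e (Suc n) \<and> x < y'" for x n using near by blast
    qed
    then obtain s where s: "\<And>n. dist (q (s n)) y < e n" "\<And>n. s n < s (Suc n)" by blast
    have e0: "(\<lambda>n. e n) \<longlonglongrightarrow> 0"
      unfolding e_def using lim_1_over_n[THEN LIMSEQ_Suc] by (simp add: add.commute)
    have "(\<lambda>n. dist (q (s n)) y) \<longlonglongrightarrow> 0"
    proof (rule tendsto_sandwich[OF _ _ tendsto_const e0])
      show "eventually (\<lambda>n. 0 \<le> dist (q (s n)) y) sequentially" by simp
      show "eventually (\<lambda>n. dist (q (s n)) y \<le> e n) sequentially"
        by (intro always_eventually allI less_imp_le[OF s(1)])
    qed
    then have "(q \<circ> s) \<longlonglongrightarrow> y"
      by (subst tendsto_dist_iff) (simp add: o_def)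
    then show ?thesis using s(2) by (auto simp: strict_mono_Suc_iff)
  qed
  with qS lim show thesis by (rule that)
qed

text \<open>The metric on functions is a weighted sum of coordinate distances truncated at 1, so it
  dominates each single term; \<open>min r 1\<close> in the threshold takes care of the
  truncation.\<close>

lemma dist_fun_coordinate_tendsto:
  fixes x y :: "nat \<Rightarrow> nat \<Rightarrow> real"
  assumes "(\<lambda>n. dist (x n) (y n)) \<longlonglongrightarrow> 0"
  shows "(\<lambda>n. x n i - y n i) \<longlonglongrightarrow> 0"
proof (rule LIMSEQ_I)
  fix r :: real assume "0 < r"
  define k where "k = to_nat i"
  define c where "c = (1/2) ^ k * min r 1"
  have "c > 0" using \<open>0 < r\<close> by (simp add: c_def)
  then obtain N where N: "\<And>n. n \<ge> N \<Longrightarrow> dist (x n) (y n) < c"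
    using LIMSEQ_D[OF assms, of c] by auto
  have "norm (x n i - y n i - 0) < r" if "n \<ge> N" for n
  proof -
    have sm: "summable (\<lambda>j. (1/2) ^ j * min (dist (x n (from_nat j)) (y n (from_nat j))) 1)"
      by (rule summable_comparison_test'[of "\<lambda>j. (1/2::real) ^ j"]) (auto intro!: summable_geometric)
    have "(1/2) ^ k * min (dist (x n i) (y n i)) 1 \<le> dist (x n) (y n)"
      unfolding dist_fun_def using sum_le_suminf[OF sm, of "{k}"] by (simp add: k_def)
    also have "... < (1/2) ^ k * min r 1" using N[OF that] by (simp add: c_def)
    finally have "min (dist (x n i) (y n i)) 1 < min r 1" by simp
    then show ?thesis by (simp add: dist_real_def min_def split: if_splits)
  qed
  then show "\<exists>no. \<forall>n\<ge>no. norm (x n i - y n i - 0) < r" by blast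
qed

text \<open>The integrals against a dense sequence embed the measures into a metrizable product space.\<close>

lemma measure_sequence_exists:
  fixes K :: "'a::metric_space measure set"
  assumes cpt: "compact (UNIV :: 'a set)" and \<psi>: "dense_seq \<psi>"
    and K: "K \<subseteq> Mprob" "K \<noteq> {}" "compactin weak_star K" "connectedin weak_star K"
  obtains \<alpha> where "\<And>j. \<alpha> j \<in> K"
    "\<And>i. (\<lambda>j. mean (\<alpha> j) (\<psi> i) - mean (\<alpha> (Suc j)) (\<psi> i)) \<longlonglongrightarrow> 0"
    "\<And>\<mu>. \<mu> \<in> K \<Longrightarrow> \<exists>s. strict_mono s \<and> (\<forall>i. (\<lambda>n. mean (\<alpha> (s n)) (\<psi> i)) \<longlonglongrightarrow> mean \<mu> (\<psi> i))"
    "\<And>\<mu> s. \<mu> \<in> Mprob \<Longrightarrow> (\<And>i. (\<lambda>n. mean (\<alpha> (s n)) (\<psi> i)) \<longlonglongrightarrow> mean \<mu> (\<psi> i)) \<Longrightarrow> \<mu> \<in> K"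
proof -
  define \<Phi> where "\<Phi> \<mu> i = mean \<mu> (\<psi> i)" for \<mu> i
  have "continuous_map weak_star euclidean (\<lambda>\<mu>. \<Phi> \<mu> i)" for i
    unfolding continuous_map_def topspace_weak_star
    using openin_weak_star_integral[OF dense_seqD(1)[OF \<psi>]] by (auto simp: \<Phi>_def)
  then have "continuous_map weak_star (product_topology (\<lambda>_. euclidean) UNIV) \<Phi>"
    by (intro continuous_map_coordinatewise_then_product) auto
  then have \<Phi>: "continuous_map weak_star euclidean \<Phi>"
    by (simp add: euclidean_product_topology)
  have cK: "compact (\<Phi> ` K)"
    using image_compactin[OF K(3) \<Phi>] by simp
  have conn: "connected (\<Phi> ` K)"
    using connectedin_continuous_map_image[OF \<Phi> K(4)] by simp
  have "\<Phi> ` K \<noteq> {}" using K(2) by simp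
  from compact_connected_sequence[OF cK conn this] obtain q where q: "\<And>n. q n \<in> \<Phi> ` K" "(\<lambda>n. dist (q n) (q (Suc n))) \<longlonglongrightarrow> 0"
    "\<And>y. y \<in> \<Phi> ` K \<Longrightarrow> \<exists>s. strict_mono s \<and> (q \<circ> s) \<longlonglongrightarrow> y"
    by blast
  have "\<exists>\<mu>. \<mu> \<in> K \<and> \<Phi> \<mu> = q n" for n
    using q(1)[of n] by auto
  then obtain \<alpha> where \<alpha>: "\<And>n. \<alpha> n \<in> K" "\<And>n. \<Phi> (\<alpha> n) = q n" by metis
  have coord: "(\<lambda>n. z n i) \<longlonglongrightarrow> w i" if "z \<longlonglongrightarrow> w" for z and w :: "nat \<Rightarrow> real" and i
    using that continuous_on_product_coordinates[of i]
    by (auto intro: continuous_on_tendsto_compose[of UNIV "\<lambda>x. x i"])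
  have uncoord: "z \<longlonglongrightarrow> w" if "\<And>i. (\<lambda>n. z n i) \<longlonglongrightarrow> w i" for z :: "nat \<Rightarrow> nat \<Rightarrow> real" and w
  proof -
    have "limitin (product_topology (\<lambda>_. euclidean) UNIV) z w sequentially"
      unfolding limitin_componentwise using that by simp
    then show ?thesis by (simp add: euclidean_product_topology)
  qed
  show thesis
  proof (rule that[of \<alpha>])
    show "\<alpha> j \<in> K" for j by (rule \<alpha>(1))
    show "(\<lambda>j. mean (\<alpha> j) (\<psi> i) - mean (\<alpha> (Suc j)) (\<psi> i)) \<longlonglongrightarrow> 0" for i
      using dist_fun_coordinate_tendsto[OF q(2), of i] unfolding \<alpha>(2)[symmetric] by (simp add: \<Phi>_def)
    show "\<exists>s. strict_mono s \<and> (\<forall>i. (\<lambda>n. mean (\<alpha> (s n)) (\<psi> i)) \<longlonglongrightarrow> mean \<mu> (\<psi> i))" if \<mu>: "\<mu> \<in> K" for \<mu>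
    proof -
      obtain s where s: "strict_mono s" "(q \<circ> s) \<longlonglongrightarrow> \<Phi> \<mu>" using q(3)[of "\<Phi> \<mu>"] \<mu> by blast
      have "(\<lambda>n. \<Phi> (\<alpha> (s n)) i) \<longlonglongrightarrow> \<Phi> \<mu> i" for i
        using coord[OF s(2), of i] by (simp add: \<alpha>(2))
      then show ?thesis using s(1) by (auto simp: \<Phi>_def)
    qed
    show "\<mu> \<in> K" if \<mu>: "\<mu> \<in> Mprob" and lim: "\<And>i. (\<lambda>n. mean (\<alpha> (s n)) (\<psi> i)) \<longlonglongrightarrow> mean \<mu> (\<psi> i)" for \<mu> s
    proof -
      have "(\<lambda>n. q (s n)) \<longlonglongrightarrow> \<Phi> \<mu>"
        by (rule uncoord) (use lim in \<open>simp add: \<alpha>(2)[symmetric] \<Phi>_def\<close>)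
      \<comment> \<open>The image of \<open>K\<close> is compact, hence closed, and
        \<open>\<Phi>\<close> is injective on \<open>Mprob\<close>; this brings the limit back into
        \<open>K\<close> itself.\<close>
      with q(1) have "\<Phi> \<mu> \<in> \<Phi> ` K"
        by (rule closed_sequentially[OF compact_imp_closed[OF cK]])
      then obtain \<nu> where \<nu>: "\<nu> \<in> K" "\<Phi> \<mu> = \<Phi> \<nu>" by blast
      from fun_cong[OF \<nu>(2)] have "mean \<mu> (\<psi> i) = mean \<nu> (\<psi> i)" for i by (simp add: \<Phi>_def)
      then have "\<mu> = \<nu>" using Mprob_eqI_dense_seq[OF cpt \<psi> \<mu>] \<nu>(1) K(1) by blast
      then show ?thesis using \<nu> by simp
    qed
  qed
qed

subsection \<open>Points with prescribed averages\<close>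

text \<open>Replaces a random choice: some point does at least as well as the average.\<close>

lemma exists_le_integral:
  fixes h :: "'a::metric_space \<Rightarrow> real"
  assumes cpt: "compact (UNIV :: 'a set)" and "continuous_on UNIV h" "\<mu> \<in> Mprob"
  shows "\<exists>x. h x \<le> (\<integral>x. h x \<partial>\<mu>)"
proof (rule ccontr)
  interpret prob_space \<mu> using assms(3) by (rule Mprob_prob_space)
  note int = integrable_Mprob[OF assms]
  assume "\<not> ?thesis"
  then have gt: "(\<integral>x. h x \<partial>\<mu>) < h x" for x by (auto simp: not_le)
  have "expectation (\<lambda>x. - h x) < - (\<integral>x. h x \<partial>\<mu>)"
    by (rule expectation_less) (use int gt in auto)
  then show False using int by simp
qed

lemma integral_invariant:
  fixes f :: "'a::metric_space \<Rightarrow> real"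
  assumes "is_action T" "\<alpha> \<in> Minv T" "continuous_on UNIV f"
  shows "(\<integral>x. f (T s x) \<partial>\<alpha>) = (\<integral>x. f x \<partial>\<alpha>)"
proof -
  have \<alpha>: "\<alpha> \<in> Mprob" "distr \<alpha> borel (T s) = \<alpha>" using assms(2) by (auto simp: Minv_def)
  have "T s \<in> measurable \<alpha> borel"
    using borel_measurable_continuous_onI[OF action_continuous[OF assms(1)]] Mprob_sets[OF \<alpha>(1)]
    by (simp cong: measurable_cong_sets)
  then have "(\<integral>x. f x \<partial>(distr \<alpha> borel (T s))) = (\<integral>x. f (T s x) \<partial>\<alpha>)"
    using assms(3) by (intro integral_distr borel_measurable_continuous_onI)
  then show ?thesis using \<alpha>(2) by simp
qed

lemma integral_dense_seq_bounds:
  assumes cpt: "compact (UNIV :: 'a::metric_space set)" and \<psi>: "dense_seq (\<psi> :: nat \<Rightarrow> 'a \<Rightarrow> real)"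
    and \<mu>: "\<mu> \<in> Mprob"
  shows "0 \<le> mean \<mu> (\<psi> i)" "mean \<mu> (\<psi> i) \<le> 1"
proof -
  interpret prob_space \<mu> using \<mu> by (rule Mprob_prob_space)
  note int = integrable_Mprob[OF cpt dense_seqD(1)[OF \<psi>] \<mu>]
  show "0 \<le> mean \<mu> (\<psi> i)"
    by (intro Bochner_Integration.integral_nonneg dense_seqD(2)[OF \<psi>])
  have "mean \<mu> (\<psi> i) \<le> (\<integral>x. 1 \<partial>\<mu>)"
    by (rule integral_mono[OF int]) (simp_all add: dense_seqD(3)[OF \<psi>])
  then show "mean \<mu> (\<psi> i) \<le> 1" by (simp add: prob_space)
qed

text \<open>Derandomized law of large numbers: choosing the points one after the other so that the mean
  over the next point does not increase the error keeps the squared error linear in the number of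
  blocks. Only invariance of the measure is needed, no ergodic decomposition.\<close>

lemma greedy_points:
  fixes T :: "'g::group_add \<Rightarrow> 'a::metric_space \<Rightarrow> 'a"
  assumes cpt: "compact (UNIV :: 'a set)" and act: "is_action T" and \<alpha>: "\<alpha> \<in> Minv T"
    and \<psi>: "dense_seq \<psi>" and "finite S"
  shows "\<exists>x. (\<Sum>i<N. (\<Sum>A\<in>S. \<Sum>s\<in>A. \<psi> i (T s (x A)) - mean \<alpha> (\<psi> i))\<^sup>2) \<le> N * (\<Sum>A\<in>S. (real (card A))\<^sup>2)"
  using \<open>finite S\<close>
proof induction
  case empty
  then show ?case by simp
next
  case (insert A S)
  note \<psi>D = dense_seqD[OF \<psi>]
  define a where "a i = mean \<alpha> (\<psi> i)" for i
  define d where "d i x = (\<Sum>s\<in>A. \<psi> i (T s x) - a i)" for i x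
  obtain x where x: "(\<Sum>i<N. (\<Sum>A\<in>S. \<Sum>s\<in>A. \<psi> i (T s (x A)) - a i)\<^sup>2) \<le> N * (\<Sum>A\<in>S. (real (card A))\<^sup>2)"
    using insert.IH by (auto simp: a_def)
  define v where "v i = (\<Sum>A\<in>S. \<Sum>s\<in>A. \<psi> i (T s (x A)) - a i)" for i
  have \<alpha>M: "\<alpha> \<in> Mprob" using \<alpha> by (simp add: Minv_def)
  interpret prob_space \<alpha> using \<alpha>M by (rule Mprob_prob_space)
  have c\<psi>T: "continuous_on UNIV (\<lambda>x. \<psi> i (T s x))" for i s
    using continuous_on_compose2[OF \<psi>D(1) action_continuous[OF act]] by blast
  have a01: "0 \<le> a i" "a i \<le> 1" for i
    unfolding a_def by (rule integral_dense_seq_bounds[OF cpt \<psi> \<alpha>M])+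
  have cd: "continuous_on UNIV (d i)" for i
    unfolding d_def by (intro continuous_intros c\<psi>T)
  have "(\<integral>x. \<psi> i (T s x) - a i \<partial>\<alpha>) = 0" for i s
    using integrable_Mprob[OF cpt c\<psi>T \<alpha>M] integral_invariant[OF act \<alpha> \<psi>D(1), of i s]
    by (simp add: a_def prob_space)
  then have int0: "(\<integral>x. d i x \<partial>\<alpha>) = 0" for i
    unfolding d_def using integrable_Mprob[OF cpt c\<psi>T \<alpha>M]
    by (subst Bochner_Integration.integral_sum) auto
  have d_le: "(d i x)\<^sup>2 \<le> (real (card A))\<^sup>2" for i x
  proof -
    have "\<bar>\<psi> i (T s x) - a i\<bar> \<le> 1" for s
      using \<psi>D(2,3)[of i "T s x"] a01[of i] by (simp add: abs_le_iff)
    then have "\<bar>d i x\<bar> \<le> (\<Sum>s\<in>A. 1)"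
      unfolding d_def by (intro order_trans[OF sum_abs] sum_mono)
    then show ?thesis by (simp add: abs_le_square_iff[symmetric])
  qed
  \<comment> \<open>An upper bound for the new squared errors, summed over all \<open>i < N\<close>
    so that one point serves all test functions. Invariance gives \<open>d i\<close> mean 0, so the
    cross terms vanish in the mean and only \<open>(card A)^2\<close> per test function is added to
    the old error.\<close>
  define h where "h x = (\<Sum>i<N. (v i)\<^sup>2 + 2 * v i * d i x + (real (card A))\<^sup>2)" for x
  have "continuous_on UNIV h"
    unfolding h_def by (intro continuous_intros cd)
  from exists_le_integral[OF cpt this \<alpha>M] obtain y where "h y \<le> (\<integral>x. h x \<partial>\<alpha>)" by blast
  also have "(\<integral>x. h x \<partial>\<alpha>) = (\<Sum>i<N. (v i)\<^sup>2 + (real (card A))\<^sup>2)"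
    unfolding h_def using integrable_Mprob[OF cpt cd \<alpha>M]
    by (subst Bochner_Integration.integral_sum) (auto simp: int0 prob_space)
  also have "... = (\<Sum>i<N. (v i)\<^sup>2) + N * (real (card A))\<^sup>2"
    by (simp add: sum.distrib)
  also have "... \<le> N * (\<Sum>A\<in>insert A S. (real (card A))\<^sup>2)"
    using x insert.hyps by (simp add: v_def algebra_simps)
  finally have hy: "h y \<le> N * (\<Sum>A\<in>insert A S. (real (card A))\<^sup>2)" .
  have "(\<Sum>i<N. (v i + d i y)\<^sup>2) \<le> h y"
    unfolding h_def using d_le[of _ y] by (intro sum_mono) (simp add: power2_sum)
  moreover have "(\<Sum>B\<in>insert A S. \<Sum>s\<in>B. \<psi> i (T s ((x(A := y)) B)) - a i) = v i + d i y" for i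
  proof -
    have "(\<Sum>B\<in>S. \<Sum>s\<in>B. \<psi> i (T s ((x(A := y)) B)) - a i) = v i"
      unfolding v_def using insert.hyps by (intro sum.cong) auto
    then show ?thesis using insert.hyps by (simp add: d_def)
  qed
  ultimately show ?case
    using hy unfolding a_def[symmetric] by (intro exI[of _ "x(A := y)"]) simp
qed

section \<open>Gluing orbit segments with few mistakes\<close>

definition product_scale :: "('g::group_add \<Rightarrow> 'a::metric_space \<Rightarrow> 'a) \<Rightarrow> (real \<Rightarrow> real) \<Rightarrow> (real \<Rightarrow> 'g set \<times> real) \<Rightarrow> bool" where
  "product_scale T g m \<longleftrightarrow>
     (\<forall>eps\<in>{0<..<1}. finite (fst (m eps)) \<and> snd (m eps) \<in> {0<..<1}) \<and>
     (\<forall>(k::nat) (eps :: nat \<Rightarrow> real) (xs :: nat \<Rightarrow> 'a) (Fs :: nat \<Rightarrow> 'g set).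
        (\<forall>i<k. eps i \<in> {0<..<1} \<and> finite (Fs i) \<and> KD_invariant (fst (m (eps i))) (snd (m (eps i))) (Fs i)) \<and>
        (\<forall>i<k. \<forall>j<k. i \<noteq> j \<longrightarrow> Fs i \<inter> Fs j = {}) \<longrightarrow>
        (\<Inter>i<k. Bball T g (Fs i) (xs i) (eps i)) \<noteq> {})"

abbreviation scale_inv :: "(real \<Rightarrow> 'g::group_add set \<times> real) \<Rightarrow> real \<Rightarrow> 'g set \<Rightarrow> bool" where
  "scale_inv m eps F \<equiv> KD_invariant (fst (m eps)) (snd (m eps)) F"

lemma eventually_scale_inv:
  assumes "product_scale T g m" "eps \<in> {0<..<1}"
  shows "eventually (scale_inv m eps) Foelner_filter"
proof -
  have "finite (fst (m eps)) \<and> snd (m eps) \<in> {0<..<1}"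
    using assms(1)[unfolded product_scale_def, THEN conjunct1] assms(2) by (rule bspec)
  then show ?thesis by (intro eventually_KD_invariant) auto
qed

text \<open>Mistakes are strict inequalities, so all mistakes of a point persist nearby and their
  number cannot drop there.\<close>

lemma closed_Bball:
  fixes T :: "'g::group_add \<Rightarrow> 'a::metric_space \<Rightarrow> 'a"
  assumes act: "is_action T" and F: "finite F"
  shows "closed (Bball T g F x eps)"
proof -
  have "\<exists>U. open U \<and> y \<in> U \<and> U \<subseteq> - Bball T g F x eps" if y: "y \<in> - Bball T g F x eps" for y
  proof (intro exI conjI)
    define S where "S = {s\<in>F. dist (T s x) (T s y) > eps}"
    have fS: "finite S" using F by (simp add: S_def)
    show "open (\<Inter>s\<in>S. {y. eps < dist (T s x) (T s y)})"
      using fS by (intro open_INT ballI open_Collect_less continuous_intros action_continuous[OF act])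
    show "y \<in> (\<Inter>s\<in>S. {y. eps < dist (T s x) (T s y)})" by (auto simp: S_def)
    show "(\<Inter>s\<in>S. {y. eps < dist (T s x) (T s y)}) \<subseteq> - Bball T g F x eps"
    proof
      fix z assume z: "z \<in> (\<Inter>s\<in>S. {y. eps < dist (T s x) (T s y)})"
      have "S \<subseteq> {s\<in>F. dist (T s x) (T s z) > eps}" using z by (auto simp: S_def)
      then have "card S \<le> card {s\<in>F. dist (T s x) (T s z) > eps}"
        using F by (intro card_mono) auto
      moreover have "real (card S) > g eps * real (card F)"
        using y by (simp add: Bball_def S_def)
      ultimately show "z \<in> - Bball T g F x eps" by (simp add: Bball_def)
    qed
  qed
  then show ?thesis
    unfolding closed_def by (subst open_subopen) blast
qed

text \<open>The finite intersection property extends gluing from finite to arbitrary disjoint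
  families; one point must follow infinitely many tiles.\<close>

lemma product_scale_family:
  fixes T :: "'g::group_add \<Rightarrow> 'a::metric_space \<Rightarrow> 'a"
  assumes cpt: "compact (UNIV :: 'a set)" and act: "is_action T" and m: "product_scale T g m"
    and I: "\<And>i. i \<in> I \<Longrightarrow> e i \<in> {0<..<1} \<and> scale_inv m (e i) (Fs i)"
    and disj: "\<And>i j. i \<in> I \<Longrightarrow> j \<in> I \<Longrightarrow> i \<noteq> j \<Longrightarrow> Fs i \<inter> Fs j = {}"
  shows "(\<Inter>i\<in>I. Bball T g (Fs i) (xs i) (e i)) \<noteq> {}"
proof -
  have fin: "finite (Fs i)" if "i \<in> I" for i
    using I[OF that] by (auto simp: KD_invariant_def)
  have "UNIV \<inter> (\<Inter>i\<in>I. Bball T g (Fs i) (xs i) (e i)) \<noteq> {}"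
  proof (rule compact_imp_fip_image[OF cpt])
    show "closed (Bball T g (Fs i) (xs i) (e i))" if "i \<in> I" for i
      by (rule closed_Bball[OF act fin[OF that]])
    fix I' assume I': "finite I'" "I' \<subseteq> I"
    obtain h where h: "bij_betw h {0..<card I'} I'"
      using ex_bij_betw_nat_finite[OF I'(1)] by blast
    have hI: "h k \<in> I" if "k < card I'" for k
      using bij_betwE[OF h] I'(2) that by auto
    have hinj: "h k \<noteq> h l" if "k < card I'" "l < card I'" "k \<noteq> l" for k l
      using bij_betw_imp_inj_on[OF h] that by (auto simp: inj_on_def)
    have "(\<Inter>k<card I'. Bball T g (Fs (h k)) (xs (h k)) (e (h k))) \<noteq> {}"
      using m[unfolded product_scale_def, THEN conjunct2, rule_format,
          of "card I'" "\<lambda>k. e (h k)" "\<lambda>k. Fs (h k)" "\<lambda>k. xs (h k)"] I hI fin hinj disj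
      by auto
    then obtain y where y: "\<And>k. k < card I' \<Longrightarrow> y \<in> Bball T g (Fs (h k)) (xs (h k)) (e (h k))"
      by blast
    have "y \<in> Bball T g (Fs i) (xs i) (e i)" if "i \<in> I'" for i
    proof -
      have "i \<in> h ` {0..<card I'}" using bij_betw_imp_surj_on[OF h] that by simp
      then show ?thesis using y by auto
    qed
    then show "UNIV \<inter> (\<Inter>i\<in>I'. Bball T g (Fs i) (xs i) (e i)) \<noteq> {}" by blast
  qed
  then show ?thesis by simp
qed

text \<open>One \<open>\<kappa>\<close> comes from the places without mistake, by the modulus of
  continuity, the other from at most \<open>g eps * card F\<close> mistakes, each costing at most
  1.\<close>

lemma Bball_sum_diff:
  fixes f :: "'a::metric_space \<Rightarrow> real"
  assumes F: "finite F" and y: "y \<in> Bball T g F x eps" and g: "g eps \<le> \<kappa>"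
    and f: "\<And>x. 0 \<le> f x \<and> f x \<le> 1" and md: "\<And>u v. dist u v \<le> eps \<Longrightarrow> \<bar>f u - f v\<bar> \<le> \<kappa>" and "0 \<le> \<kappa>"
  shows "\<bar>(\<Sum>s\<in>F. f (T s y) - f (T s x))\<bar> \<le> 2 * \<kappa> * card F"
proof -
  have "\<bar>(\<Sum>s\<in>F. f (T s y) - f (T s x))\<bar> \<le> (\<Sum>s\<in>F. \<bar>f (T s y) - f (T s x)\<bar>)"
    by (rule sum_abs)
  also have "... \<le> (\<Sum>s\<in>F. \<kappa> + of_bool (dist (T s x) (T s y) > eps))"
  proof (rule sum_mono)
    fix s
    show "\<bar>f (T s y) - f (T s x)\<bar> \<le> \<kappa> + of_bool (dist (T s x) (T s y) > eps)"
      using md[of "T s y" "T s x"] f[of "T s y"] f[of "T s x"] \<open>0 \<le> \<kappa>\<close>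
      by (cases "dist (T s x) (T s y) > eps") (auto simp: dist_commute abs_le_iff)
  qed
  also have "... = \<kappa> * card F + card {s\<in>F. dist (T s x) (T s y) > eps}"
    using F by (simp add: sum.distrib Int_def mult.commute)
  also have "... \<le> \<kappa> * card F + g eps * card F"
    using y by (simp add: Bball_def)
  also have "... \<le> \<kappa> * card F + \<kappa> * card F"
    using g by (intro add_left_mono mult_right_mono) auto
  finally show ?thesis by simp
qed

lemma modulus_exists:
  fixes \<psi> :: "nat \<Rightarrow> 'a::metric_space \<Rightarrow> real"
  assumes cpt: "compact (UNIV :: 'a set)" and \<psi>: "\<And>i. continuous_on UNIV (\<psi> i)" and g: "mistake_density g"
    and "0 < \<kappa>"
  shows "\<exists>eps\<in>{0<..<1}. eps \<le> \<kappa> \<and> g eps \<le> \<kappa> \<and> (\<forall>i<N. \<forall>u v. dist u v \<le> eps \<longrightarrow> \<bar>\<psi> i u - \<psi> i v\<bar> \<le> \<kappa>)"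
proof -
  have "eventually (\<lambda>eps. \<forall>u v. dist u v \<le> eps \<longrightarrow> \<bar>\<psi> i u - \<psi> i v\<bar> \<le> \<kappa>) (at_right 0)" for i
  proof -
    have "uniformly_continuous_on UNIV (\<psi> i)"
      using \<psi> cpt by (rule compact_uniformly_continuous)
    then obtain d where d: "d > 0" "\<And>u v. dist u v < d \<Longrightarrow> dist (\<psi> i u) (\<psi> i v) < \<kappa>"
      using \<open>0 < \<kappa>\<close> unfolding uniformly_continuous_on_def by (metis UNIV_I)
    show ?thesis
    proof (rule eventually_at_rightI[OF _ d(1)])
      fix e assume e: "e \<in> {0<..<d}"
      show "\<forall>u v. dist u v \<le> e \<longrightarrow> \<bar>\<psi> i u - \<psi> i v\<bar> \<le> \<kappa>"
      proof (intro allI impI)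
        fix u v :: 'a assume "dist u v \<le> e"
        then have "dist u v < d" using e by simp
        from d(2)[OF this] show "\<bar>\<psi> i u - \<psi> i v\<bar> \<le> \<kappa>" by (simp add: dist_real_def)
      qed
    qed
  qed
  then have "eventually (\<lambda>eps. \<forall>i\<in>{..<N}. \<forall>u v. dist u v \<le> eps \<longrightarrow> \<bar>\<psi> i u - \<psi> i v\<bar> \<le> \<kappa>) (at_right 0)"
    by (intro eventually_ball_finite) auto
  moreover have "eventually (\<lambda>eps. g eps < \<kappa>) (at_right 0)"
    using g \<open>0 < \<kappa>\<close> unfolding mistake_density_def by (auto dest: order_tendstoD)
  moreover have "eventually (\<lambda>eps. eps \<in> {0<..<min 1 \<kappa>}) (at_right 0)"
    using \<open>0 < \<kappa>\<close> by (intro eventually_at_rightI[of 0 "min 1 \<kappa>"]) auto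
  ultimately have "eventually (\<lambda>eps. eps \<in> {0<..<1} \<and> eps \<le> \<kappa> \<and> g eps \<le> \<kappa> \<and> (\<forall>i<N. \<forall>u v. dist u v \<le> eps \<longrightarrow> \<bar>\<psi> i u - \<psi> i v\<bar> \<le> \<kappa>)) (at_right (0::real))"
    by eventually_elim auto
  then have "\<exists>eps. eps \<in> {0<..<1} \<and> eps \<le> \<kappa> \<and> g eps \<le> \<kappa> \<and> (\<forall>i<N. \<forall>u v. dist u v \<le> eps \<longrightarrow> \<bar>\<psi> i u - \<psi> i v\<bar> \<le> \<kappa>)"
    by (rule eventually_happens'[rotated]) simp
  then show ?thesis by blast
qed

lemma sum_blocks:
  fixes f :: "'b \<Rightarrow> real"
  assumes F: "finite F" and S: "S \<subseteq> Pow F" "disjoint S" and f: "\<And>s. \<bar>f s\<bar> \<le> 1"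
  shows "\<bar>sum f F\<bar> \<le> card (F - \<Union>S) + \<bar>\<Sum>A\<in>S. sum f A\<bar>"
proof -
  have "sum f F = sum f (F - \<Union>S) + sum f (\<Union>S)"
    using F S(1) by (intro sum.subset_diff) auto
  also have "sum f (\<Union>S) = (\<Sum>A\<in>S. sum f A)"
    using S F by (subst sum.Union_disjoint) (auto simp: disjoint_def intro: finite_subset)
  finally have "sum f F = sum f (F - \<Union>S) + (\<Sum>A\<in>S. sum f A)" .
  moreover have "\<bar>sum f (F - \<Union>S)\<bar> \<le> (\<Sum>s\<in>F - \<Union>S. 1)"
    using f by (intro order_trans[OF sum_abs] sum_mono)
  ultimately show ?thesis by simp
qed

text \<open>Every invariant measure, ergodic or not, is approximated by a single orbit segment on
  \<open>A\<close>, obtained by gluing greedy points on bounded tiles. The tiles and the size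
  threshold are fixed before the measure, so one condition on \<open>A\<close> works for all
  \<open>\<alpha>\<close>.\<close>

lemma eventually_empirical_approx:
  fixes T :: "'g::group_add \<Rightarrow> 'a::metric_space \<Rightarrow> 'a" and \<kappa> :: real
  assumes cpt: "compact (UNIV :: 'a set)" and act: "is_action T" and m: "product_scale T g m"
    and g: "mistake_density g" and \<psi>: "dense_seq \<psi>"
    and inf: "infinite (UNIV :: 'g set)" and nb: "(Foelner_filter :: 'g set filter) \<noteq> bot" and "0 < \<kappa>"
  shows "eventually (\<lambda>A. \<forall>\<alpha>\<in>Minv T. \<exists>z. \<forall>i<N.
    \<bar>(\<Sum>s\<in>A. \<psi> i (T s z) - mean \<alpha> (\<psi> i))\<bar> \<le> \<kappa> * card A) Foelner_filter"
proof -
  note \<psi>D = dense_seqD[OF \<psi>]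
  \<comment> \<open>Four shares: one for the uncovered part, two for gluing, one for the greedy
    error.\<close>
  define k where "k = \<kappa> / 4"
  have k: "0 < k" using \<open>0 < \<kappa>\<close> by (simp add: k_def)
  obtain eps where eps0: "eps \<in> {0<..<1}"
      "eps \<le> k \<and> g eps \<le> k \<and> (\<forall>i<N. \<forall>u v. dist u v \<le> eps \<longrightarrow> \<bar>\<psi> i u - \<psi> i v\<bar> \<le> k)"
    by (rule bexE[OF modulus_exists[OF cpt \<psi>D(1) g k, where N = N]])
  then have eps: "eps \<in> {0<..<1}" "g eps \<le> k" "\<forall>i<N. \<forall>u v. dist u v \<le> eps \<longrightarrow> \<bar>\<psi> i u - \<psi> i v\<bar> \<le> k"
    by simp_all
  from Foelner_tiling[OF k nb eventually_scale_inv[OF m eps(1)]]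
  obtain \<T> L where \<T>: "disjoint \<T>" "\<forall>A\<in>\<T>. scale_inv m eps A \<and> finite A \<and> A \<noteq> {} \<and> card A \<le> L"
    "eventually (covers \<T> k) Foelner_filter"
    by (elim exE conjE)
  \<comment> \<open>Tiles have at most \<open>L\<close> elements, so the squared greedy error is at
    most \<open>N * L * card A\<close>, which is below \<open>(k * card A)^2\<close> once
    \<open>card A\<close> reaches \<open>M\<close>.\<close>
  obtain M :: nat where M: "N * L / k\<^sup>2 \<le> real M" using real_arch_simple by blast
  show ?thesis
    using \<T>(3) eventually_finite_Foelner eventually_card_Foelner[OF inf, of M]
  proof eventually_elim
    case (elim A)
    have fA: "finite A" using elim by simp
    define S where "S = {B\<in>\<T>. B \<subseteq> A}"
    have SB: "scale_inv m eps B" "finite B" "card B \<le> L" "B \<subseteq> A" if "B \<in> S" for B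
      using \<T>(2) that by (auto simp: S_def)
    have disS: "disjoint S" using \<T>(1) by (auto simp: S_def disjoint_def)
    have SP: "S \<subseteq> Pow A" by (auto simp: S_def)
    note fS = sum_card_le(1)[OF fA SP disS]
    have sumS_le: "(\<Sum>B\<in>S. real (card B)) \<le> card A"
      using sum_card_le(2)[OF fA SP disS] by simp
    show "\<forall>\<alpha>\<in>Minv T. \<exists>z. \<forall>i<N. \<bar>(\<Sum>s\<in>A. \<psi> i (T s z) - mean \<alpha> (\<psi> i))\<bar> \<le> \<kappa> * card A"
    proof
      fix \<alpha> assume \<alpha>: "\<alpha> \<in> Minv T"
      have \<alpha>M: "\<alpha> \<in> Mprob" using \<alpha> by (simp add: Minv_def)
      interpret prob_space \<alpha> using \<alpha>M by (rule Mprob_prob_space)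
      define a where "a i = mean \<alpha> (\<psi> i)" for i
      have a01: "0 \<le> a i" "a i \<le> 1" for i
        unfolding a_def by (rule integral_dense_seq_bounds[OF cpt \<psi> \<alpha>M])+
      obtain x where x: "(\<Sum>i<N. (\<Sum>B\<in>S. \<Sum>s\<in>B. \<psi> i (T s (x B)) - a i)\<^sup>2) \<le> N * (\<Sum>B\<in>S. (real (card B))\<^sup>2)"
        using greedy_points[OF cpt act \<alpha> \<psi> fS] by (auto simp: a_def)
      have "(\<Sum>B\<in>S. (real (card B))\<^sup>2) \<le> (\<Sum>B\<in>S. L * real (card B))"
        using SB(3) by (intro sum_mono) (auto simp: power2_eq_square intro: mult_right_mono)
      also have "... \<le> L * real (card A)"
        using sumS_le by (simp add: sum_distrib_left[symmetric] mult_left_mono)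
      finally have "N * (\<Sum>B\<in>S. (real (card B))\<^sup>2) \<le> N * (L * real (card A))"
        by (intro mult_left_mono) auto
      also have "... = (real N * L) * real (card A)" by simp
      also have "... \<le> (k\<^sup>2 * M) * real (card A)"
      proof (rule mult_right_mono)
        show "real N * L \<le> k\<^sup>2 * M" using M k by (simp add: field_simps)
      qed simp
      also have "... \<le> (k\<^sup>2 * card A) * real (card A)"
        using elim by (intro mult_right_mono mult_left_mono) auto
      also have "... = (k * card A)\<^sup>2" by (simp add: power2_eq_square)
      finally have bnd: "N * (\<Sum>B\<in>S. (real (card B))\<^sup>2) \<le> (k * card A)\<^sup>2" .
      have dev: "\<bar>\<Sum>B\<in>S. \<Sum>s\<in>B. \<psi> i (T s (x B)) - a i\<bar> \<le> k * card A" if "i < N" for i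
      proof -
        have "(\<Sum>B\<in>S. \<Sum>s\<in>B. \<psi> i (T s (x B)) - a i)\<^sup>2 \<le> (\<Sum>i<N. (\<Sum>B\<in>S. \<Sum>s\<in>B. \<psi> i (T s (x B)) - a i)\<^sup>2)"
          using that by (intro member_le_sum) auto
        then have "(\<Sum>B\<in>S. \<Sum>s\<in>B. \<psi> i (T s (x B)) - a i)\<^sup>2 \<le> (k * card A)\<^sup>2"
          using x bnd by linarith
        then show ?thesis using k by (simp add: abs_le_square_iff[symmetric] abs_mult)
      qed
      have "(\<Inter>B\<in>S. Bball T g B (x B) eps) \<noteq> {}"
        using SB eps(1) disS by (intro product_scale_family[OF cpt act m]) (auto simp: disjoint_def)
      then obtain z where z: "\<And>B. B \<in> S \<Longrightarrow> z \<in> Bball T g B (x B) eps" by auto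
      have "\<bar>(\<Sum>s\<in>A. \<psi> i (T s z) - a i)\<bar> \<le> \<kappa> * card A" if i: "i < N" for i
      proof -
        have 1: "\<bar>\<Sum>s\<in>A. \<psi> i (T s z) - a i\<bar> \<le> card (A - \<Union>S) + \<bar>\<Sum>B\<in>S. \<Sum>s\<in>B. \<psi> i (T s z) - a i\<bar>"
        proof (rule sum_blocks[OF fA SP disS])
          show "\<bar>\<psi> i (T s z) - a i\<bar> \<le> 1" for s
            using \<psi>D(2,3)[of i "T s z"] a01[of i] by (simp add: abs_le_iff)
        qed
        have 2: "card (A - \<Union>S) \<le> k * card A" using elim by (simp add: covers_def S_def)
        have "(\<Sum>B\<in>S. \<Sum>s\<in>B. \<psi> i (T s z) - a i) =
            (\<Sum>B\<in>S. (\<Sum>s\<in>B. \<psi> i (T s z) - \<psi> i (T s (x B))) + (\<Sum>s\<in>B. \<psi> i (T s (x B)) - a i))"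
          by (simp add: sum.distrib[symmetric])
        also have "... = (\<Sum>B\<in>S. \<Sum>s\<in>B. \<psi> i (T s z) - \<psi> i (T s (x B))) + (\<Sum>B\<in>S. \<Sum>s\<in>B. \<psi> i (T s (x B)) - a i)"
          by (rule sum.distrib)
        finally have eq: "(\<Sum>B\<in>S. \<Sum>s\<in>B. \<psi> i (T s z) - a i) = ..." .
        have "\<bar>\<Sum>B\<in>S. \<Sum>s\<in>B. \<psi> i (T s z) - \<psi> i (T s (x B))\<bar> \<le> (\<Sum>B\<in>S. 2 * k * card B)"
          using z SB(2) eps \<psi>D(2,3) k i
          by (intro order_trans[OF sum_abs] sum_mono Bball_sum_diff[where eps = eps and g = g]) auto
        also have "... \<le> 2 * k * card A"
          using sumS_le k by (simp add: sum_distrib_left[symmetric])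
        finally show ?thesis
          using 1 2 dev[OF i] unfolding eq k_def by linarith
      qed
      then show "\<exists>z. \<forall>i<N. \<bar>(\<Sum>s\<in>A. \<psi> i (T s z) - mean \<alpha> (\<psi> i))\<bar> \<le> \<kappa> * card A"
        unfolding a_def by blast
    qed
  qed
qed

section \<open>Towers of tilings and the levels used for gluing\<close>

lemma tiling_tower:
  fixes Q :: "nat \<Rightarrow> 'g::group_add set \<Rightarrow> bool"
  assumes nb: "(Foelner_filter :: 'g set filter) \<noteq> bot"
    and Q: "\<And>j. eventually (Q j) Foelner_filter" and \<kappa>: "\<And>j. 0 < \<kappa> j"
  shows "\<exists>\<T>. \<forall>j. (disjoint (\<T> j) \<and> (\<forall>A\<in>\<T> j. Q j A \<and> finite A \<and> A \<noteq> {}) \<and>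
      eventually (covers (\<T> j) (\<kappa> j)) Foelner_filter) \<and> (\<forall>A\<in>\<T> (Suc j). covers (\<T> j) (\<kappa> j) A)"
proof (rule dependent_nat_choice)
  from Foelner_tiling[OF \<kappa>[of 0] nb Q[of 0]]
  obtain \<T> L where "disjoint \<T>" "\<forall>A\<in>\<T>. Q 0 A \<and> finite A \<and> A \<noteq> {} \<and> card A \<le> L"
    "eventually (covers \<T> (\<kappa> 0)) Foelner_filter"
    by (elim exE conjE)
  then show "\<exists>\<T>. disjoint \<T> \<and> (\<forall>A\<in>\<T>. Q 0 A \<and> finite A \<and> A \<noteq> {}) \<and> eventually (covers \<T> (\<kappa> 0)) Foelner_filter"
    by (intro exI[of _ \<T>]) simp
next
  fix \<T> j
  assume \<T>: "disjoint \<T> \<and> (\<forall>A\<in>\<T>. Q j A \<and> finite A \<and> A \<noteq> {}) \<and> eventually (covers \<T> (\<kappa> j)) Foelner_filter"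
  \<comment> \<open>Being almost exhausted by tiles of the previous tiling is an eventual property,
    so it can be imposed on every tile of the next one.\<close>
  have ev: "eventually (\<lambda>A. Q (Suc j) A \<and> covers \<T> (\<kappa> j) A) Foelner_filter"
    using Q[of "Suc j"] \<T> by (intro eventually_conj) auto
  from Foelner_tiling[OF \<kappa>[of "Suc j"] nb ev]
  obtain \<T>' L where "disjoint \<T>'"
    "\<forall>A\<in>\<T>'. (Q (Suc j) A \<and> covers \<T> (\<kappa> j) A) \<and> finite A \<and> A \<noteq> {} \<and> card A \<le> L"
    "eventually (covers \<T>' (\<kappa> (Suc j))) Foelner_filter"
    by (elim exE conjE)
  then show "\<exists>\<T>'. (disjoint \<T>' \<and> (\<forall>A\<in>\<T>'. Q (Suc j) A \<and> finite A \<and> A \<noteq> {}) \<and>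
      eventually (covers \<T>' (\<kappa> (Suc j))) Foelner_filter) \<and> (\<forall>A\<in>\<T>'. covers \<T> (\<kappa> j) A)"
    by (intro exI[of _ \<T>']) simp
qed

lemma card_uncovered_le:
  fixes \<kappa> :: real
  assumes F: "finite F" and S: "\<And>D. D \<in> S \<Longrightarrow> D \<subseteq> F" "disjoint S" and "0 \<le> \<kappa>"
    and cov: "\<And>D. D \<in> S \<Longrightarrow> covers \<T> \<kappa> D"
  shows "card (\<Union>D\<in>S. D - \<Union>{A\<in>\<T>. A \<subseteq> D}) \<le> \<kappa> * card F"
proof -
  have SP: "S \<subseteq> Pow F" using S(1) by blast
  note fS = sum_card_le(1)[OF F SP S(2)]
  have "real (card (\<Union>D\<in>S. D - \<Union>{A\<in>\<T>. A \<subseteq> D})) \<le> (\<Sum>D\<in>S. card (D - \<Union>{A\<in>\<T>. A \<subseteq> D}))"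
    using card_UN_le[OF fS] by (simp only: of_nat_le_iff)
  also have "... = (\<Sum>D\<in>S. real (card (D - \<Union>{A\<in>\<T>. A \<subseteq> D})))" by simp
  also have "... \<le> (\<Sum>D\<in>S. \<kappa> * card D)"
    using cov by (intro sum_mono) (simp add: covers_def)
  also have "... = \<kappa> * real (\<Sum>D\<in>S. card D)" by (simp add: sum_distrib_left)
  also have "... \<le> \<kappa> * card F"
    using sum_card_le(2)[OF F SP S(2)] \<open>0 \<le> \<kappa>\<close> by (rule mult_left_mono)
  finally show ?thesis .
qed

text \<open>The index is shifted: \<open>visited j\<close> uses only thresholds below
  \<open>j\<close>, so that \<open>N j\<close> can be chosen in dependence on it.\<close>

primrec visited :: "'g set \<Rightarrow> (nat \<Rightarrow> 'g set) \<Rightarrow> (nat \<Rightarrow> nat) \<Rightarrow> nat \<Rightarrow> 'g set" where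
  "visited A0 Fn N 0 = A0"
| "visited A0 Fn N (Suc j) = A0 \<union> (\<Union>n\<le>N j. Fn n)"

lemma visited_mono:
  assumes "strict_mono N" "i \<le> j"
  shows "visited A0 Fn N i \<subseteq> visited A0 Fn N j"
proof (cases i)
  case 0
  then show ?thesis by (cases j) auto
next
  case (Suc i')
  then obtain j' where "j = Suc j'" "i' \<le> j'" using assms(2) by (cases j) auto
  then show ?thesis
    using Suc strict_mono_mono[OF assms(1), THEN monoD, of i' j'] by fastforce
qed

text \<open>Level j uses tiles of the j-th tiling inside those tiles of the (j+1)-st tiling that lie in
  one of the sets Fn n, n <= N j. Since the region used by a level is a union of tiles of the next
  tiling, no tile of the next level is cut.\<close>

context
  fixes \<T> :: "nat \<Rightarrow> 'g set set" and \<kappa> :: "nat \<Rightarrow> real" and A0 :: "'g set"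
    and Fn :: "nat \<Rightarrow> 'g set" and N :: "nat \<Rightarrow> nat"
  assumes dj: "\<And>j. disjoint (\<T> j)" and fin: "\<And>j A. A \<in> \<T> j \<Longrightarrow> finite A \<and> A \<noteq> {}"
    and cov: "\<And>j A. A \<in> \<T> (Suc j) \<Longrightarrow> covers (\<T> j) (\<kappa> j) A"
    and finF: "\<And>n. finite (Fn n)" and N: "strict_mono N"
    and \<kappa>: "\<And>j. 0 < \<kappa> j" "decseq \<kappa>"
begin

definition marked :: "nat \<Rightarrow> 'g set set" where
  "marked j = {D\<in>\<T> (Suc j). \<exists>n\<le>N j. D \<subseteq> Fn n}"

text \<open>For \<open>j = 0\<close> the truncated \<open>j - 1\<close> is 0 and
  \<open>visited\<close> reduces to \<open>A0\<close>, the set reserved for the prescribed orbit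
  segment.\<close>

definition level :: "nat \<Rightarrow> 'g set set" where
  "level j = {A\<in>\<T> j. (\<exists>D\<in>marked j. A \<subseteq> D) \<and> A \<inter> visited A0 Fn N (j - 1) = {} \<and>
     (\<forall>i. j = Suc i \<longrightarrow> A \<notin> marked i)}"

lemma marked_subset_visited: "D \<in> marked j \<Longrightarrow> D \<subseteq> visited A0 Fn N (Suc j)"
  by (auto simp: marked_def)

lemma level_disjoint_A0:
  assumes "A \<in> level j"
  shows "A \<inter> A0 = {}"
proof -
  have "A0 \<subseteq> visited A0 Fn N (j - 1)" using visited_mono[OF N, of 0 "j - 1" A0 Fn] by simp
  then show ?thesis using assms by (auto simp: level_def)
qed

text \<open>Two levels or more apart, the earlier tile lies in the visited region that the later one
  avoids. For consecutive levels, the earlier tile lies in a marked tile of the later tiling, and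
  level \<open>j\<close> excludes marked tiles.\<close>

lemma level_disjoint_less:
  assumes "A \<in> level i" "B \<in> level j" "i < j"
  shows "A \<inter> B = {}"
proof -
  obtain D where D: "D \<in> marked i" "A \<subseteq> D" using assms(1) by (auto simp: level_def)
  show ?thesis
  proof (cases "j = Suc i")
    case True
    have "B \<noteq> D" using assms(2) True D(1) by (auto simp: level_def)
    moreover have "B \<in> \<T> j" "D \<in> \<T> j" using assms(2) D(1) True by (auto simp: level_def marked_def)
    ultimately have "B \<inter> D = {}" using dj[of j] by (auto simp: disjoint_def)
    then show ?thesis using D(2) by auto
  next
    case False
    then have "visited A0 Fn N (Suc i) \<subseteq> visited A0 Fn N (j - 1)"
      using assms(3) by (intro visited_mono[OF N]) auto
    then have "A \<subseteq> visited A0 Fn N (j - 1)" using D marked_subset_visited by blast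
    then show ?thesis using assms(2) by (auto simp: level_def)
  qed
qed

lemma level_disjoint:
  assumes "A \<in> level i" "B \<in> level j" "(i, A) \<noteq> (j, B)"
  shows "A \<inter> B = {}"
proof (cases i j rule: linorder_cases)
  case less
  then show ?thesis using level_disjoint_less assms by blast
next
  case equal
  then have "A \<in> \<T> j" "B \<in> \<T> j" "A \<noteq> B" using assms by (auto simp: level_def)
  then show ?thesis using dj[of j] by (auto simp: disjoint_def)
next
  case greater
  then show ?thesis using level_disjoint_less[OF assms(2,1)] by blast
qed

text \<open>Follow a point of \<open>Fn n\<close> down through tiles \<open>D\<close>,
  \<open>E\<close>, \<open>A\<close> of the tilings j + 2, j + 1, j. If \<open>E\<close> is not
  marked at level j, it is used whole at level j + 1; otherwise \<open>A\<close> is used at level j.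
  The point is lost only if a tile is missing or meets the visited region, which gives four losses
  of at most \<open>\<kappa> j\<close> each.\<close>

lemma stage_covered:
  assumes n: "n \<le> N (Suc j)" and c: "covers (\<T> (Suc (Suc j))) (\<kappa> (Suc (Suc j))) (Fn n)"
    and few: "card (Fn n \<inter> \<Union>{A\<in>\<T> j \<union> \<T> (Suc j). A \<inter> visited A0 Fn N j \<noteq> {}}) \<le> \<kappa> j * card (Fn n)"
  shows "card (Fn n - \<Union>{A\<in>level j \<union> level (Suc j). A \<subseteq> Fn n}) \<le> 4 * \<kappa> j * card (Fn n)"
proof -
  let ?F = "Fn n"
  define X1 where "X1 = ?F - \<Union>{D\<in>\<T> (Suc (Suc j)). D \<subseteq> ?F}"
  define X2 where "X2 = (\<Union>D\<in>{D\<in>\<T> (Suc (Suc j)). D \<subseteq> ?F}. D - \<Union>{E\<in>\<T> (Suc j). E \<subseteq> D})"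
  define X3 where "X3 = (\<Union>E\<in>{E\<in>\<T> (Suc j). E \<subseteq> ?F}. E - \<Union>{A\<in>\<T> j. A \<subseteq> E})"
  define X4 where "X4 = ?F \<inter> \<Union>{A\<in>\<T> j \<union> \<T> (Suc j). A \<inter> visited A0 Fn N j \<noteq> {}}"
  have sub: "?F - \<Union>{A\<in>level j \<union> level (Suc j). A \<subseteq> ?F} \<subseteq> X1 \<union> X2 \<union> X3 \<union> X4"
  proof
    fix s assume s: "s \<in> ?F - \<Union>{A\<in>level j \<union> level (Suc j). A \<subseteq> ?F}"
    show "s \<in> X1 \<union> X2 \<union> X3 \<union> X4"
    proof (rule ccontr)
      assume no: "\<not> ?thesis"
      obtain D where D: "D \<in> \<T> (Suc (Suc j))" "D \<subseteq> ?F" "s \<in> D"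
        using s no by (auto simp: X1_def)
      obtain E where E: "E \<in> \<T> (Suc j)" "E \<subseteq> D" "s \<in> E"
        using D no by (auto simp: X2_def)
      have EF: "E \<subseteq> ?F" using E D by auto
      have DM: "D \<in> marked (Suc j)" using D n by (auto simp: marked_def)
      show False
      proof (cases "E \<in> marked j")
        case False
        have "E \<inter> visited A0 Fn N j = {}"
          using no s E by (auto simp: X4_def)
        then have "E \<in> level (Suc j)"
          using False E DM by (auto simp: level_def)
        then show False using s E EF by auto
      next
        case True
        obtain A where A: "A \<in> \<T> j" "A \<subseteq> E" "s \<in> A"
          using E EF no by (auto simp: X3_def)
        have dis: "A \<inter> visited A0 Fn N j = {}"
          using no s A by (auto simp: X4_def)
        have "A \<inter> visited A0 Fn N (j - 1) = {}"
          using dis visited_mono[OF N, of "j - 1" j A0 Fn] by auto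
        moreover have "A \<notin> marked i" if "j = Suc i" for i
          using dis that marked_subset_visited[of A i] A(3) by blast
        ultimately have "A \<in> level j"
          using A True by (auto simp: level_def)
        then show False using s A EF by blast
      qed
    qed
  qed
  have fin4: "finite X1" "finite X2" "finite X3" "finite X4"
    using finF[of n] by (auto simp: X1_def X2_def X3_def X4_def intro: finite_subset[of _ "Fn n"])
  have \<kappa>0: "0 \<le> \<kappa> i" for i using \<kappa>(1)[of i] by simp
  have \<kappa>1: "\<kappa> (Suc j) \<le> \<kappa> j" "\<kappa> (Suc (Suc j)) \<le> \<kappa> j"
    using \<kappa>(2) by (auto simp: decseq_def)
  have dj': "disjoint {D\<in>\<T> i. D \<subseteq> ?F}" for i using dj[of i] by (auto simp: disjoint_def)
  have "card X1 \<le> \<kappa> (Suc (Suc j)) * card ?F" using c by (simp add: covers_def X1_def)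
  also have "... \<le> \<kappa> j * card ?F" using \<kappa>1 by (intro mult_right_mono) auto
  finally have b1: "card X1 \<le> \<kappa> j * card ?F" .
  have "card X2 \<le> \<kappa> (Suc j) * card ?F"
    unfolding X2_def using cov \<kappa>0 by (intro card_uncovered_le finF dj') auto
  also have "... \<le> \<kappa> j * card ?F" using \<kappa>1 by (intro mult_right_mono) auto
  finally have b2: "card X2 \<le> \<kappa> j * card ?F" .
  have b3: "card X3 \<le> \<kappa> j * card ?F"
    unfolding X3_def using cov \<kappa>0 by (intro card_uncovered_le finF dj') auto
  have "card (?F - \<Union>{A\<in>level j \<union> level (Suc j). A \<subseteq> ?F}) \<le> card (X1 \<union> X2 \<union> X3 \<union> X4)"
    using sub fin4 by (intro card_mono) auto
  also have "... \<le> card X1 + card X2 + card X3 + card X4"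
    using card_Un_le[of "X1 \<union> X2 \<union> X3" X4] card_Un_le[of "X1 \<union> X2" X3] card_Un_le[of X1 X2] by linarith
  finally have "real (card (?F - \<Union>{A\<in>level j \<union> level (Suc j). A \<subseteq> ?F})) \<le> real (card X1) + card X2 + card X3 + card X4"
    by linarith
  then show ?thesis
    using b1 b2 b3 few by (simp add: X4_def)
qed

end

lemma thresholds_exist:
  fixes Fn :: "nat \<Rightarrow> 'g set"
  assumes ev: "\<And>j H. finite H \<Longrightarrow> eventually (R j H) sequentially"
    and "finite A0" "\<And>n. finite (Fn n)"
  shows "\<exists>N. strict_mono N \<and> (\<forall>j. \<forall>n>N j. R j (visited A0 Fn N j) n)"
proof -
  have ex: "\<exists>M>x. \<forall>n>M. R j H n" if fH: "finite H" for j H x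
  proof -
    obtain M where M: "\<forall>n\<ge>M. R j H n" using ev[OF fH, of j] unfolding eventually_sequentially by blast
    then show ?thesis by (intro exI[of _ "max M (Suc x)"]) auto
  qed
  have "\<exists>N. \<forall>j. (j = 0 \<longrightarrow> (\<forall>n>N j. R 0 A0 n)) \<and>
     (N j < N (Suc j) \<and> (\<forall>n>N (Suc j). R (Suc j) (A0 \<union> (\<Union>n\<le>N j. Fn n)) n))"
  proof (rule dependent_nat_choice)
    show "\<exists>x. 0 = (0::nat) \<longrightarrow> (\<forall>n>x. R 0 A0 n)" using ex[OF assms(2), of _ 0] by blast
    fix x j :: nat
    have "finite (A0 \<union> (\<Union>n\<le>x. Fn n))" using assms(2,3) by auto
    from ex[OF this, of x "Suc j"]
    show "\<exists>y. (Suc j = 0 \<longrightarrow> (\<forall>n>y. R 0 A0 n)) \<and> x < y \<and> (\<forall>n>y. R (Suc j) (A0 \<union> (\<Union>n\<le>x. Fn n)) n)"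
      by blast
  qed
  then obtain N where N0: "\<forall>n>N 0. R 0 A0 n" and NS: "\<And>j. N j < N (Suc j)"
    "\<And>j. \<forall>n>N (Suc j). R (Suc j) (A0 \<union> (\<Union>n\<le>N j. Fn n)) n" by blast
  have "\<forall>n>N j. R j (visited A0 Fn N j) n" for j
    using N0 NS(2) by (cases j) simp_all
  moreover have "strict_mono N" using NS(1) by (simp add: strict_mono_Suc_iff)
  ultimately show ?thesis by blast
qed

text \<open>For \<open>n > N 0\<close> this is the \<open>j\<close> with
  \<open>N j < n \<le> N (Suc j)\<close>; all smaller indices get stage 0.\<close>

definition stage :: "(nat \<Rightarrow> nat) \<Rightarrow> nat \<Rightarrow> nat" where
  "stage N n = (LEAST j. n \<le> N (Suc j))"

context
  fixes N :: "nat \<Rightarrow> nat"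
  assumes N: "strict_mono N"
begin

lemma stage_le: "n \<le> N (Suc (stage N n))"
  unfolding stage_def
proof (rule LeastI)
  show "n \<le> N (Suc n)" using strict_mono_imp_increasing[OF N, of "Suc n"] by simp
qed

lemma stage_gt:
  assumes "N 0 < n"
  shows "N (stage N n) < n"
proof (cases "stage N n")
  case (Suc j)
  then have "\<not> n \<le> N (Suc j)"
    unfolding stage_def by (intro not_less_Least) simp
  then show ?thesis using Suc by simp
qed (use assms in simp)

lemma mono_stage: "n \<le> n' \<Longrightarrow> stage N n \<le> stage N n'"
  using stage_le[of n'] by (subst stage_def, intro Least_le) simp

lemma stage_threshold: "stage N (N (Suc j)) = j"
  unfolding stage_def by (rule Least_equality) (simp_all add: strict_mono_less_eq[OF N])

lemma stage_at_top: "filterlim (stage N) at_top sequentially"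
  unfolding filterlim_at_top eventually_sequentially
proof
  fix j
  show "\<exists>n0. \<forall>n\<ge>n0. j \<le> stage N n"
    using mono_stage[of "N (Suc j)"] stage_threshold[of j] by (intro exI[of _ "N (Suc j)"]) auto
qed

end

text \<open>Foelner sets of an infinite group grow without bound, so any finite set becomes
  negligible in them.\<close>

lemma eventually_card_Int_le:
  fixes Fn :: "nat \<Rightarrow> 'g::group_add set" and c :: real
  assumes inf: "infinite (UNIV :: 'g set)" and Fn: "Foelner_seq Fn" and "finite B" "0 < c"
  shows "eventually (\<lambda>n. card (Fn n \<inter> B) \<le> c * card (Fn n)) sequentially"
proof -
  obtain M :: nat where M: "card B / c \<le> M" using real_arch_simple by blast
  have "eventually (\<lambda>n. M \<le> card (Fn n)) sequentially"
    using eventually_card_Foelner[OF inf, of M] Foelner_seq_filterlim[OF Fn]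
    by (rule eventually_compose_filterlim)
  then show ?thesis
  proof eventually_elim
    case (elim n)
    have "real (card (Fn n \<inter> B)) \<le> card B" using assms(3) by (auto intro: card_mono)
    also have "... \<le> c * M" using M assms(4) by (simp add: field_simps)
    also have "... \<le> c * card (Fn n)" using elim assms(4) by (intro mult_left_mono) auto
    finally show ?case .
  qed
qed

text \<open>By disjointness, a tile meeting \<open>H\<close> is determined by its trace on
  \<open>H\<close>, and there are finitely many traces.\<close>

lemma finite_meeting:
  assumes "disjoint \<T>" "\<And>A. A \<in> \<T> \<Longrightarrow> finite A" "finite H"
  shows "finite (\<Union>{A\<in>\<T>. A \<inter> H \<noteq> {}})"
proof -
  have "inj_on (\<lambda>A. A \<inter> H) {A\<in>\<T>. A \<inter> H \<noteq> {}}"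
  proof (rule inj_onI)
    fix A B assume "A \<in> {A\<in>\<T>. A \<inter> H \<noteq> {}}" "B \<in> {A\<in>\<T>. A \<inter> H \<noteq> {}}" "A \<inter> H = B \<inter> H"
    then have "A \<inter> B \<noteq> {}" "A \<in> \<T>" "B \<in> \<T>" by auto
    then show "A = B" using assms(1) by (auto simp: disjoint_def)
  qed
  moreover have "(\<lambda>A. A \<inter> H) ` {A\<in>\<T>. A \<inter> H \<noteq> {}} \<subseteq> Pow H" by auto
  then have "finite ((\<lambda>A. A \<inter> H) ` {A\<in>\<T>. A \<inter> H \<noteq> {}})"
    by (rule finite_subset) (use assms(3) in simp)
  ultimately have "finite {A\<in>\<T>. A \<inter> H \<noteq> {}}" by (rule finite_imageD[rotated])
  then show ?thesis using assms(2) by auto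
qed

text \<open>\<open>J n\<close> is the stage of \<open>n\<close>. As it is monotone and onto, the
  sets \<open>Fn n\<close> follow every measure \<open>\<alpha> j\<close> in turn. The prescription
  on \<open>A0\<close> concerns a finite set and leaves no trace in the limits.\<close>

theorem saturating_point:
  fixes T :: "'g::group_add \<Rightarrow> 'a::metric_space \<Rightarrow> 'a"
  assumes cpt: "compact (UNIV :: 'a set)" and act: "is_action T" and m: "product_scale T g m"
    and g: "mistake_density g" and \<psi>: "dense_seq \<psi>"
    and inf: "infinite (UNIV :: 'g set)" and Fn: "Foelner_seq Fn"
    and \<alpha>: "\<And>j. \<alpha> j \<in> Minv T"
    and step: "\<And>i. (\<lambda>j. mean (\<alpha> j) (\<psi> i) - mean (\<alpha> (Suc j)) (\<psi> i)) \<longlonglongrightarrow> 0"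
    and e0: "e0 \<in> {0<..<1}" and A0: "scale_inv m e0 A0"
  shows "\<exists>z\<in>Bball T g A0 x0 e0. \<exists>J. mono J \<and> surj J \<and>
    (\<forall>i. (\<lambda>n. mean (empirical T (Fn n) z) (\<psi> i) - mean (\<alpha> (J n)) (\<psi> i)) \<longlonglongrightarrow> 0)"
proof -
  note \<psi>D = dense_seqD[OF \<psi>]
  have nb: "(Foelner_filter :: 'g set filter) \<noteq> bot" by (rule Foelner_filter_neq_bot[OF Fn])
  have Ff: "finite (Fn n)" "Fn n \<noteq> {}" for n using Fn by (auto simp: Foelner_seq_def)
  have fA0: "finite A0" using A0 by (simp add: KD_invariant_def)
  define \<kappa> where "\<kappa> j = 1 / real (Suc j)" for j
  have \<kappa>: "0 < \<kappa> j" for j by (simp add: \<kappa>_def)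
  have \<kappa>dec: "decseq \<kappa>" unfolding decseq_def \<kappa>_def by (auto intro!: divide_left_mono)
  have "\<exists>eps. eps \<in> {0<..<1} \<and> g eps \<le> \<kappa> j \<and> (\<forall>i<j. \<forall>u v. dist u v \<le> eps \<longrightarrow> \<bar>\<psi> i u - \<psi> i v\<bar> \<le> \<kappa> j)" for j
  proof -
    obtain e where "e \<in> {0<..<1}"
        "e \<le> \<kappa> j \<and> g e \<le> \<kappa> j \<and> (\<forall>i<j. \<forall>u v. dist u v \<le> e \<longrightarrow> \<bar>\<psi> i u - \<psi> i v\<bar> \<le> \<kappa> j)"
      by (rule bexE[OF modulus_exists[where \<psi> = \<psi>, OF cpt \<psi>D(1) g \<kappa>[of j], where N = j]])
    then show ?thesis by (intro exI[of _ e]) simp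
  qed
  then have "\<exists>eps. \<forall>j. eps j \<in> {0<..<1} \<and> g (eps j) \<le> \<kappa> j \<and> (\<forall>i<j. \<forall>u v. dist u v \<le> eps j \<longrightarrow> \<bar>\<psi> i u - \<psi> i v\<bar> \<le> \<kappa> j)"
    by (intro choice allI)
  then obtain eps where eps: "\<forall>j. eps j \<in> {0<..<1} \<and> g (eps j) \<le> \<kappa> j \<and> (\<forall>i<j. \<forall>u v. dist u v \<le> eps j \<longrightarrow> \<bar>\<psi> i u - \<psi> i v\<bar> \<le> \<kappa> j)"
    by (elim exE)
  \<comment> \<open>Level \<open>j\<close> controls only test functions of index below
    \<open>j\<close>; since the stages tend to infinity, each test function is controlled
    eventually.\<close>
  define good where "good j A x \<longleftrightarrow> (\<forall>i<j. \<bar>(\<Sum>s\<in>A. \<psi> i (T s x) - mean (\<alpha> j) (\<psi> i))\<bar> \<le> \<kappa> j * card A)" for j A x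
  define Q where "Q j A \<longleftrightarrow> scale_inv m (eps j) A \<and> (\<exists>x. good j A x)" for j A
  have "eventually (Q j) Foelner_filter" for j
    using eventually_scale_inv[OF m, of "eps j"] eventually_empirical_approx[OF cpt act m g \<psi> inf nb \<kappa>[of j], of j]
  proof (rule eventually_elim2[of "scale_inv m (eps j)"])
    fix A
    assume 1: "scale_inv m (eps j) A"
      and 2: "\<forall>\<alpha>\<in>Minv T. \<exists>z. \<forall>i<j. \<bar>(\<Sum>s\<in>A. \<psi> i (T s z) - mean \<alpha> (\<psi> i))\<bar> \<le> \<kappa> j * card A"
    from 1 bspec[OF 2 \<alpha>[of j]] show "Q j A" unfolding Q_def good_def by (rule conjI)
  qed (use eps in auto)
  from tiling_tower[where Q = Q and \<kappa> = \<kappa>, OF nb this \<kappa>]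
  obtain \<T> where \<T>: "\<forall>j. (disjoint (\<T> j) \<and> (\<forall>A\<in>\<T> j. Q j A \<and> finite A \<and> A \<noteq> {}) \<and>
      eventually (covers (\<T> j) (\<kappa> j)) Foelner_filter) \<and> (\<forall>A\<in>\<T> (Suc j). covers (\<T> j) (\<kappa> j) A)"
    by (elim exE)
  have dj: "disjoint (\<T> j)" and ev: "eventually (covers (\<T> j) (\<kappa> j)) Foelner_filter" for j
    using \<T> by simp_all
  have Qt: "Q j A" and fin: "finite A \<and> A \<noteq> {}" if "A \<in> \<T> j" for j A
    using \<T> that by simp_all
  have cov: "covers (\<T> j) (\<kappa> j) A" if "A \<in> \<T> (Suc j)" for j A
    using \<T> that by simp
  define R where "R j H n \<longleftrightarrow> covers (\<T> (Suc (Suc j))) (\<kappa> (Suc (Suc j))) (Fn n) \<and>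
    card (Fn n \<inter> \<Union>{A\<in>\<T> j \<union> \<T> (Suc j). A \<inter> H \<noteq> {}}) \<le> \<kappa> j * card (Fn n)" for j H n
  have evR: "eventually (R j H) sequentially" if H: "finite H" for j H
  proof -
    have "\<Union>{A\<in>\<T> j \<union> \<T> (Suc j). A \<inter> H \<noteq> {}} = \<Union>{A\<in>\<T> j. A \<inter> H \<noteq> {}} \<union> \<Union>{A\<in>\<T> (Suc j). A \<inter> H \<noteq> {}}"
      by auto
    then have "finite (\<Union>{A\<in>\<T> j \<union> \<T> (Suc j). A \<inter> H \<noteq> {}})"
      using finite_meeting[OF dj _ H] fin by auto
    from eventually_card_Int_le[OF inf Fn this \<kappa>]
      eventually_compose_filterlim[OF ev Foelner_seq_filterlim[OF Fn]]
    show ?thesis unfolding R_def by (intro eventually_conj)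
  qed
  have "\<exists>N. strict_mono N \<and> (\<forall>j. \<forall>n>N j. R j (visited A0 Fn N j) n)"
    by (rule thresholds_exist[OF _ fA0 Ff(1)]) (rule evR)
  then obtain N where N: "strict_mono N" and thr: "\<forall>j. \<forall>n>N j. R j (visited A0 Fn N j) n"
    by (elim exE conjE)
  define lev where "lev = level \<T> A0 Fn N"
  have levT: "A \<in> \<T> j" if "A \<in> lev j" for j A
    using that by (simp add: lev_def level_def[where \<T> = \<T> and \<kappa> = \<kappa> and Fn = Fn, OF dj fin cov Ff(1) N \<kappa> \<kappa>dec])
  have lev_disj: "A \<inter> B = {}" if "A \<in> lev i" "B \<in> lev j" "(i, A) \<noteq> (j, B)" for i j A B
    unfolding lev_def
  proof (rule level_disjoint[where \<T> = \<T> and \<kappa> = \<kappa> and Fn = Fn, OF dj _ _ Ff(1) N \<kappa> \<kappa>dec])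
    show "A \<in> level \<T> A0 Fn N i" "B \<in> level \<T> A0 Fn N j" using that unfolding lev_def by simp_all
  qed (fact fin cov that(3))+
  have lev_A0: "A \<inter> A0 = {}" if "A \<in> lev j" for j A
    unfolding lev_def
  proof (rule level_disjoint_A0[where \<T> = \<T> and \<kappa> = \<kappa> and Fn = Fn, OF dj _ _ Ff(1) N \<kappa> \<kappa>dec])
    show "A \<in> level \<T> A0 Fn N j" using that unfolding lev_def .
  qed (fact fin cov)+
  define x where "x j A = (SOME x. good j A x)" for j A
  have x: "good j A (x j A)" if "A \<in> \<T> j" for j A
    unfolding x_def using Qt[OF that] by (auto simp: Q_def intro: someI_ex)
  \<comment> \<open>\<open>None\<close> stands for the prescribed segment on \<open>A0\<close>,
    \<open>Some (j, A)\<close> for a tile of level \<open>j\<close>, where \<open>j\<close>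
    determines the point to follow and the precision.\<close>
  define I where "I = insert None (Some ` {(j, A). A \<in> lev j})"
  define Fs where "Fs = case_option A0 (snd :: nat \<times> 'g set \<Rightarrow> 'g set)"
  have "(\<Inter>p\<in>I. Bball T g (Fs p) (case_option x0 (\<lambda>(j, A). x j A) p) (case_option e0 (\<lambda>(j, A). eps j) p)) \<noteq> {}"
  proof (rule product_scale_family[OF cpt act m])
    show "case_option e0 (\<lambda>(j, A). eps j) p \<in> {0<..<1} \<and> scale_inv m (case_option e0 (\<lambda>(j, A). eps j) p) (Fs p)"
      if p: "p \<in> I" for p
    proof (cases p)
      case None
      then show ?thesis using e0 A0 by (simp add: Fs_def)
    next
      case (Some q)
      obtain j A where q: "q = (j, A)" by (cases q)
      have "A \<in> lev j" using p by (auto simp: I_def Some q)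
      then have "scale_inv m (eps j) A" using Qt[OF levT] by (simp add: Q_def)
      then show ?thesis using eps[rule_format, of j] by (simp add: Fs_def Some q)
    qed
    fix p r assume pr: "p \<in> I" "r \<in> I" "p \<noteq> r"
    have mem: "q = None \<or> (\<exists>j A. q = Some (j, A) \<and> A \<in> lev j)" if "q \<in> I" for q
      using that by (auto simp: I_def)
    consider (Nn) j A where "p = None" "r = Some (j, A)" "A \<in> lev j"
      | (nN) j A where "r = None" "p = Some (j, A)" "A \<in> lev j"
      | (nn) i A j B where "p = Some (i, A)" "A \<in> lev i" "r = Some (j, B)" "B \<in> lev j"
      using mem[OF pr(1)] mem[OF pr(2)] pr(3) by blast
    then show "Fs p \<inter> Fs r = {}"
    proof cases
      case Nn
      then show ?thesis using lev_A0[OF Nn(3)] by (simp add: Fs_def Int_commute)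
    next
      case nN
      then show ?thesis using lev_A0[OF nN(3)] by (simp add: Fs_def)
    next
      case nn
      have "(i, A) \<noteq> (j, B)" using pr(3) nn by auto
      from lev_disj[OF nn(2,4) this] show ?thesis using nn by (simp add: Fs_def)
    qed
  qed
  then obtain z where z: "z \<in> (\<Inter>p\<in>I. Bball T g (Fs p) (case_option x0 (\<lambda>(j, A). x j A) p) (case_option e0 (\<lambda>(j, A). eps j) p))"
    by blast
  have "None \<in> I" by (simp add: I_def)
  from INT_D[OF z this] have z0: "z \<in> Bball T g A0 x0 e0" by (simp add: Fs_def)
  have zl: "z \<in> Bball T g A (x j A) (eps j)" if "A \<in> lev j" for j A
  proof -
    have "Some (j, A) \<in> I" using that by (auto simp: I_def)
    from INT_D[OF z this] show ?thesis by (simp add: Fs_def)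
  qed
  define a where "a i j = mean (\<alpha> j) (\<psi> i)" for i j
  have a01: "0 \<le> a i j" "a i j \<le> 1" for i j
    unfolding a_def using integral_dense_seq_bounds[OF cpt \<psi>, of "\<alpha> j" i] \<alpha>[of j] by (simp_all add: Minv_def)
  have tile: "\<bar>\<Sum>s\<in>A. \<psi> i (T s z) - a i j\<bar> \<le> 3 * \<kappa> j * card A" if A: "A \<in> lev j" and i: "i < j" for i j A
  proof -
    have "\<bar>\<Sum>s\<in>A. \<psi> i (T s z) - \<psi> i (T s (x j A))\<bar> \<le> 2 * \<kappa> j * card A"
      using zl[OF A] fin[OF levT[OF A]] eps i \<psi>D(2,3) \<kappa>[of j]
      by (intro Bball_sum_diff[where eps = "eps j" and g = g]) auto
    moreover have "\<bar>\<Sum>s\<in>A. \<psi> i (T s (x j A)) - a i j\<bar> \<le> \<kappa> j * card A"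
      using x[OF levT[OF A]] i by (simp add: good_def a_def)
    moreover have "(\<Sum>s\<in>A. \<psi> i (T s z) - a i j) =
        (\<Sum>s\<in>A. \<psi> i (T s z) - \<psi> i (T s (x j A))) + (\<Sum>s\<in>A. \<psi> i (T s (x j A)) - a i j)"
      by (simp add: sum.distrib[symmetric])
    ultimately show ?thesis by linarith
  qed
  \<comment> \<open>Of the 7 shares, 4 pay for the uncovered part and 3 for the tiles (2 for gluing,
    1 for the averages of the chosen points). The last term is the gap between the two measures that
    the tiles inside \<open>Fn n\<close> may follow.\<close>
  define b where "b i j = 7 * \<kappa> j + \<bar>a i j - a i (Suc j)\<bar>" for i j
  define J where "J = stage N"
  have main: "\<bar>mean (empirical T (Fn n) z) (\<psi> i) - a i (J n)\<bar> \<le> b i (J n)"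
    if n: "N 0 < n" and i: "i < J n" for i n
  proof -
    define j where "j = J n"
    define c where "c = 3 * \<kappa> j + \<bar>a i j - a i (Suc j)\<bar>"
    define S where "S = {A\<in>lev j \<union> lev (Suc j). A \<subseteq> Fn n}"
    have c0: "0 \<le> c" using \<kappa>[of j] by (simp add: c_def)
    have "N j < n" "n \<le> N (Suc j)"
      using stage_gt[OF N n] stage_le[OF N, of n] by (simp_all add: j_def J_def)
    then have Rn: "R j (visited A0 Fn N j) n" and nN: "n \<le> N (Suc j)" using thr by simp_all
    have unc: "card (Fn n - \<Union>S) \<le> 4 * \<kappa> j * card (Fn n)"
      unfolding S_def lev_def
    proof (rule stage_covered[where \<T> = \<T> and \<kappa> = \<kappa> and Fn = Fn, OF dj _ _ Ff(1) N \<kappa> \<kappa>dec nN])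
      show "covers (\<T> (Suc (Suc j))) (\<kappa> (Suc (Suc j))) (Fn n)"
        "card (Fn n \<inter> \<Union>{A\<in>\<T> j \<union> \<T> (Suc j). A \<inter> visited A0 Fn N j \<noteq> {}}) \<le> \<kappa> j * card (Fn n)"
        using Rn unfolding R_def by simp_all
    qed (fact fin cov)+
    have SF: "S \<subseteq> Pow (Fn n)" by (auto simp: S_def)
    have dS: "disjoint S" using lev_disj unfolding disjoint_def S_def by blast
    have bl: "\<bar>\<Sum>s\<in>Fn n. \<psi> i (T s z) - a i j\<bar> \<le> card (Fn n - \<Union>S) + \<bar>\<Sum>A\<in>S. \<Sum>s\<in>A. \<psi> i (T s z) - a i j\<bar>"
    proof (rule sum_blocks[OF Ff(1) SF dS])
      show "\<bar>\<psi> i (T s z) - a i j\<bar> \<le> 1" for s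
        using \<psi>D(2,3)[of i "T s z"] a01[of i j] by (simp add: abs_le_iff)
    qed
    have "\<bar>\<Sum>A\<in>S. \<Sum>s\<in>A. \<psi> i (T s z) - a i j\<bar> \<le> (\<Sum>A\<in>S. c * card A)"
    proof (rule order_trans[OF sum_abs], rule sum_mono)
      show "\<bar>\<Sum>s\<in>A. \<psi> i (T s z) - a i j\<bar> \<le> c * card A" if A: "A \<in> S" for A
      proof (cases "A \<in> lev j")
        case True
        have "3 * \<kappa> j * card A \<le> c * card A" by (intro mult_right_mono) (simp_all add: c_def)
        moreover have "i < j" using i by (simp add: j_def)
        ultimately show ?thesis using tile[OF True, of i] by linarith
      next
        case False
        then have A': "A \<in> lev (Suc j)" using A by (simp add: S_def)
        have eq: "(\<Sum>s\<in>A. \<psi> i (T s z) - a i j) = (\<Sum>s\<in>A. \<psi> i (T s z) - a i (Suc j)) + card A * (a i (Suc j) - a i j)"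
          by (simp add: sum_subtractf algebra_simps)
        have t: "\<bar>\<Sum>s\<in>A. \<psi> i (T s z) - a i (Suc j)\<bar> \<le> 3 * \<kappa> (Suc j) * card A"
          using tile[OF A'] i by (simp add: j_def)
        have "\<kappa> (Suc j) \<le> \<kappa> j" using \<kappa>dec by (simp add: decseq_def)
        then have "3 * \<kappa> (Suc j) * card A \<le> 3 * \<kappa> j * card A" by (intro mult_right_mono) simp_all
        moreover have "\<bar>card A * (a i (Suc j) - a i j)\<bar> = \<bar>a i j - a i (Suc j)\<bar> * card A"
          by (simp add: abs_mult abs_minus_commute)
        ultimately show ?thesis using t unfolding eq c_def distrib_right by linarith
      qed
    qed
    also have "... = c * real (\<Sum>A\<in>S. card A)" by (simp add: sum_distrib_left)
    also have "... \<le> c * card (Fn n)"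
      using sum_card_le(2)[OF Ff(1) SF dS] c0 by (rule mult_left_mono)
    finally have "\<bar>sum (\<lambda>s. \<psi> i (T s z) - a i j) (Fn n)\<bar> \<le> 4 * \<kappa> j * card (Fn n) + c * card (Fn n)"
      using bl unc by linarith
    also have "... = b i j * card (Fn n)" by (simp add: b_def c_def algebra_simps)
    finally have le: "\<bar>sum (\<lambda>s. \<psi> i (T s z) - a i j) (Fn n)\<bar> \<le> b i j * card (Fn n)" .
    have cpos: "real (card (Fn n)) > 0" using Ff[of n] by (simp add: card_gt_0_iff)
    have "mean (empirical T (Fn n) z) (\<psi> i) - a i j = sum (\<lambda>s. \<psi> i (T s z) - a i j) (Fn n) / card (Fn n)"
      using integral_empirical[OF Ff[of n] \<psi>D(1), where T = T and x = z] cpos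
      by (simp add: sum_subtractf diff_divide_distrib)
    then have "\<bar>mean (empirical T (Fn n) z) (\<psi> i) - a i j\<bar> = \<bar>sum (\<lambda>s. \<psi> i (T s z) - a i j) (Fn n)\<bar> / card (Fn n)"
      using cpos by simp
    also have "... \<le> b i j" using le cpos by (simp add: divide_le_eq)
    finally show ?thesis by (simp add: j_def)
  qed
  have lim: "(\<lambda>n. mean (empirical T (Fn n) z) (\<psi> i) - a i (J n)) \<longlonglongrightarrow> 0" for i
  proof (rule Lim_null_comparison)
    have J: "filterlim J at_top sequentially" unfolding J_def by (rule stage_at_top[OF N])
    have "eventually (\<lambda>n. Suc i \<le> J n) sequentially"
      using J unfolding filterlim_at_top by blast
    moreover have "eventually (\<lambda>n. N 0 < n) sequentially" by (rule eventually_gt_at_top)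
    ultimately show "eventually (\<lambda>n. norm (mean (empirical T (Fn n) z) (\<psi> i) - a i (J n)) \<le> b i (J n)) sequentially"
      by eventually_elim (simp add: main)
    have "(\<lambda>j. 7 * \<kappa> j + \<bar>a i j - a i (Suc j)\<bar>) \<longlonglongrightarrow> 7 * 0 + \<bar>0\<bar>"
    proof (intro tendsto_add tendsto_mult tendsto_const tendsto_rabs)
      show "\<kappa> \<longlonglongrightarrow> 0" unfolding \<kappa>_def[abs_def] using LIMSEQ_Suc[OF lim_1_over_n] by simp
      show "(\<lambda>j. a i j - a i (Suc j)) \<longlonglongrightarrow> 0" unfolding a_def by (rule step)
    qed
    then have "b i \<longlonglongrightarrow> 0" unfolding b_def[abs_def] by simp
    then show "(\<lambda>n. b i (J n)) \<longlonglongrightarrow> 0" using J by (rule filterlim_compose)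
  qed
  have "mono J" unfolding J_def using mono_stage[OF N] by (rule monoI)
  moreover have "surj J" unfolding surj_def J_def using stage_threshold[OF N] by metis
  ultimately show ?thesis
    using z0 lim unfolding a_def by blast
qed

subsection \<open>Entropy of saturated sets\<close>

text \<open>Weighting each word by t to the number of its nonzero letters gives total weight
  (1 + M t)^n, while every word counted here has weight at least t^(\<gamma> n).\<close>

lemma card_sparse_words:
  fixes t \<gamma> :: real and F :: "'b set" and M :: nat
  assumes F: "finite F" and t: "0 < t" "t \<le> 1"
  defines "W \<equiv> {w \<in> F \<rightarrow>\<^sub>E {..M}. card {s\<in>F. w s \<noteq> 0} \<le> \<gamma> * card F}"
  shows "finite W" "card W > 0 \<Longrightarrow> ln (card W) \<le> card F * (M * t + \<gamma> * ln (1 / t))"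
proof -
  have fP: "finite (F \<rightarrow>\<^sub>E {..M})" using F by (intro finite_PiE) auto
  then show fW: "finite W" by (auto simp: W_def)
  assume pos: "card W > 0"
  have weight: "(\<Prod>s\<in>F. if w s = 0 then 1 else t) = t ^ card {s\<in>F. w s \<noteq> 0}" for w :: "'b \<Rightarrow> nat"
  proof -
    have "(\<Prod>s\<in>F. if w s = 0 then 1 else t) = (\<Prod>s\<in>{s\<in>F. w s \<noteq> 0}. t)"
      using F by (intro prod.mono_neutral_cong_right) auto
    then show ?thesis by simp
  qed
  have "card W * t powr (\<gamma> * card F) = (\<Sum>w\<in>W. t powr (\<gamma> * card F))" by simp
  also have "... \<le> (\<Sum>w\<in>W. \<Prod>s\<in>F. if w s = 0 then 1 else t)"
  proof (rule sum_mono)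
    fix w assume w: "w \<in> W"
    have "t powr (\<gamma> * card F) \<le> t powr (real (card {s\<in>F. w s \<noteq> 0}))"
      using t w by (intro powr_mono') (auto simp: W_def)
    then show "t powr (\<gamma> * card F) \<le> (\<Prod>s\<in>F. if w s = 0 then 1 else t)"
      using t by (simp add: weight powr_realpow)
  qed
  also have "... \<le> (\<Sum>w\<in>F \<rightarrow>\<^sub>E {..M}. \<Prod>s\<in>F. if w s = 0 then 1 else t)"
    using t by (intro sum_mono2 fP prod_nonneg) (auto simp: W_def)
  also have "... = (\<Prod>s\<in>F. \<Sum>k\<le>M. if k = 0 then 1 else t)"
    using F by (subst prod_sum_PiE) auto
  also have "(\<Sum>k\<le>M. if k = 0 then 1 else t) = 1 + M * t"
    by (induction M) (simp_all add: algebra_simps)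
  finally have le: "card W * t powr (\<gamma> * card F) \<le> (1 + M * t) ^ card F" by simp
  have "ln (card W) + \<gamma> * card F * ln t = ln (card W * t powr (\<gamma> * card F))"
    using pos t by (simp add: ln_mult ln_powr)
  also have "... \<le> ln ((1 + M * t) ^ card F)"
    using le pos t by (intro ln_mono) auto
  also have "... = card F * ln (1 + M * t)"
    by (rule ln_realpow)
  also have "... \<le> card F * (M * t)"
    using t by (intro mult_left_mono ln_add_one_self_le_self) auto
  finally show "ln (card W) \<le> card F * (M * t + \<gamma> * ln (1 / t))"
    using t by (simp add: ln_div algebra_simps)
qed

text \<open>Labels start at 1 because 0 will mean that no mistake occurs.\<close>

lemma finite_cells:
  assumes cpt: "compact (UNIV :: 'a::metric_space set)" and "0 < eps"
  shows "\<exists>(M::nat) (c :: 'a \<Rightarrow> nat). (\<forall>x. 0 < c x \<and> c x \<le> M) \<and> (\<forall>x y. c x = c y \<longrightarrow> dist x y \<le> 2 * eps)"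
proof -
  obtain N where N: "finite N" "UNIV \<subseteq> (\<Union>x\<in>N. ball (x::'a) eps)"
    using cpt assms(2) unfolding compact_eq_totally_bounded by blast
  obtain h where h: "bij_betw h N {0..<card N}"
    using ex_bij_betw_finite_nat[OF N(1)] by blast
  have "\<forall>x. \<exists>p. p \<in> N \<and> x \<in> ball p eps" using N(2) by blast
  then have "\<exists>p. \<forall>x. p x \<in> N \<and> x \<in> ball (p x) eps" by (rule choice)
  then obtain p where p: "\<forall>x. p x \<in> N \<and> x \<in> ball (p x) eps" by (elim exE)
  have "h (p x) < card N" for x using bij_betwE[OF h] p by auto
  then have 1: "\<forall>x. 0 < Suc (h (p x)) \<and> Suc (h (p x)) \<le> card N" by (auto simp: Suc_le_eq)
  have 2: "\<forall>x y. Suc (h (p x)) = Suc (h (p y)) \<longrightarrow> dist x y \<le> 2 * eps"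
  proof (intro allI impI)
    fix x y assume "Suc (h (p x)) = Suc (h (p y))"
    then have eq: "p x = p y" using bij_betw_imp_inj_on[OF h] p by (auto simp: inj_on_def)
    have "dist (p x) x < eps" "dist (p x) y < eps" using p[rule_format, of x] p[rule_format, of y] eq by auto
    then show "dist x y \<le> 2 * eps" using dist_triangle2[of x y "p x"] by (simp add: dist_commute)
  qed
  show ?thesis by (rule exI[of _ "card N"], rule exI[of _ "\<lambda>x. Suc (h (p x))"]) (rule conjI[OF 1 2])
qed

text \<open>A point \<open>x\<close> is encoded by a point of \<open>E'\<close> near its shadow
  \<open>z x\<close> and by a word recording the cell of \<open>T s x\<close> at every mistake.
  Equal codes force a distance of at most \<open>e + eps + eps + e\<close> where no mistake occurs
  and \<open>2 * eps\<close> elsewhere, so the code is injective on a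
  \<open>4 * eps\<close>-separated set.\<close>

lemma sep_num_mistakes:
  fixes T :: "'g::group_add \<Rightarrow> 'a::metric_space \<Rightarrow> 'a" and c :: "'a \<Rightarrow> nat"
    and g :: "real \<Rightarrow> real"
  assumes cpt: "compact (UNIV :: 'a set)" and act: "is_action T" and F: "finite F" "F \<noteq> {}"
    and eps: "0 < eps" "e \<le> eps"
    and c: "\<forall>x. 0 < c x \<and> c x \<le> M" "\<forall>x y. c x = c y \<longrightarrow> dist x y \<le> 2 * eps"
    and Y: "\<And>x. \<exists>z\<in>Y. z \<in> Bball T g F x e"
  shows "sep_num T F UNIV (4 * eps) \<le> sep_num T F Y eps *
    card {w \<in> F \<rightarrow>\<^sub>E {..M}. card {s\<in>F. w s \<noteq> 0} \<le> g e * card F}"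
proof -
  let ?W = "{w \<in> F \<rightarrow>\<^sub>E {..M}. card {s\<in>F. w s \<noteq> 0} \<le> g e * card F}"
  have fW: "finite ?W"
    by (rule finite_subset[of _ "F \<rightarrow>\<^sub>E {..M}"]) (use F in \<open>auto intro: finite_PiE\<close>)
  have eps4: "0 < 4 * eps" using eps by simp
  obtain E where E: "E \<subseteq> UNIV" "finite E" "separated T F (4 * eps) E" "card E = sep_num T F UNIV (4 * eps)"
    by (rule sep_num_witness[OF cpt act F eps4, of UNIV])
  obtain E' where E': "E' \<subseteq> Y" "finite E'" "separated T F eps E'" "card E' = sep_num T F Y eps"
    by (rule sep_num_witness[OF cpt act F eps(1), of Y])
  have "\<exists>z. z \<in> Y \<and> z \<in> Bball T g F x e" for x using Y[of x] by blast
  then have "\<exists>z. \<forall>x. z x \<in> Y \<and> z x \<in> Bball T g F x e" by (intro choice allI)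
  then obtain z where z: "\<forall>x. z x \<in> Y \<and> z x \<in> Bball T g F x e" by (elim exE)
  have "\<exists>y. y \<in> E' \<and> dist_F T F y (z x) \<le> eps" for x
    using sep_num_spanning[OF cpt act F eps(1) E', of "z x"] z by blast
  then have "\<exists>y. \<forall>x. y x \<in> E' \<and> dist_F T F (y x) (z x) \<le> eps" by (intro choice allI)
  then obtain y where y: "\<forall>x. y x \<in> E' \<and> dist_F T F (y x) (z x) \<le> eps" by (elim exE)
  have yd: "dist (T s (y x)) (T s (z x)) \<le> eps" if "s \<in> F" for x s
    using y[rule_format, of x] that F by (simp add: dist_F_le_iff)
  define w where "w x = restrict (\<lambda>s. if dist (T s x) (T s (z x)) > e then c (T s x) else 0) F" for x
  have "inj_on (\<lambda>x. (y x, w x)) E"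
  proof (rule inj_onI, rule ccontr)
    fix x x' assume xx: "x \<in> E" "x' \<in> E" "(y x, w x) = (y x', w x')" "x \<noteq> x'"
    have "dist (T s x) (T s x') \<le> 4 * eps" if s: "s \<in> F" for s
    proof -
      have ws: "w x s = w x' s" using xx(3) by simp
      show ?thesis
      proof (cases "w x s = 0")
        case True
        have c0: "c (T s x) \<noteq> 0" "c (T s x') \<noteq> 0" using c(1) by (metis less_irrefl)+
        have d: "dist (T s x) (T s (z x)) \<le> e" "dist (T s x') (T s (z x')) \<le> e"
          using True ws s c0 by (auto simp: w_def not_less split: if_splits)
        have d': "dist (T s (y x)) (T s (z x)) \<le> eps" "dist (T s (y x)) (T s (z x')) \<le> eps"
          using yd[OF s, of x] yd[OF s, of x'] xx(3) by auto
        show ?thesis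
          using d d' eps dist_triangle2[of "T s x" "T s (y x)" "T s (z x)"]
            dist_triangle2[of "T s x'" "T s (y x)" "T s (z x')"]
            dist_triangle2[of "T s x" "T s x'" "T s (y x)"] by linarith
      next
        case False
        then have "w x s = c (T s x)" "w x' s = c (T s x')"
          using ws s by (auto simp: w_def split: if_splits)
        then have "dist (T s x) (T s x') \<le> 2 * eps" using ws c(2) by simp
        then show ?thesis using eps by simp
      qed
    qed
    then have "dist_F T F x x' \<le> 4 * eps" using F by (simp add: dist_F_le_iff)
    moreover have "dist_F T F x x' > 4 * eps" using E(3) xx unfolding separated_def by blast
    ultimately show False by simp
  qed
  moreover have "(\<lambda>x. (y x, w x)) ` E \<subseteq> E' \<times> ?W"
  proof -
    have "w x \<in> ?W" for x
    proof -
      have "w x \<in> F \<rightarrow>\<^sub>E {..M}" using c(1) by (auto simp: w_def)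
      moreover have "{s\<in>F. w x s \<noteq> 0} \<subseteq> {s\<in>F. dist (T s x) (T s (z x)) > e}"
        by (auto simp: w_def)
      then have "card {s\<in>F. w x s \<noteq> 0} \<le> card {s\<in>F. dist (T s x) (T s (z x)) > e}"
        using F by (intro card_mono) auto
      moreover have "card {s\<in>F. dist (T s x) (T s (z x)) > e} \<le> g e * card F"
        using z by (simp add: Bball_def)
      ultimately show ?thesis by simp
    qed
    then show ?thesis using y by auto
  qed
  ultimately have "card E \<le> card (E' \<times> ?W)"
    using E'(2) fW by (intro card_inj_on_le) auto
  then show ?thesis using E(4) E'(4) by (simp add: card_cartesian_product)
qed

text \<open>The mistake words contribute at most the rate \<open>M * t + g e * ln (1 / t)\<close>.
  The number \<open>M\<close> of cells is fixed by \<open>eps\<close>; then \<open>t\<close> is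
  chosen small, and \<open>e\<close> last, so that both terms are at most half of
  \<open>\<kappa>\<close>.\<close>

lemma sep_rate_le_of_shadowing:
  fixes T :: "'g::group_add \<Rightarrow> 'a::metric_space \<Rightarrow> 'a"
  assumes cpt: "compact (UNIV :: 'a set)" and act: "is_action T" and Fn: "Foelner_seq Fn"
    and g: "mistake_density g" and eps: "0 < eps"
    and shadow: "\<And>e. e \<in> {0<..<1} \<Longrightarrow> eventually (\<lambda>n. \<forall>x. \<exists>z\<in>Y. z \<in> Bball T g (Fn n) x e) sequentially"
  shows "sep_rate T UNIV Fn (4 * eps) \<le> sep_rate T Y Fn eps"
proof (rule ereal_le_epsilon2)
  fix \<kappa> :: real assume \<kappa>: "0 < \<kappa>"
  note Ff = Foelner_seq_finite[OF cpt act Fn]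
  obtain M :: nat and c :: "'a \<Rightarrow> nat" where c: "\<forall>x. 0 < c x \<and> c x \<le> M" "\<forall>x y. c x = c y \<longrightarrow> dist x y \<le> 2 * eps"
    using finite_cells[OF cpt eps] by (elim exE conjE)
  define t where "t = min 1 (\<kappa> / (2 * (M + 1)))"
  have t: "0 < t" "t \<le> 1" "t \<le> \<kappa> / (2 * (M + 1))" using \<kappa> by (simp_all add: t_def)
  have "M * t \<le> (M + 1) * t" using t by simp
  also have "... \<le> \<kappa> / 2" using t(3) by (simp add: field_simps)
  finally have Mt: "M * t \<le> \<kappa> / 2" .
  define l where "l = ln (1 / t)"
  have l: "0 \<le> l" using t by (simp add: l_def)
  define \<kappa>' where "\<kappa>' = min eps (\<kappa> / (2 * (l + 1)))"
  have \<kappa>': "0 < \<kappa>'" "\<kappa>' \<le> eps" "\<kappa>' \<le> \<kappa> / (2 * (l + 1))" using \<kappa> eps l by (simp_all add: \<kappa>'_def)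
  \<comment> \<open>With \<open>N = 0\<close> the clause on test functions is empty; what is wanted
    is that \<open>e\<close> and \<open>g e\<close> are small.\<close>
  obtain e where e: "e \<in> {0<..<1}" and e': "e \<le> \<kappa>' \<and> g e \<le> \<kappa>' \<and> (\<forall>i<0. \<forall>u v :: 'a. dist u v \<le> e \<longrightarrow> \<bar>0 - 0\<bar> \<le> \<kappa>')"
    by (rule bexE[OF modulus_exists[where \<psi> = "\<lambda>_ _. 0", OF cpt _ g \<kappa>'(1), where N = 0]]) (auto)
  have "g e * l \<le> \<kappa>' * (l + 1)"
    using e' l \<kappa>' by (intro mult_mono) auto
  also have "... \<le> \<kappa> / 2" using \<kappa>'(3) l by (simp add: field_simps)
  finally have gl: "g e * l \<le> \<kappa> / 2" .
  have "eventually (\<lambda>n. ereal (ln (real (sep_num T (Fn n) UNIV (4 * eps))) / real (card (Fn n)))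
      \<le> ereal (ln (real (sep_num T (Fn n) Y eps)) / real (card (Fn n))) + ereal \<kappa>) sequentially"
    using shadow[OF e]
  proof eventually_elim
    case (elim n)
    define W where "W = {w \<in> Fn n \<rightarrow>\<^sub>E {..M}. card {s\<in>Fn n. w s \<noteq> 0} \<le> g e * card (Fn n)}"
    have cF: "real (card (Fn n)) > 0" using Ff[of n] by (simp add: card_gt_0_iff)
    have "sep_num T (Fn n) UNIV (4 * eps) \<le> sep_num T (Fn n) Y eps * card W"
      unfolding W_def using elim eps e' \<kappa>'(2) by (intro sep_num_mistakes[OF cpt act Ff _ _ c]) auto
    \<comment> \<open>A one-point set is separated, so all counts are positive and the logarithm of
      the product splits.\<close>
    moreover have "card {undefined :: 'a} \<le> sep_num T (Fn n) UNIV (4 * eps)"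
      using eps by (intro card_le_sep_num[OF cpt act Ff]) (auto simp: separated_def)
    ultimately have le: "sep_num T (Fn n) UNIV (4 * eps) \<le> sep_num T (Fn n) Y eps * card W"
      and pos: "sep_num T (Fn n) UNIV (4 * eps) > 0" by simp_all
    then have posW: "card W > 0" "sep_num T (Fn n) Y eps > 0" by (auto intro: Nat.gr0I)
    have "real (sep_num T (Fn n) UNIV (4 * eps)) \<le> real (sep_num T (Fn n) Y eps) * real (card W)"
      using le by (simp flip: of_nat_mult)
    then have "ln (real (sep_num T (Fn n) UNIV (4 * eps))) \<le> ln (real (sep_num T (Fn n) Y eps) * real (card W))"
      using pos posW by (intro ln_mono) auto
    also have "... = ln (real (sep_num T (Fn n) Y eps)) + ln (real (card W))"
      using posW by (intro ln_mult_pos) auto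
    also have "ln (real (card W)) \<le> card (Fn n) * (M * t + g e * l)"
      using card_sparse_words(2)[OF Ff(1) t(1,2), of n M "g e"] posW unfolding W_def l_def by simp
    also have "... \<le> card (Fn n) * \<kappa>"
      using Mt gl by (intro mult_left_mono) auto
    finally have "ln (real (sep_num T (Fn n) UNIV (4 * eps))) \<le> ln (real (sep_num T (Fn n) Y eps)) + card (Fn n) * \<kappa>"
      by simp
    then have "ln (real (sep_num T (Fn n) UNIV (4 * eps))) / real (card (Fn n)) \<le>
        (ln (real (sep_num T (Fn n) Y eps)) + card (Fn n) * \<kappa>) / card (Fn n)"
      using cF by (intro divide_right_mono) auto
    then show ?case using cF by (simp add: add_divide_distrib)
  qed
  then have "sep_rate T UNIV Fn (4 * eps) \<le>
      limsup (\<lambda>n. ereal (ln (real (sep_num T (Fn n) Y eps)) / real (card (Fn n))) + ereal \<kappa>)"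
    unfolding sep_rate_def by (rule Limsup_mono)
  also have "... = sep_rate T Y Fn eps + ereal \<kappa>"
    unfolding sep_rate_def by (rule Limsup_add_ereal_right) simp_all
  finally show "sep_rate T UNIV Fn (4 * eps) \<le> sep_rate T Y Fn eps + ereal \<kappa>" .
qed

text \<open>Along any subsequence, the empirical measures and the measures
  \<open>\<alpha> (J n)\<close> have the same limits of integrals. So every limit point lies in
  \<open>K\<close>, and a subsequence of \<open>\<alpha>\<close> converging to a point of
  \<open>K\<close> is realised by lifting it through \<open>J\<close>.\<close>

lemma saturated_memI:
  fixes T :: "'g \<Rightarrow> 'a::metric_space \<Rightarrow> 'a"
  assumes cpt: "compact (UNIV :: 'a set)" and \<psi>: "dense_seq \<psi>"
    and Ff: "\<And>n. finite (Fn n)" "\<And>n. Fn n \<noteq> {}" and K: "K \<subseteq> Mprob"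
    and dense: "\<And>\<mu>. \<mu> \<in> K \<Longrightarrow> \<exists>s. strict_mono s \<and> (\<forall>i. (\<lambda>n. mean (\<alpha> (s n)) (\<psi> i)) \<longlonglongrightarrow> mean \<mu> (\<psi> i))"
    and closed: "\<And>\<mu> s. \<mu> \<in> Mprob \<Longrightarrow> (\<And>i. (\<lambda>n. mean (\<alpha> (s n)) (\<psi> i)) \<longlonglongrightarrow> mean \<mu> (\<psi> i)) \<Longrightarrow> \<mu> \<in> K"
    and J: "mono J" "surj J"
    and lim: "\<And>i. (\<lambda>n. mean (empirical T (Fn n) z) (\<psi> i) - mean (\<alpha> (J n)) (\<psi> i)) \<longlonglongrightarrow> 0"
  shows "z \<in> saturated T Fn K"
proof -
  have emp: "empirical T (Fn n) z \<in> Mprob" for n by (rule empirical_Mprob[OF Ff])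
  have iff: "limitin weak_star (\<lambda>n. empirical T (Fn (r n)) z) \<mu> sequentially \<longleftrightarrow>
      (\<forall>i. (\<lambda>n. mean (empirical T (Fn (r n)) z) (\<psi> i)) \<longlonglongrightarrow> mean \<mu> (\<psi> i))" if "\<mu> \<in> Mprob" for r \<mu>
    by (rule limitin_weak_star_dense_seq[OF cpt \<psi> emp that])
  have sub: "(\<lambda>n. mean (empirical T (Fn (r n)) z) (\<psi> i) - mean (\<alpha> (J (r n))) (\<psi> i)) \<longlonglongrightarrow> 0"
    if "strict_mono r" for r i
    using LIMSEQ_subseq_LIMSEQ[OF lim that] by (simp add: o_def)
  have "\<mu> \<in> K" if \<mu>: "\<mu> \<in> Vlimits T z Fn" for \<mu>
  proof -
    from \<mu> obtain r where \<mu>M: "\<mu> \<in> Mprob" and r: "strict_mono r"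
      "limitin weak_star (\<lambda>n. empirical T (Fn (r n)) z) \<mu> sequentially"
      unfolding Vlimits_def by blast
    show ?thesis
    proof (rule closed[OF \<mu>M, of "\<lambda>n. J (r n)"])
      fix i
      have "(\<lambda>n. mean (empirical T (Fn (r n)) z) (\<psi> i)) \<longlonglongrightarrow> mean \<mu> (\<psi> i)"
        using iff[OF \<mu>M] r(2) by simp
      from tendsto_diff[OF this sub[OF r(1), of i]]
      show "(\<lambda>n. mean (\<alpha> (J (r n))) (\<psi> i)) \<longlonglongrightarrow> mean \<mu> (\<psi> i)" by simp
    qed
  qed
  moreover have "\<mu> \<in> Vlimits T z Fn" if \<mu>: "\<mu> \<in> K" for \<mu>
  proof -
    obtain s where s: "strict_mono s" "\<forall>i. (\<lambda>n. mean (\<alpha> (s n)) (\<psi> i)) \<longlonglongrightarrow> mean \<mu> (\<psi> i)"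
      using dense[OF \<mu>] by (elim exE conjE)
    \<comment> \<open>Preimages under a monotone surjection: as \<open>s\<close> increases strictly,
      so does \<open>r\<close>.\<close>
    define r where "r n = inv J (s n)" for n
    have Jr: "J (r n) = s n" for n unfolding r_def by (rule surj_f_inv_f[OF J(2)])
    have "strict_mono r"
      unfolding strict_mono_Suc_iff
    proof (rule allI, rule ccontr)
      fix n assume "\<not> r n < r (Suc n)"
      then have "J (r (Suc n)) \<le> J (r n)" using J(1) by (simp add: monoD)
      moreover have "s n < s (Suc n)" using s(1) by (simp add: strict_mono_Suc_iff)
      ultimately show False by (simp add: Jr)
    qed
    moreover have "(\<lambda>n. mean (empirical T (Fn (r n)) z) (\<psi> i)) \<longlonglongrightarrow> mean \<mu> (\<psi> i)" for i
      using tendsto_add[OF sub[OF calculation, of i] s(2)[rule_format, of i]] by (simp add: Jr)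
    moreover have "\<mu> \<in> Mprob" using K \<mu> by blast
    ultimately show ?thesis using iff[of \<mu> r] unfolding Vlimits_def by blast
  qed
  ultimately show ?thesis unfolding saturated_def by blast
qed

theorem theorem1p1:
  fixes T :: "'g::{group_add,countable} \<Rightarrow> 'a::metric_space \<Rightarrow> 'a"
    and \<phi> :: "nat \<Rightarrow> 'a \<Rightarrow> real"
    and g :: "real \<Rightarrow> real"
    and K :: "'a measure set"
    and Fn :: "nat \<Rightarrow> 'g set"
  assumes "compact (UNIV :: 'a set)"
    and "\<forall>i. continuous_on UNIV (\<phi> i) \<and> (\<forall>x. 0 \<le> \<phi> i x \<and> \<phi> i x \<le> 1)"
    and "\<forall>x y. x \<noteq> y \<longrightarrow> (\<exists>i. \<phi> i x \<noteq> \<phi> i y)"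
    and "\<forall>x y. dist x y = (\<Sum>i. (1/2) ^ Suc i * \<bar>\<phi> i x - \<phi> i y\<bar>)"
    and "infinite (UNIV :: 'g set)"
    and "amenable_group TYPE('g)"
    and "is_action T"
    and "mistake_density g"
    and "g_almost_product T g"
    and "K \<subseteq> Minv T" and "K \<noteq> {}"
    and "compactin weak_star K" and "connectedin weak_star K"
    and "Foelner_seq Fn"
  shows "hUC T (saturated T Fn K) Fn = hUC T UNIV Fn \<and> hUC T UNIV Fn = htop T"
proof -
  note cpt = assms(1) and act = assms(7) and g = assms(8) and Fn = assms(14)
  let ?Y = "saturated T Fn K"
  have "\<exists>\<psi> :: nat \<Rightarrow> 'a \<Rightarrow> real. dense_seq \<psi>"
    by (rule dense_seq_exists[of \<phi>, OF cpt]) (use assms(2,3) in auto)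
  then obtain \<psi> :: "nat \<Rightarrow> 'a \<Rightarrow> real" where \<psi>: "dense_seq \<psi>" by (elim exE)
  obtain m where m: "product_scale T g m"
    using assms(9) unfolding g_almost_product_def product_scale_def by (elim exE)
  have KM: "K \<subseteq> Mprob" using assms(10) by (auto simp: Minv_def)
  obtain \<alpha> where \<alpha>: "\<And>j. \<alpha> j \<in> K"
    "\<And>i. (\<lambda>j. mean (\<alpha> j) (\<psi> i) - mean (\<alpha> (Suc j)) (\<psi> i)) \<longlonglongrightarrow> 0"
    "\<And>\<mu>. \<mu> \<in> K \<Longrightarrow> \<exists>s. strict_mono s \<and> (\<forall>i. (\<lambda>n. mean (\<alpha> (s n)) (\<psi> i)) \<longlonglongrightarrow> mean \<mu> (\<psi> i))"
    "\<And>\<mu> s. \<mu> \<in> Mprob \<Longrightarrow> (\<And>i. (\<lambda>n. mean (\<alpha> (s n)) (\<psi> i)) \<longlonglongrightarrow> mean \<mu> (\<psi> i)) \<Longrightarrow> \<mu> \<in> K"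
    using measure_sequence_exists[OF cpt \<psi> KM assms(11,12,13)] by blast
  have Ff: "finite (Fn n)" "Fn n \<noteq> {}" for n
    by (rule Foelner_seq_finite[OF cpt act Fn])+
  have \<alpha>I: "\<alpha> j \<in> Minv T" for j using \<alpha>(1) assms(10) by blast
  \<comment> \<open>The prescribed set is \<open>Fn n\<close> itself, once it is invariant enough
    for precision \<open>e\<close>. The saturated point may depend on \<open>n\<close> and
    \<open>x\<close>, since separated points are counted for each \<open>n\<close> on its
    own.\<close>
  have shadow: "eventually (\<lambda>n. \<forall>x. \<exists>z\<in>?Y. z \<in> Bball T g (Fn n) x e) sequentially"
    if e: "e \<in> {0<..<1}" for e
    using eventually_compose_filterlim[OF eventually_scale_inv[OF m e] Foelner_seq_filterlim[OF Fn]]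
  proof eventually_elim
    case (elim n)
    show ?case
    proof
      fix x
      obtain z where z: "z \<in> Bball T g (Fn n) x e" and "\<exists>J. mono J \<and> surj J \<and>
          (\<forall>i. (\<lambda>n. mean (empirical T (Fn n) z) (\<psi> i) - mean (\<alpha> (J n)) (\<psi> i)) \<longlonglongrightarrow> 0)"
        by (rule bexE[OF saturating_point[where \<alpha> = \<alpha> and \<psi> = \<psi>, OF cpt act m g \<psi> assms(5) Fn \<alpha>I \<alpha>(2) e elim]])
      then obtain J where J: "mono J" "surj J"
        "\<And>i. (\<lambda>n. mean (empirical T (Fn n) z) (\<psi> i) - mean (\<alpha> (J n)) (\<psi> i)) \<longlonglongrightarrow> 0"
        by blast
      have "z \<in> ?Y"
        by (rule saturated_memI[where \<alpha> = \<alpha> and \<psi> = \<psi>, OF cpt \<psi> Ff KM \<alpha>(3) \<alpha>(4) J]) assumption+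
      then show "\<exists>z\<in>?Y. z \<in> Bball T g (Fn n) x e" using z by blast
    qed
  qed
  have "hUC T ?Y Fn = hUC T UNIV Fn"
    unfolding hUC_eq_SUP[OF cpt act Fn]
  proof (rule SUP_eq)
    fix eps :: real assume "eps \<in> {0<..}"
    then show "\<exists>eps'\<in>{0<..}. sep_rate T ?Y Fn eps \<le> sep_rate T UNIV Fn eps'"
      using sep_rate_mono[OF cpt act Fn, of eps ?Y UNIV] by auto
  next
    fix eps :: real assume "eps \<in> {0<..}"
    \<comment> \<open>The shadowing estimate loses a factor 4 in the scale, which the supremum over
      all scales absorbs.\<close>
    then have "0 < eps / 4" by simp
    from sep_rate_le_of_shadowing[OF cpt act Fn g this shadow]
    show "\<exists>eps'\<in>{0<..}. sep_rate T UNIV Fn eps \<le> sep_rate T ?Y Fn eps'"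
      using \<open>0 < eps / 4\<close> by (intro bexI[of _ "eps / 4"]) auto
  qed
  then show ?thesis
    using hUC_UNIV_eq_htop[OF cpt act Fn] by (rule conjI)
qed

end
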